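(* The maximum common edge subgraph problem (MCES) is $\mathsf{NP}$-hard even when restricted to inputs in which both graphs are edge-labeled paths.
   Context: Graphs are finite, simple and undirected. An edge-labeled path is a path graph together with an assignment of a label from a finite alphabet $\Sigma$ to each edge. A common subgraph of $G_1$ and $G_2$ is a (not necessarily induced, not necessarily connected) subgraph of $G_1$ that is isomorphic to a subgraph of $G_2$, where isomorphisms must preserve labels. $\mathrm{MCES}(G_1,G_2)$ is the maximum number of edges in a common subgraph of $G_1$ and $G_2$, and the MCES problem is to compute this number. $\mathsf{NP}$-hardness refers to the associated decision problem: given $G_1,G_2$ and an integer $K$, decide whether $\mathrm{MCES}(G_1,G_2)\ge K$. *)

theory Defs
  imports Main "HOL-Computational_Algebra.Polynomial"
begin

section \<open>Edge-labeled graphs and maximum common edge subgraphs\<close>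

record ('v, 'l) lgraph =
  verts :: "'v set"
  edges :: "'v set set"
  lab :: "'v set \<Rightarrow> 'l"  \<comment> \<open>relevant on \<open>edges\<close> only\<close>

definition wf_lgraph :: "('v, 'l) lgraph \<Rightarrow> bool" where
  "wf_lgraph G \<longleftrightarrow> finite (verts G) \<and> (\<forall>e\<in>edges G. e \<subseteq> verts G \<and> card e = 2)"

definition subgraph :: "('v, 'l) lgraph \<Rightarrow> ('v, 'l) lgraph \<Rightarrow> bool" where
  "subgraph H G \<longleftrightarrow> wf_lgraph H \<and> verts H \<subseteq> verts G \<and> edges H \<subseteq> edges G \<and>
     (\<forall>e\<in>edges H. lab H e = lab G e)"

definition lgraph_iso :: "('v \<Rightarrow> 'w) \<Rightarrow> ('v, 'l) lgraph \<Rightarrow> ('w, 'l) lgraph \<Rightarrow> bool" where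
  "lgraph_iso \<phi> G H \<longleftrightarrow> bij_betw \<phi> (verts G) (verts H) \<and>
     (\<forall>u\<in>verts G. \<forall>v\<in>verts G. {u, v} \<in> edges G \<longleftrightarrow> {\<phi> u, \<phi> v} \<in> edges H) \<and>
     (\<forall>e\<in>edges G. lab H (\<phi> ` e) = lab G e)"

definition common_subgraph ::
  "('v, 'l) lgraph \<Rightarrow> ('v, 'l) lgraph \<Rightarrow> ('w, 'l) lgraph \<Rightarrow> bool" where
  "common_subgraph S G H \<longleftrightarrow> subgraph S G \<and> (\<exists>T \<phi>. subgraph T H \<and> lgraph_iso \<phi> S T)"

definition MCES :: "('v, 'l) lgraph \<Rightarrow> ('w, 'l) lgraph \<Rightarrow> nat" where
  "MCES G H = Max {card (edges S) | S. common_subgraph S G H}"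

definition is_path :: "('v, 'l) lgraph \<Rightarrow> bool" where
  "is_path G \<longleftrightarrow> (\<exists>vs. vs \<noteq> [] \<and> distinct vs \<and> verts G = set vs \<and>
     edges G = {{vs ! i, vs ! Suc i} | i. Suc i < length vs})"

text \<open>The maximum in \<open>MCES\<close> is attained.\<close>

lemma finite_edges: "wf_lgraph G \<Longrightarrow> finite (edges G)"
  unfolding wf_lgraph_def by (rule finite_subset[of _ "Pow (verts G)"]) auto

lemma common_subgraph_sizes:
  assumes "wf_lgraph G"
  shows "finite {card (edges S) | S. common_subgraph S G H}"
    and "{card (edges S) | S. common_subgraph S G H} \<noteq> {}"
proof -
  have "card (edges S) \<le> card (edges G)" if "common_subgraph S G H" for S
    using that finite_edges[OF assms]
    by (auto simp: common_subgraph_def subgraph_def intro: card_mono)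
  then have "{card (edges S) | S. common_subgraph S G H} \<subseteq> {..card (edges G)}"
    by auto
  then show "finite {card (edges S) | S. common_subgraph S G H}"
    by (rule finite_subset) simp
  have "common_subgraph \<lparr>verts = {}, edges = {}, lab = lab G\<rparr> G H"
    unfolding common_subgraph_def
  proof (intro conjI exI)
    show "subgraph \<lparr>verts = {}, edges = {}, lab = lab G\<rparr> G"
      and "subgraph \<lparr>verts = {}, edges = {}, lab = lab H\<rparr> H"
      by (simp_all add: subgraph_def wf_lgraph_def)
    show "lgraph_iso undefined \<lparr>verts = {}, edges = {}, lab = lab G\<rparr>
        \<lparr>verts = {}, edges = {}, lab = lab H\<rparr>"
      by (simp add: lgraph_iso_def bij_betw_def)
  qed
  then show "{card (edges S) | S. common_subgraph S G H} \<noteq> {}"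
    by blast
qed

lemma is_path_wf:
  assumes "is_path G"
  shows "wf_lgraph G"
proof -
  from assms obtain vs where vs: "distinct vs" "verts G = set vs"
    "edges G = {{vs ! i, vs ! Suc i} | i. Suc i < length vs}"
    unfolding is_path_def by blast
  have "card {vs ! i, vs ! Suc i} = 2" if "Suc i < length vs" for i
    using that vs(1) by (simp add: nth_eq_iff_index_eq)
  then show ?thesis
    using vs by (auto simp: wf_lgraph_def)
qed


section \<open>Polynomial-time computable functions on bit strings\<close>

text \<open>
  Deterministic multi-tape Turing machines. Tapes are infinite in both directions; symbol 0 is
  the blank, symbols 1 and 2 represent the bits. State 0 is the start state and state 1 is the
  halting state. A word starts at cell 0 and extends to the first blank; the first tape holds
  the input, the last tape holds the output.
\<close>

datatype move = Left | Stay | Right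

record tm =
  num_tapes :: nat
  num_syms :: nat
  num_states :: nat
  delta :: "nat \<Rightarrow> nat list \<Rightarrow> nat \<times> (nat \<times> move) list"
    \<comment> \<open>state and scanned symbols to new state and one action (write, then move) per tape\<close>

definition wf_tm :: "tm \<Rightarrow> bool" where
  "wf_tm M \<longleftrightarrow> num_tapes M \<ge> 1 \<and> num_syms M \<ge> 3 \<and> num_states M \<ge> 2 \<and>
     (\<forall>q rs. q < num_states M \<and> length rs = num_tapes M \<and> (\<forall>a\<in>set rs. a < num_syms M) \<longrightarrow>
        (case delta M q rs of (q', acts) \<Rightarrow>
           q' < num_states M \<and> length acts = num_tapes M \<and> (\<forall>(a, m)\<in>set acts. a < num_syms M)))"

type_synonym tape = "(int \<Rightarrow> nat) \<times> int"  \<comment> \<open>contents and head position\<close>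
type_synonym config = "nat \<times> tape list"

fun offset :: "move \<Rightarrow> int" where
  "offset Left = -1"
| "offset Stay = 0"
| "offset Right = 1"

fun act :: "nat \<times> move \<Rightarrow> tape \<Rightarrow> tape" where
  "act (a, m) (t, h) = (t(h := a), h + offset m)"

fun step :: "tm \<Rightarrow> config \<Rightarrow> config" where
  "step M (q, ts) =
     (if q = 1 then (q, ts)
      else case delta M q (map (\<lambda>(t, h). t h) ts) of (q', acts) \<Rightarrow> (q', map2 act acts ts))"

definition sym_of_bit :: "bool \<Rightarrow> nat" where
  "sym_of_bit b = (if b then 2 else 1)"

definition word_tape :: "bool list \<Rightarrow> int \<Rightarrow> nat" where
  "word_tape x i = (if 0 \<le> i \<and> i < int (length x) then sym_of_bit (x ! nat i) else 0)"

definition initial :: "tm \<Rightarrow> bool list \<Rightarrow> config" where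
  "initial M x = (0, (word_tape x, 0) # replicate (num_tapes M - 1) (word_tape [], 0))"

text \<open>The contents to the left of cell 0 and beyond the first blank are not part of the output.\<close>

definition holds_word :: "(int \<Rightarrow> nat) \<Rightarrow> bool list \<Rightarrow> bool" where
  "holds_word t y \<longleftrightarrow> (\<forall>i<length y. t (int i) = sym_of_bit (y ! i)) \<and> t (int (length y)) = 0"

definition halts_with :: "config \<Rightarrow> bool list \<Rightarrow> bool" where
  "halts_with c y \<longleftrightarrow> fst c = 1 \<and> holds_word (fst (last (snd c))) y"

definition poly_time :: "(bool list \<Rightarrow> bool list) \<Rightarrow> bool" where
  "poly_time f \<longleftrightarrow> (\<exists>M (p :: nat poly). wf_tm M \<and>
     (\<forall>x. \<exists>t \<le> poly p (length x). halts_with ((step M ^^ t) (initial M x)) (f x)))"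


section \<open>Encodings\<close>

text \<open>
  A list is written with a \<^term>\<open>True\<close> in front of every element and a \<^term>\<open>False\<close> at the end.
  This is self-delimiting whenever the element encoding is, so encodings can be concatenated.
\<close>

definition enc_list :: "('a \<Rightarrow> bool list) \<Rightarrow> 'a list \<Rightarrow> bool list" where
  "enc_list f xs = concat (map (\<lambda>x. True # f x) xs) @ [False]"

definition enc_word :: "bool list \<Rightarrow> bool list" where
  "enc_word = enc_list (\<lambda>b. [b])"

definition enc_pair :: "bool list \<Rightarrow> bool list \<Rightarrow> bool list" where
  "enc_pair x u = enc_word x @ u"

text \<open>
  In inputs, vertices and labels are named by arbitrary bit strings, so the label alphabet is a
  finite set that may differ from input to input.
\<close>

type_synonym edge_entry = "bool list \<times> bool list \<times> bool list"  \<comment> \<open>two ends and label\<close>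

definition lists_graph ::
  "bool list list \<Rightarrow> edge_entry list \<Rightarrow> (bool list, bool list) lgraph \<Rightarrow> bool" where
  "lists_graph vs es G \<longleftrightarrow>
     distinct vs \<and> set vs = verts G \<and>
     distinct (map (\<lambda>(u, v, l). {u, v}) es) \<and> {{u, v} | u v l. (u, v, l) \<in> set es} = edges G \<and>
     (\<forall>(u, v, l)\<in>set es. lab G {u, v} = l)"

definition enc_graph :: "bool list list \<Rightarrow> edge_entry list \<Rightarrow> bool list" where
  "enc_graph vs es =
     enc_list enc_word vs @ enc_list (\<lambda>(u, v, l). enc_word u @ enc_word v @ enc_word l) es"

text \<open>The threshold \<open>K\<close> is written in binary, least significant bit first.\<close>

definition encodes_input ::
  "bool list \<Rightarrow> (bool list, bool list) lgraph \<Rightarrow> (bool list, bool list) lgraph \<Rightarrow> nat \<Rightarrow> bool" where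
  "encodes_input w G H K \<longleftrightarrow> wf_lgraph G \<and> wf_lgraph H \<and>
     (\<exists>vs es vs' es' ks. lists_graph vs es G \<and> lists_graph vs' es' H \<and>
        K = horner_sum of_bool 2 ks \<and>
        w = enc_graph vs es @ enc_graph vs' es' @ enc_word ks)"

text \<open>An input determines the two graphs, up to labels of non-edges, and the threshold.\<close>

lemma enc_list_inject:
  assumes "\<And>x y r s. f x @ r = f y @ s \<Longrightarrow> x = y \<and> r = s"
  shows "enc_list f xs @ r = enc_list f ys @ s \<longleftrightarrow> xs = ys \<and> r = s"
proof (induction xs arbitrary: ys)
  case Nil
  then show ?case by (cases ys) (auto simp: enc_list_def)
next
  case (Cons x xs)
  have unfold: "enc_list f (z # zs) @ q = True # f z @ enc_list f zs @ q" for z zs q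
    by (simp add: enc_list_def)
  show ?case
  proof (cases ys)
    case Nil
    then show ?thesis by (simp add: enc_list_def)
  next
    case ys: (Cons y zs)
    show ?thesis
      unfolding ys unfold
      using Cons.IH[of zs] assms[of x "enc_list f xs @ r" y "enc_list f zs @ s"] by auto
  qed
qed

lemma enc_word_inject: "enc_word x @ r = enc_word y @ s \<longleftrightarrow> x = y \<and> r = s"
  unfolding enc_word_def by (rule enc_list_inject) simp

lemma enc_graph_inject:
  "enc_graph vs es @ r = enc_graph vs' es' @ s \<longleftrightarrow> vs = vs' \<and> es = es' \<and> r = s"
proof -
  have "enc_list enc_word vs @ r = enc_list enc_word vs' @ s \<longleftrightarrow> vs = vs' \<and> r = s" for r s
    by (rule enc_list_inject) (simp add: enc_word_inject)
  moreover have "enc_list (\<lambda>(u, v, l). enc_word u @ enc_word v @ enc_word l) es @ r =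
      enc_list (\<lambda>(u, v, l). enc_word u @ enc_word v @ enc_word l) es' @ s \<longleftrightarrow> es = es' \<and> r = s"
    for r s
    by (rule enc_list_inject) (auto simp: enc_word_inject)
  ultimately show ?thesis
    by (simp add: enc_graph_def)
qed

lemma lists_graph_unique:
  assumes "lists_graph vs es G" "lists_graph vs es G'"
  shows "verts G = verts G' \<and> edges G = edges G' \<and> (\<forall>e\<in>edges G. lab G e = lab G' e)"
proof -
  have G: "set vs = verts G" "{{u, v} | u v l. (u, v, l) \<in> set es} = edges G"
      "\<forall>(u, v, l)\<in>set es. lab G {u, v} = l"
    using assms(1)[unfolded lists_graph_def] by - (elim conjE, assumption)+
  have G': "set vs = verts G'" "{{u, v} | u v l. (u, v, l) \<in> set es} = edges G'"
      "\<forall>(u, v, l)\<in>set es. lab G' {u, v} = l"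
    using assms(2)[unfolded lists_graph_def] by - (elim conjE, assumption)+
  have "lab G e = lab G' e" if "e \<in> edges G" for e
  proof -
    obtain u v l where e: "e = {u, v}" "(u, v, l) \<in> set es"
      using \<open>e \<in> edges G\<close>[folded G(2)] by auto
    show ?thesis
      using G(3)[THEN bspec, OF e(2)] G'(3)[THEN bspec, OF e(2)] e(1) by simp
  qed
  then show ?thesis
    using trans[OF G(1)[symmetric] G'(1)] trans[OF G(2)[symmetric] G'(2)] by simp
qed

lemma encodes_input_unique:
  assumes "encodes_input w G H K" "encodes_input w G' H' K'"
  shows "verts G = verts G' \<and> edges G = edges G' \<and> (\<forall>e\<in>edges G. lab G e = lab G' e)"
    and "verts H = verts H' \<and> edges H = edges H' \<and> (\<forall>e\<in>edges H. lab H e = lab H' e)"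
    and "K = K'"
proof -
  from assms(1) obtain vs es vs' es' ks where 1:
    "lists_graph vs es G" "lists_graph vs' es' H" "K = horner_sum of_bool 2 ks"
    "w = enc_graph vs es @ enc_graph vs' es' @ enc_word ks"
    unfolding encodes_input_def by blast
  from assms(2) obtain us fs us' fs' js where 2:
    "lists_graph us fs G'" "lists_graph us' fs' H'" "K' = horner_sum of_bool 2 js"
    "w = enc_graph us fs @ enc_graph us' fs' @ enc_word js"
    unfolding encodes_input_def by blast
  have eq: "vs = us" "es = fs" "vs' = us'" "es' = fs'" "ks = js"
    using 1(4) 2(4) enc_word_inject[of ks "[]" js "[]"] by (simp_all add: enc_graph_inject)
  show "verts G = verts G' \<and> edges G = edges G' \<and> (\<forall>e\<in>edges G. lab G e = lab G' e)"
    by (rule lists_graph_unique[OF 1(1) 2(1)[folded eq]])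
  show "verts H = verts H' \<and> edges H = edges H' \<and> (\<forall>e\<in>edges H. lab H e = lab H' e)"
    by (rule lists_graph_unique[OF 1(2) 2(2)[folded eq]])
  show "K = K'"
    by (simp only: 1(3) 2(3) eq)
qed

definition MCES_yes :: "bool list set" where
  "MCES_yes = {w. \<exists>G H K. encodes_input w G H K \<and> MCES G H \<ge> K}"

definition path_inputs :: "bool list set" where
  "path_inputs = {w. \<exists>G H K. encodes_input w G H K \<and> is_path G \<and> is_path H}"


section \<open>NP-hardness\<close>

definition NP :: "bool list set set" where
  "NP = {L. \<exists>V (p :: nat poly). poly_time V \<and>
     (\<forall>x. x \<in> L \<longleftrightarrow> (\<exists>u. length u \<le> poly p (length x) \<and> V (enc_pair x u) = [True]))}"

text \<open>
  Hardness of the problem with yes-instances \<open>Y\<close> restricted to the inputs \<open>I\<close>: reductions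
  produce inputs in \<open>I\<close> only. NP-hardness of a language is the case \<open>I = UNIV\<close>.
\<close>

definition NP_hard_on :: "bool list set \<Rightarrow> bool list set \<Rightarrow> bool" where
  "NP_hard_on I Y \<longleftrightarrow>
     (\<forall>L\<in>NP. \<exists>f. poly_time f \<and> (\<forall>x. f x \<in> I \<and> (x \<in> L \<longleftrightarrow> f x \<in> Y)))"

end

theory Submission
  imports Defs
begin

text \<open>
  The second path is cut into single edges of distinct labels by an edge label that does not occur on
  the first path. A common subgraph that uses all these edges is then a set of pairwise non-adjacent
  edges of the first path with every label once. Such a selection encodes satisfiability: the labels
  are the clauses, and every occurrence of a variable is a piece of three edges on the first path,
  where the middle edge stands for one truth value and the two outer edges for the other one. Two of
  the three edges belong to implications that make the copies of a variable agree.

  The formula is the tableau of the verifier. Its clauses come in finitely many schemes that are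
  indexed by times and positions, so the two paths can be printed by nested loops, and such loops run
  on a Turing machine that uses head positions as counters.
\<close>

section \<open>While-programs on Turing machine tapes\<close>

text \<open>Counting does the forcing: apart from separators the second path carries every label
  exactly once, and the threshold is the number of these labels, so no slack is left for a partial
  selection. The only interaction between selected edges is that neighbours exclude each other;
  everything else must be expressed through it.

  Implications in one direction are enough to make the copies of a variable consistent. Its positive
  occurrences precede its negative ones, so a clause edge taken at a positive copy makes all later
  copies true, and a true negative copy cannot give up its own clause edge. A chain fits a path,
  whereas a cycle of equalities would not.

  Hardness ranges over all verifiers, which are Turing machines, and the reduction must be a Turing
  machine too. What it computes is therefore kept trivial: no arithmetic beyond sums of loop
  variables, all names in unary, and exactly four edges per loop step, so that one tick counter
  names the vertices, the links and finally the threshold.\<close>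

datatype com =
    Atom "nat list \<Rightarrow> (nat \<times> move) list"
  | Seq com com (infixr ";;" 60)
  | IfSym nat nat com com
  | UntilSym nat nat com

abbreviation scan :: "tape list \<Rightarrow> nat list" where
  "scan ts \<equiv> map (\<lambda>(t, h). t h) ts"

definition stay :: "nat list \<Rightarrow> (nat \<times> move) list" where
  "stay rs = map (\<lambda>a. (a, Stay)) rs"

definition legal :: "nat list \<Rightarrow> (nat \<times> move) list \<Rightarrow> bool" where
  "legal rs acts \<longleftrightarrow> length acts = length rs \<and> (\<forall>(a, m)\<in>set acts. a < 4)"

text \<open>The step counts are those of the compiled machine: every change of the control stack
  costs one step, including the unfolding of a sequence and each test of a loop.\<close>

inductive texec :: "com \<Rightarrow> tape list \<Rightarrow> nat \<Rightarrow> tape list \<Rightarrow> bool" where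
  Atom: "legal (scan ts) (f (scan ts)) \<Longrightarrow> texec (Atom f) ts 1 (map2 act (f (scan ts)) ts)"
| Seq: "texec a ts t ts' \<Longrightarrow> texec b ts' t' ts'' \<Longrightarrow> texec (a ;; b) ts (Suc (t + t')) ts''"
| IfSym: "texec (if scan ts ! r = s then a else b) ts t ts' \<Longrightarrow> texec (IfSym r s a b) ts (Suc t) ts'"
| Until_stop: "scan ts ! r = s \<Longrightarrow> texec (UntilSym r s a) ts 1 ts"
| Until_loop: "scan ts ! r \<noteq> s \<Longrightarrow> texec a ts t ts' \<Longrightarrow> texec (UntilSym r s a) ts' t' ts'' \<Longrightarrow>
    texec (UntilSym r s a) ts (Suc (t + t')) ts''"

text \<open>The control state of the machine is the stack of programs that remain to be run.\<close>

fun next_stack :: "com list \<Rightarrow> nat list \<Rightarrow> com list \<times> (nat \<times> move) list" where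
  "next_stack [] rs = ([], stay rs)"
| "next_stack (Atom f # k) rs = (k, f rs)"
| "next_stack ((a ;; b) # k) rs = (a # b # k, stay rs)"
| "next_stack (IfSym r s a b # k) rs = ((if rs ! r = s then a else b) # k, stay rs)"
| "next_stack (UntilSym r s a # k) rs =
     (if rs ! r = s then k else a # UntilSym r s a # k, stay rs)"

text \<open>These are the control stacks that can arise while \<open>c\<close> runs on top of
  \<open>k\<close>. There are finitely many because programs have no recursion, so a stack is
  determined by a place in the program; this is what allows stacks to serve as machine
  states.\<close>

fun stacks :: "com \<Rightarrow> com list \<Rightarrow> com list set" where
  "stacks (Atom f) k = {Atom f # k}"
| "stacks (a ;; b) k = insert ((a ;; b) # k) (stacks a (b # k) \<union> stacks b k)"
| "stacks (IfSym r s a b) k = insert (IfSym r s a b # k) (stacks a k \<union> stacks b k)"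
| "stacks (UntilSym r s a) k =
     insert (UntilSym r s a # k) (stacks a (UntilSym r s a # k))"

lemma finite_stacks: "finite (stacks c k)"
  by (induction c arbitrary: k) auto

lemma stacks_start: "c # k \<in> stacks c k"
  by (cases c) auto

lemma stacks_closed: "x \<in> stacks c k \<Longrightarrow> fst (next_stack x rs) \<in> insert k (stacks c k)"
proof (induction c arbitrary: k)
  case (Seq a b)
  then show ?case using stacks_start[of a "b # k"] stacks_start[of b k] by fastforce
next
  case (IfSym r s a b)
  then show ?case using stacks_start[of a k] stacks_start[of b k] by (auto split: if_splits)
next
  case (UntilSym r s a)
  then show ?case using stacks_start[of a "UntilSym r s a # k"] by (auto split: if_splits)
qed auto

lemma act_stay: "map2 act (stay (scan ts)) ts = ts"
proof -
  have "act (fst t (snd t), Stay) t = t" for t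
    by (cases t) simp
  then show ?thesis
    unfolding stay_def by (intro nth_equalityI) (auto simp: case_prod_unfold)
qed

lemma legal_stay: "\<forall>a\<in>set rs. a < 4 \<Longrightarrow> legal rs (stay rs)"
  by (auto simp: legal_def stay_def)

text \<open>Illegal actions are replaced by \<open>stay\<close> and foreign states lead to the
  halting state, so well-formedness does not depend on the functions inside the atoms.\<close>

definition stack_tm :: "nat \<Rightarrow> nat \<Rightarrow> com list set \<Rightarrow> (com list \<Rightarrow> nat) \<Rightarrow> tm" where
  "stack_tm k n Q e = \<lparr>num_tapes = k, num_syms = 4, num_states = n,
     delta = (\<lambda>q rs. if q \<in> e ` Q
       then (let (x, acts) = next_stack (the_inv_into Q e q) rs
             in (e x, if legal rs acts then acts else stay rs))
       else (1, stay rs))\<rparr>"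

lemma com_turing_machine:
  assumes "k \<ge> 1"
  shows "\<exists>M. wf_tm M \<and> num_tapes M = k \<and>
    (\<forall>ts t ts'. texec c ts t ts' \<longrightarrow> (step M ^^ t) (0, ts) = (1, ts'))"
proof -
  define Q where "Q = insert [] (stacks c [])"
  have "finite Q" by (simp add: Q_def finite_stacks)
  then obtain g and m :: nat where g: "g ` Q = {i. i < m}" "inj_on g Q"
    using finite_imp_inj_to_nat_seg by blast
  \<comment> \<open>The whole program must become the start state 0 and the empty stack the halting
    state 1; the shift by 2 keeps all other stacks away from both.\<close>
  define e where "e x = (if x = [c] then 0 else if x = [] then 1 else g x + 2)" for x
  define M where "M = stack_tm k (m + 2) Q e"
  have inj: "inj_on e Q"
    using g(2) by (auto simp: inj_on_def e_def)
  have e_less: "e x < m + 2" if "x \<in> Q" for x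
    using g(1) that by (auto simp: e_def)
  have closed: "fst (next_stack x rs) \<in> Q" if "x \<in> Q" for x rs
    using that stacks_closed[of x c "[]" rs] by (auto simp: Q_def)
  have wf: "wf_tm M"
    unfolding wf_tm_def
  proof (intro conjI allI impI)
    fix q rs
    assume "q < num_states M \<and> length rs = num_tapes M \<and> (\<forall>a\<in>set rs. a < num_syms M)"
    then have rs: "length rs = k" "\<forall>a\<in>set rs. a < 4"
      by (simp_all add: M_def stack_tm_def)
    show "case delta M q rs of (q', acts) \<Rightarrow> q' < num_states M \<and> length acts = num_tapes M \<and>
        (\<forall>(a, m)\<in>set acts. a < num_syms M)"
    proof (cases "q \<in> e ` Q")
      case True
      then have "the_inv_into Q e q \<in> Q"
        using inj by (auto simp: the_inv_into_f_f)
      then show ?thesis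
        using closed[of "the_inv_into Q e q" rs] True rs legal_stay[OF rs(2)]
        e_less[of "fst (next_stack (the_inv_into Q e q) rs)"]
        by (auto simp: M_def stack_tm_def legal_def Let_def split: prod.splits)
    next
      case False
      then show ?thesis
        using rs legal_stay[OF rs(2)] by (auto simp: M_def stack_tm_def legal_def)
    qed
  qed (use assms in \<open>auto simp: M_def stack_tm_def\<close>)
  have one_step: "step M (e (b # l), ts) =
      (let (x, acts) = next_stack (b # l) (scan ts)
       in (e x, map2 act (if legal (scan ts) acts then acts else stay (scan ts)) ts))"
    if "b # l \<in> Q" for b l ts
  proof -
    have "e (b # l) \<noteq> 1" "e (b # l) \<in> e ` Q"
      using that by (auto simp: e_def)
    moreover have "the_inv_into Q e (e (b # l)) = b # l"
      using the_inv_into_f_f[OF inj that] .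
    ultimately show ?thesis
      by (simp add: M_def stack_tm_def case_prod_unfold Let_def)
  qed
  have trans: "(step M ^^ (Suc (t + t'))) a = d"
    if "step M a = b" "(step M ^^ t) b = c" "(step M ^^ t') c = d" for a b c d t t'
    using that by (simp add: funpow_swap1 add.commute[of t] funpow_add)
  \<comment> \<open>The continuation \<open>l\<close> is arbitrary because the parts of a sequence
    and the body of a loop run on top of what remains to be done.\<close>
  have run: "texec b ts t ts' \<Longrightarrow> stacks b l \<subseteq> Q \<Longrightarrow> l \<in> Q \<Longrightarrow>
      (step M ^^ t) (e (b # l), ts) = (e l, ts')" for b ts t ts' l
  proof (induction arbitrary: l rule: texec.induct)
    case (Atom ts f)
    then show ?case by (simp add: one_step del: step.simps)
  next
    case (Seq a ts t ts' b t' ts'')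
    have "step M (e ((a ;; b) # l), ts) = (e (a # b # l), ts)"
      using Seq.prems by (simp add: one_step act_stay del: step.simps)
    then show ?case
      using Seq stacks_start[of b l] by (intro trans[where b = "(e (a # b # l), ts)" and c = "(e (b # l), ts')"]) auto
  next
    case (IfSym ts r s a b t ts')
    have "step M (e (IfSym r s a b # l), ts) = (e ((if scan ts ! r = s then a else b) # l), ts)"
      using IfSym.prems by (simp add: one_step act_stay del: step.simps)
    then show ?case
      using IfSym.IH[of l] IfSym.prems by (simp add: funpow_swap1 split: if_splits)
  next
    case (Until_stop ts r s a)
    then show ?case by (simp add: one_step act_stay del: step.simps)
  next
    case (Until_loop ts r s a t ts' t' ts'')
    have "step M (e (UntilSym r s a # l), ts) = (e (a # UntilSym r s a # l), ts)"
      using Until_loop.prems Until_loop.hyps(1) by (simp add: one_step act_stay del: step.simps)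
    then show ?case
      using Until_loop by (intro trans[where b = "(e (a # UntilSym r s a # l), ts)" and c = "(e (UntilSym r s a # l), ts')"]) auto
  qed
  have "(step M ^^ t) (0, ts) = (1, ts')" if "texec c ts t ts'" for ts t ts'
    using run[OF that, of "[]"] by (simp add: Q_def e_def subset_insertI)
  moreover have "num_tapes M = k"
    by (simp add: M_def stack_tm_def)
  ultimately show ?thesis
    using wf by blast
qed

section \<open>Counter programs\<close>

text \<open>A counter is the head position on a tape that has the symbol 3 in cell -1; the head of
  an empty counter scans that cell. Counter 0 lives on the input tape.\<close>

definition nregs :: nat where "nregs = 40"

definition reg_tape :: "bool list \<Rightarrow> nat \<Rightarrow> nat \<Rightarrow> tape" where
  "reg_tape x r n = ((word_tape (if r = 0 then x else []))(-1 := 3), int n - 1)"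

definition tapes :: "bool list \<Rightarrow> (nat \<Rightarrow> nat) \<Rightarrow> bool list \<Rightarrow> tape list" where
  "tapes x s out = map (\<lambda>r. reg_tape x r (s r)) [0..<nregs] @ [(word_tape out, int (length out))]"

text \<open>A counter of value \<open>n\<close> has its head on cell \<open>n - 1\<close>. Hence the
  marker 3 is read exactly at value zero, and counter 0 with value \<open>k + 1\<close> reads the
  input bit of index \<open>k\<close>.\<close>

definition scanned :: "bool list \<Rightarrow> nat \<Rightarrow> nat \<Rightarrow> nat" where
  "scanned x r n = (if n = 0 then 3 else word_tape (if r = 0 then x else []) (int n - 1))"

lemma scanned_eq_3 [simp]: "scanned x r n = 3 \<longleftrightarrow> n = 0"
  by (simp add: scanned_def word_tape_def sym_of_bit_def)

lemma length_tapes [simp]: "length (tapes x s out) = Suc nregs"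
  by (simp add: tapes_def)

lemma scan_tapes:
  "scan (tapes x s out) = map (\<lambda>r. scanned x r (s r)) [0..<nregs] @ [0]"
  by (simp add: tapes_def reg_tape_def scanned_def word_tape_def)

lemma word_tape_less: "word_tape x i < 4"
  by (simp add: word_tape_def sym_of_bit_def)

lemma scan_tapes_less: "a \<in> set (scan (tapes x s out)) \<Longrightarrow> a < 4"
  unfolding scan_tapes by (auto simp: scanned_def word_tape_less)

definition inc :: "nat \<Rightarrow> com" where
  "inc r = Atom (\<lambda>rs. map (\<lambda>j. (rs ! j, if j = r then Right else Stay)) [0..<length rs])"

text \<open>The marker test keeps the head from passing cell -1, which makes this truncated
  subtraction on natural numbers.\<close>

definition dec :: "nat \<Rightarrow> com" where
  "dec r = Atom (\<lambda>rs. map (\<lambda>j. (rs ! j, if j = r \<and> rs ! j \<noteq> 3 then Left else Stay)) [0..<length rs])"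

definition emit :: "bool \<Rightarrow> com" where
  "emit b = Atom (\<lambda>rs. map (\<lambda>j. if Suc j = length rs then (sym_of_bit b, Right) else (rs ! j, Stay))
     [0..<length rs])"

definition skip :: com where
  "skip = Atom stay"

text \<open>Between instructions only head positions and the output tape vary, so counters and
  output word describe the state completely. The time is an upper bound, which lets composed bounds
  be rounded up by \<open>run_mono\<close>.\<close>

fun run :: "bool list \<Rightarrow> com \<Rightarrow> (nat \<Rightarrow> nat) \<times> bool list \<Rightarrow> nat \<Rightarrow> (nat \<Rightarrow> nat) \<times> bool list \<Rightarrow> bool" where
  "run x c (s, out) T (s', out') \<longleftrightarrow> (\<exists>t\<le>T. texec c (tapes x s out) t (tapes x s' out'))"

lemma run_mono: "run x c \<sigma> t \<sigma>' \<Longrightarrow> t \<le> T \<Longrightarrow> run x c \<sigma> T \<sigma>'"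
  by (cases \<sigma>; cases \<sigma>') (auto intro: le_trans)

lemma texec_atom:
  assumes "\<And>j. j < length ts \<Longrightarrow> fst (g (scan ts) j) < 4"
  shows "texec (Atom (\<lambda>rs. map (g rs) [0..<length rs])) ts 1
    (map (\<lambda>j. act (g (scan ts) j) (ts ! j)) [0..<length ts])"
proof -
  let ?f = "\<lambda>rs. map (g rs) [0..<length rs]"
  have "legal (scan ts) (?f (scan ts))"
    using assms by (auto simp: legal_def case_prod_unfold)
  moreover have "map2 act (?f (scan ts)) ts = map (\<lambda>j. act (g (scan ts) j) (ts ! j)) [0..<length ts]"
    by (rule nth_equalityI) auto
  ultimately show ?thesis
    using texec.Atom[of ts ?f] by simp
qed

lemma run_atom:
  assumes "\<And>j. j \<le> nregs \<Longrightarrow> act (g (scan (tapes x s out)) j) (tapes x s out ! j) = tapes x s' out' ! j"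
    and "\<And>j. j \<le> nregs \<Longrightarrow> fst (g (scan (tapes x s out)) j) < 4"
  shows "run x (Atom (\<lambda>rs. map (g rs) [0..<length rs])) (s, out) 1 (s', out')"
proof -
  have "map (\<lambda>j. act (g (scan (tapes x s out)) j) (tapes x s out ! j)) [0..<length (tapes x s out)] = tapes x s' out'"
    by (rule nth_equalityI) (use assms(1) in \<open>auto simp del: upt_Suc\<close>)
  then show ?thesis
    using texec_atom[of "tapes x s out" g] assms(2) by auto
qed

lemma nth_tapes: "j < nregs \<Longrightarrow> tapes x s out ! j = reg_tape x j (s j)"
  "tapes x s out ! nregs = (word_tape out, int (length out))"
  by (simp_all add: tapes_def nth_append)

lemma nth_scan_tapes': "r < nregs \<Longrightarrow> scan (tapes x s out) ! r = scanned x r (s r)"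
  by (simp add: scan_tapes nth_append)

lemma scan_less: "j \<le> nregs \<Longrightarrow> scan (tapes x s out) ! j < 4"
  using scan_tapes_less[of "scan (tapes x s out) ! j"] nth_mem[of j "scan (tapes x s out)"]
  by (simp del: nth_map)

lemma act_write_back: "j \<le> nregs \<Longrightarrow> act (scan (tapes x s out) ! j, m) (tapes x s out ! j) =
    (fst (tapes x s out ! j), snd (tapes x s out ! j) + offset m)"
  by (cases "tapes x s out ! j") simp

lemma run_inc: "r < nregs \<Longrightarrow> run x (inc r) (s, out) 1 (s(r := Suc (s r)), out)"
  unfolding inc_def
proof (rule run_atom)
  fix j
  assume "r < nregs" "j \<le> nregs"
  then show "act (scan (tapes x s out) ! j, if j = r then Right else Stay) (tapes x s out ! j) =
      tapes x (s(r := Suc (s r))) out ! j"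
    unfolding act_write_back[OF \<open>j \<le> nregs\<close>]
    by (cases "j = nregs") (simp_all add: nth_tapes reg_tape_def)
qed (simp add: scan_less del: nth_map)

lemma run_dec: "r < nregs \<Longrightarrow> run x (dec r) (s, out) 1 (s(r := s r - 1), out)"
  unfolding dec_def
proof (rule run_atom)
  fix j
  assume r: "r < nregs" and j: "j \<le> nregs"
  have eq: "(scan (tapes x s out) ! r = 3) = (s r = 0)"
    using r by (simp add: nth_scan_tapes' del: nth_map)
  show "act (scan (tapes x s out) ! j, if j = r \<and> scan (tapes x s out) ! j \<noteq> 3 then Left else Stay)
      (tapes x s out ! j) = tapes x (s(r := s r - 1)) out ! j"
    unfolding act_write_back[OF \<open>j \<le> nregs\<close>]
    using r j eq by (cases "j = nregs"; cases "j = r") (simp_all add: nth_tapes reg_tape_def del: nth_map)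
qed (simp add: scan_less del: nth_map)

lemma word_tape_snoc: "(word_tape out)(int (length out) := sym_of_bit b) = word_tape (out @ [b])"
  by (rule ext) (auto simp: word_tape_def nth_append)

lemma run_emit: "run x (emit b) (s, out) 1 (s, out @ [b])"
  unfolding emit_def
proof (rule run_atom)
  fix j
  assume "j \<le> nregs"
  then show "act (if Suc j = length (scan (tapes x s out)) then (sym_of_bit b, Right)
      else (scan (tapes x s out) ! j, Stay)) (tapes x s out ! j) = tapes x s (out @ [b]) ! j"
    using act_write_back[OF \<open>j \<le> nregs\<close>, of x s out Stay]
    by (cases "j = nregs") (simp_all add: nth_tapes reg_tape_def word_tape_snoc del: nth_map)
qed (simp add: scan_less sym_of_bit_def del: nth_map)

lemma run_skip: "run x skip \<sigma> (Suc 0) \<sigma>"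
proof (cases \<sigma>)
  case (Pair s out)
  have "legal (scan (tapes x s out)) (stay (scan (tapes x s out)))"
    by (rule legal_stay) (use scan_tapes_less in blast)
  then show ?thesis
    unfolding Pair skip_def using texec.Atom[of "tapes x s out" stay] by (auto simp: act_stay)
qed

lemma run_seq:
  assumes "run x a \<sigma> t \<sigma>'" "run x b \<sigma>' t' \<sigma>''"
  shows "run x (a ;; b) \<sigma> (Suc (t + t')) \<sigma>''"
proof -
  obtain s out s' out' s'' out'' where eq: "\<sigma> = (s, out)" "\<sigma>' = (s', out')" "\<sigma>'' = (s'', out'')"
    by (metis surj_pair)
  obtain u u' where "u \<le> t" "u' \<le> t'" "texec a (tapes x s out) u (tapes x s' out')"
    "texec b (tapes x s' out') u' (tapes x s'' out'')"
    using assms unfolding eq by auto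
  then show ?thesis
    unfolding eq run.simps by (intro exI[of _ "Suc (u + u')"]) (auto intro: texec.Seq)
qed

lemma run_if:
  assumes "r < nregs" "run x (if scanned x r (s r) = a then c else d) (s, out) t \<sigma>'"
  shows "run x (IfSym r a c d) (s, out) (Suc t) \<sigma>'"
proof -
  obtain s' out' where eq: "\<sigma>' = (s', out')"
    by (metis surj_pair)
  obtain u where "u \<le> t" "texec (if scanned x r (s r) = a then c else d) (tapes x s out) u (tapes x s' out')"
    using assms(2) unfolding eq by auto
  then show ?thesis
    unfolding eq run.simps using assms(1) texec.IfSym[of "tapes x s out" r a c d u "tapes x s' out'"]
    by (intro exI[of _ "Suc u"]) (auto simp: nth_scan_tapes' simp del: nth_map)
qed

lemma run_until_stop:
  "r < nregs \<Longrightarrow> scanned x r (s r) = a \<Longrightarrow> run x (UntilSym r a c) (s, out) 1 (s, out)"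
  using texec.Until_stop[of "tapes x s out" r a c] by (auto simp: nth_scan_tapes' simp del: nth_map)

lemma run_until_loop:
  assumes "r < nregs" "scanned x r (s r) \<noteq> a" "run x c (s, out) t \<sigma>'" "run x (UntilSym r a c) \<sigma>' t' \<sigma>''"
  shows "run x (UntilSym r a c) (s, out) (Suc (t + t')) \<sigma>''"
proof -
  obtain s' out' s'' out'' where eq: "\<sigma>' = (s', out')" "\<sigma>'' = (s'', out'')"
    by (metis surj_pair)
  obtain u u' where "u \<le> t" "u' \<le> t'" "texec c (tapes x s out) u (tapes x s' out')"
    "texec (UntilSym r a c) (tapes x s' out') u' (tapes x s'' out'')"
    using assms(3,4) unfolding eq by auto
  then show ?thesis
    unfolding eq run.simps using assms(1,2)
    by (intro exI[of _ "Suc (u + u')"] conjI texec.Until_loop) (auto simp: nth_scan_tapes' simp del: nth_map)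
qed

lemma run_until:
  assumes "r < nregs"
    and "\<And>i. i < n \<Longrightarrow> scanned x r (s i r) \<noteq> a \<and> run x c (s i, out i) t (s (Suc i), out (Suc i))"
    and "scanned x r (s n r) = a"
  shows "run x (UntilSym r a c) (s 0, out 0) (n * Suc t + 1) (s n, out n)"
proof -
  \<comment> \<open>The induction is on the number \<open>m\<close> of remaining rounds, since the
    loop rule peels off the first round and not the last.\<close>
  have "run x (UntilSym r a c) (s (n - m), out (n - m)) (m * Suc t + 1) (s n, out n)" if "m \<le> n" for m
    using that
  proof (induction m)
    case 0
    then show ?case using run_until_stop[of r x "s n" a c "out n"] assms(1,3) by (simp del: run.simps)
  next
    case (Suc m)
    then have "Suc (n - Suc m) = n - m" by simp
    then show ?case
      using run_until_loop[OF assms(1), of x "s (n - Suc m)" a c "out (n - Suc m)" t "(s (n - m), out (n - m))"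
          "m * Suc t + 1" "(s n, out n)"] assms(2)[of "n - Suc m"] Suc
      by (simp add: add_ac del: run.simps)
  qed
  from this[of n] show ?thesis by simp
qed

declare run.simps [simp del]

section \<open>Arithmetic and unary output on counters\<close>

definition clear :: "nat \<Rightarrow> com" where
  "clear r = UntilSym r 3 (dec r)"

lemma run_clear:
  assumes "r < nregs"
  shows "run x (clear r) (s, out) (2 * s r + 1) (s(r := 0), out)"
proof -
  have "run x (UntilSym r 3 (dec r)) (s(r := s r - 0), out) (s r * Suc 1 + 1) (s(r := s r - s r), out)"
  proof (intro run_until[where s = "\<lambda>i. s(r := s r - i)" and out = "\<lambda>_. out"] assms conjI)
    fix i
    show "run x (dec r) (s(r := s r - i), out) 1 (s(r := s r - Suc i), out)"
      using run_dec[OF assms, of x "s(r := s r - i)" out] by simp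
  qed auto
  then show ?thesis
    by (simp add: clear_def mult.commute mult_2_right)
qed

text \<open>A counter can only be tested for zero, so counting \<open>a\<close> down destroys it;
  \<open>k\<close> records the rounds, and the second loop restores \<open>a\<close> from it. The
  body sees both counters in the middle of this transfer, which explains the updated states in the
  hypothesis of \<open>run_times\<close>.\<close>

definition times :: "nat \<Rightarrow> nat \<Rightarrow> com \<Rightarrow> com" where
  "times k a c = UntilSym a 3 (dec a ;; inc k ;; c) ;; UntilSym k 3 (dec k ;; inc a)"

lemma run_times:
  assumes "a < nregs" "k < nregs" "a \<noteq> k"
    and regs: "\<And>i. s i a = n \<and> s i k = 0"
    and body: "\<And>i. i < n \<Longrightarrow> run x c ((s i)(a := n - Suc i, k := Suc i), out i) t
      ((s (Suc i))(a := n - Suc i, k := Suc i), out (Suc i))"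
  shows "run x (times k a c) (s 0, out 0) (n * (t + 9) + 3) (s n, out n)"
proof -
  define s1 where "s1 i = (s i)(a := n - i, k := i)" for i
  have s1_app: "s1 i a = n - i" for i
    using assms(3) by (simp add: s1_def)
  have "run x (dec a ;; inc k ;; c) (s1 i, out i) (t + 4) (s1 (Suc i), out (Suc i))" if "i < n" for i
  proof -
    have "run x (dec a) (s1 i, out i) 1 ((s1 i)(a := n - Suc i), out i)"
      using run_dec[OF assms(1), of x "s1 i" "out i"] assms(3) by (simp add: s1_def)
    moreover have "run x (inc k) ((s1 i)(a := n - Suc i), out i) 1 ((s i)(a := n - Suc i, k := Suc i), out i)"
    proof -
      have "(s1 i)(a := n - Suc i, k := Suc i) = (s i)(a := n - Suc i, k := Suc i)"
        using assms(3) by (auto simp: s1_def)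
      then show ?thesis
        using run_inc[OF assms(2), of x "(s1 i)(a := n - Suc i)" "out i"] assms(3)
        by (simp add: s1_def)
    qed
    ultimately show ?thesis
      using run_seq[OF _ run_seq[OF _ body[OF that]]]
      by (auto simp: s1_def intro!: run_mono[OF run_seq[OF _ run_seq[OF _ body[OF that]]]])
  qed
  then have 1: "run x (UntilSym a 3 (dec a ;; inc k ;; c)) (s1 0, out 0) (n * Suc (t + 4) + 1) (s1 n, out n)"
    using assms(1,3) by (intro run_until conjI) (simp_all add: s1_app)
  define s2 where "s2 i = (s n)(a := i, k := n - i)" for i
  have s2_app: "s2 i k = n - i" for i
    by (simp add: s2_def)
  have "run x (dec k ;; inc a) (s2 i, out n) 3 (s2 (Suc i), out n)" if "i < n" for i
  proof -
    have "run x (dec k) (s2 i, out n) 1 ((s2 i)(k := n - Suc i), out n)"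
      using run_dec[OF assms(2), of x "s2 i" "out n"] assms(3) by (simp add: s2_def)
    moreover have "run x (inc a) ((s2 i)(k := n - Suc i), out n) 1 (s2 (Suc i), out n)"
    proof -
      have "(s2 i)(k := n - Suc i, a := Suc i) = s2 (Suc i)"
        using assms(3) by (auto simp: s2_def)
      then show ?thesis
        using run_inc[OF assms(1), of x "(s2 i)(k := n - Suc i)" "out n"] assms(3)
        by (simp add: s2_def)
    qed
    ultimately show ?thesis
      by (auto intro: run_mono[OF run_seq])
  qed
  then have 2: "run x (UntilSym k 3 (dec k ;; inc a)) (s2 0, out n) (n * Suc 3 + 1) (s2 n, out n)"
    using assms(2,3) by (intro run_until[where out = "\<lambda>_. out n"] conjI) (simp_all add: s2_app)
  have eqs: "s1 0 = s 0" "s1 n = s2 0" "s2 n = s n"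
    using regs assms(3) by (auto simp: s1_def s2_def fun_eq_iff)
  show ?thesis
    unfolding times_def
    by (rule run_mono[OF run_seq[OF 1[unfolded eqs] 2[unfolded eqs]]]) (simp add: algebra_simps)
qed

definition add_reg :: "nat \<Rightarrow> nat \<Rightarrow> com" where
  "add_reg a b = times 1 a (inc b)"

definition sub_reg :: "nat \<Rightarrow> nat \<Rightarrow> com" where
  "sub_reg a b = times 1 a (dec b)"

lemma run_add_reg:
  assumes "a < nregs" "b < nregs" "a \<noteq> b" "a \<noteq> 1" "b \<noteq> 1" "s 1 = 0"
  shows "run x (add_reg a b) (s, out) (10 * s a + 3) (s(b := s b + s a), out)"
proof -
  have "run x (add_reg a b) (s(b := s b + 0), out) (s a * (1 + 9) + 3) (s(b := s b + s a), out)"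
    unfolding add_reg_def
  proof (intro run_times)
    fix i
    have "s(b := s b + i, a := s a - Suc i, 1 := Suc i, b := Suc (s b + i)) =
        s(b := s b + Suc i, a := s a - Suc i, 1 := Suc i)"
      using assms by (auto simp: fun_eq_iff)
    then show "run x (inc b) (s(b := s b + i, a := s a - Suc i, 1 := Suc i), out) 1
        (s(b := s b + Suc i, a := s a - Suc i, 1 := Suc i), out)"
      using run_inc[OF assms(2), of x "s(b := s b + i, a := s a - Suc i, 1 := Suc i)" out] assms
      by simp
  qed (use assms in \<open>auto simp: nregs_def\<close>)
  then show ?thesis by (simp add: mult.commute)
qed

lemma run_sub_reg:
  assumes "a < nregs" "b < nregs" "a \<noteq> b" "a \<noteq> 1" "b \<noteq> 1" "s 1 = 0"
  shows "run x (sub_reg a b) (s, out) (10 * s a + 3) (s(b := s b - s a), out)"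
proof -
  have "run x (sub_reg a b) (s(b := s b - 0), out) (s a * (1 + 9) + 3) (s(b := s b - s a), out)"
    unfolding sub_reg_def
  proof (intro run_times)
    fix i
    have "s(b := s b - i, a := s a - Suc i, 1 := Suc i, b := s b - i - 1) =
        s(b := s b - Suc i, a := s a - Suc i, 1 := Suc i)"
      using assms by (auto simp: fun_eq_iff)
    then show "run x (dec b) (s(b := s b - i, a := s a - Suc i, 1 := Suc i), out) 1
        (s(b := s b - Suc i, a := s a - Suc i, 1 := Suc i), out)"
      using run_dec[OF assms(2), of x "s(b := s b - i, a := s a - Suc i, 1 := Suc i)" out] assms
      by simp
  qed (use assms in \<open>auto simp: nregs_def\<close>)
  then show ?thesis by (simp add: mult.commute)
qed

definition emit_unary :: "nat \<Rightarrow> com" where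
  "emit_unary a = times 1 a (emit True ;; emit True)"

lemma run_emit_unary:
  assumes "a < nregs" "a \<noteq> 1" "s 1 = 0"
  shows "run x (emit_unary a) (s, out) (12 * s a + 3) (s, out @ replicate (2 * s a) True)"
proof -
  have "run x (emit_unary a) (s, out @ replicate (2 * 0) True) (s a * (3 + 9) + 3)
      (s, out @ replicate (2 * s a) True)"
    unfolding emit_unary_def
  proof (intro run_times[where out = "\<lambda>i. out @ replicate (2 * i) True"])
    fix i
    show "run x (emit True ;; emit True) (s(a := s a - Suc i, 1 := Suc i), out @ replicate (2 * i) True) 3
        (s(a := s a - Suc i, 1 := Suc i), out @ replicate (2 * Suc i) True)"
      by (rule run_mono[OF run_seq[OF run_emit run_emit], THEN back_subst[of "\<lambda>ys. run x _ _ _ (_, ys)"]])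
        (simp_all add: replicate_append_same)
  qed (use assms in \<open>auto simp: nregs_def\<close>)
  then show ?thesis by (simp add: mult.commute)
qed

section \<open>Binary output of a counter\<close>

fun bits :: "nat \<Rightarrow> bool list" where
  "bits n = (if n = 0 then [] else odd n # bits (n div 2))"

declare bits.simps [simp del]

lemma horner_sum_bits: "horner_sum of_bool 2 (bits n) = n"
proof (induction n rule: less_induct)
  case (less n)
  show ?case
  proof (cases "n = 0")
    case True
    then show ?thesis by (simp add: bits.simps[of 0])
  next
    case False
    then show ?thesis
      using less[of "n div 2"] by (simp add: bits.simps[of n])
  qed
qed

definition halve :: com where
  "halve = UntilSym 3 3 (dec 3 ;; IfSym 3 3 (inc 5) (dec 3 ;; inc 4))"

lemma run_halve:
  assumes "s 4 = 0" "s 5 = 0"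
  shows "run x halve (s, out) (7 * s 3 + 8) (s(3 := 0, 4 := s 3 div 2, 5 := s 3 mod 2), out)"
proof -
  define m where "m = s 3"
  \<comment> \<open>Closed form of the state after \<open>i\<close> rounds. Every round moves a pair
    of units, except that the last round of an odd number finds a single unit and records it in
    counter 5; this is where \<open>m < 2 * i\<close>.\<close>
  define f where "f i = s(3 := m - 2 * i, 4 := min i (m div 2), 5 := of_bool (m < 2 * i))" for i
  define n where "n = (m + 1) div 2"
  have "run x halve (f 0, out) (n * Suc 6 + 1) (f n, out)"
    unfolding halve_def
  proof (intro run_until[where out = "\<lambda>_. out"] conjI)
    fix i
    assume "i < n"
    then have i: "2 * i < m"
      unfolding n_def by presburger
    then show "scanned x 3 (f i 3) \<noteq> 3"
      by (simp add: f_def)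
    have dec: "run x (dec 3) (f i, out) 1 ((f i)(3 := m - 2 * i - 1), out)"
      using run_dec[of 3 x "f i" out] by (simp add: nregs_def f_def)
    show "run x (dec 3 ;; IfSym 3 3 (inc 5) (dec 3 ;; inc 4)) (f i, out) 6 (f (Suc i), out)"
    proof (cases "m = 2 * i + 1")
      case True
      have "(f i)(3 := m - 2 * i - 1, 5 := Suc (f i 5)) = f (Suc i)"
        using True by (auto simp: f_def fun_eq_iff)
      then have "run x (inc 5) ((f i)(3 := m - 2 * i - 1), out) 1 (f (Suc i), out)"
        using run_inc[of 5 x "(f i)(3 := m - 2 * i - 1)" out] by (simp add: nregs_def)
      then have "run x (IfSym 3 3 (inc 5) (dec 3 ;; inc 4)) ((f i)(3 := m - 2 * i - 1), out) 2 (f (Suc i), out)"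
        by (intro run_mono[OF run_if[where t = 1]]) (use True in \<open>simp_all add: nregs_def\<close>)
      then show ?thesis
        by (rule run_mono[OF run_seq[OF dec]]) simp
    next
      case False
      have "(f i)(3 := m - 2 * i - 1, 3 := m - 2 * i - 2, 4 := Suc (f i 4)) = f (Suc i)"
        using False i by (auto simp: f_def fun_eq_iff min_def)
      moreover have "run x (dec 3) ((f i)(3 := m - 2 * i - 1), out) 1 ((f i)(3 := m - 2 * i - 1, 3 := m - 2 * i - 2), out)"
        using run_dec[of 3 x "(f i)(3 := m - 2 * i - 1)" out] by (simp add: nregs_def)
      ultimately have "run x (dec 3 ;; inc 4) ((f i)(3 := m - 2 * i - 1), out) 3 (f (Suc i), out)"
        using run_seq[OF _ run_inc[of 4], of x "dec 3" "((f i)(3 := m - 2 * i - 1), out)" 1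
            "(f i)(3 := m - 2 * i - 1, 3 := m - 2 * i - 2)" out]
        by (simp add: nregs_def numeral_eq_Suc)
      then have "run x (IfSym 3 3 (inc 5) (dec 3 ;; inc 4)) ((f i)(3 := m - 2 * i - 1), out) 4 (f (Suc i), out)"
        by (intro run_mono[OF run_if[where t = 3]]) (use False i in \<open>simp_all add: nregs_def\<close>)
      then show ?thesis
        by (rule run_mono[OF run_seq[OF dec]]) simp
    qed
  next
    have "m \<le> 2 * n"
      unfolding n_def by presburger
    then show "scanned x 3 (f n 3) = 3"
      by (simp add: f_def)
  qed (simp add: nregs_def)
  moreover have "f 0 = s"
    using assms by (auto simp: f_def m_def fun_eq_iff)
  moreover have "f n = s(3 := 0, 4 := s 3 div 2, 5 := s 3 mod 2)"
  proof -
    have n: "m \<le> 2 * n" "m div 2 \<le> n" "m < 2 * n \<longleftrightarrow> m mod 2 = 1"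
      unfolding n_def by presburger+
    have "of_bool (m < 2 * n) = m mod 2"
      unfolding n(3) by (cases "m mod 2 = 1") auto
    then show ?thesis
      using n(1,2) by (simp add: f_def m_def min_def)
  qed
  moreover have "n * Suc 6 + 1 \<le> 7 * m + 8"
    unfolding n_def by simp
  ultimately show ?thesis
    unfolding m_def by (auto intro: run_mono)
qed

text \<open>Repeated halving delivers the bits least significant first, the order prescribed for
  thresholds, and each bit is preceded by the marker \<open>True\<close> of
  \<open>enc_word\<close>.\<close>

definition emit_binary :: com where
  "emit_binary = UntilSym 3 3 (halve ;; emit True ;;
     IfSym 5 3 (emit False) (emit True ;; dec 5) ;; UntilSym 4 3 (dec 4 ;; inc 3)) ;; emit False"

lemma run_emit_binary:
  assumes "s 4 = 0" "s 5 = 0"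
  shows "run x emit_binary (s, out) (100 * s 3 + 3) (s(3 := 0), out @ enc_word (bits (s 3)))"
proof -
  define c where "c = halve ;; emit True ;;
     IfSym 5 3 (emit False) (emit True ;; dec 5) ;; UntilSym 4 3 (dec 4 ;; inc 3)"
  define g where "g w = concat (map (\<lambda>b. [True, b]) w)" for w
  have c: "run x c (s(3 := m), out) (11 * m + 20) (s(3 := m div 2), out @ [True, odd m])" for m out
  proof -
    define s1 where "s1 = s(3 := 0, 4 := m div 2, 5 := m mod 2)"
    define s2 where "s2 i = s(3 := i, 4 := m div 2 - i)" for i
    have s2_app: "s2 i 4 = m div 2 - i" for i
      by (simp add: s2_def)
    have 1: "run x halve (s(3 := m), out) (7 * m + 8) (s1, out)"
      using run_halve[of "s(3 := m)" x out] assms by (simp add: s1_def)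
    have 2: "run x (IfSym 5 3 (emit False) (emit True ;; dec 5)) (s1, out @ [True]) 4 (s2 0, out @ [True, odd m])"
    proof (cases "odd m")
      case True
      then have "run x (emit True ;; dec 5) (s1, out @ [True]) 3 (s2 0, out @ [True, odd m])"
        using run_seq[OF run_emit run_dec[of 5 x s1], of True "out @ [True]"] assms
        by (simp add: nregs_def s1_def s2_def odd_iff_mod_2_eq_one numeral_eq_Suc fun_upd_idem fun_upd_twist)
      then have "run x (IfSym 5 3 (emit False) (emit True ;; dec 5)) (s1, out @ [True]) (Suc 3) (s2 0, out @ [True, odd m])"
        by (intro run_if) (use True in \<open>auto simp: nregs_def s1_def odd_iff_mod_2_eq_one\<close>)
      then show ?thesis by simp
    next
      case False
      then have "run x (emit False) (s1, out @ [True]) 1 (s2 0, out @ [True, odd m])"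
        using run_emit[of x False s1 "out @ [True]"] assms
        by (simp add: s1_def s2_def even_iff_mod_2_eq_zero fun_upd_idem fun_upd_twist)
      then have "run x (IfSym 5 3 (emit False) (emit True ;; dec 5)) (s1, out @ [True]) (Suc 1) (s2 0, out @ [True, odd m])"
        by (intro run_if) (use False in \<open>auto simp: nregs_def s1_def even_iff_mod_2_eq_zero\<close>)
      then show ?thesis by (rule run_mono) simp
    qed
    have "run x (dec 4 ;; inc 3) (s2 i, out @ [True, odd m]) 3 (s2 (Suc i), out @ [True, odd m])"
      if "i < m div 2" for i
    proof -
      have "(s2 i)(4 := s2 i 4 - 1, 3 := Suc i) = s2 (Suc i)"
        by (auto simp: s2_def fun_eq_iff)
      then show ?thesis
        using run_seq[OF run_dec run_inc, of 4 3 x "s2 i" "out @ [True, odd m]"]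
        by (simp add: nregs_def s2_def numeral_eq_Suc)
    qed
    then have 3: "run x (UntilSym 4 3 (dec 4 ;; inc 3)) (s2 0, out @ [True, odd m]) (m div 2 * Suc 3 + 1)
        (s2 (m div 2), out @ [True, odd m])"
      by (intro run_until[where out = "\<lambda>_. out @ [True, odd m]"] conjI) (simp_all add: nregs_def s2_app)
    have "s2 (m div 2) = s(3 := m div 2)"
      using assms by (auto simp: s2_def fun_eq_iff)
    with 3 have 3: "run x (UntilSym 4 3 (dec 4 ;; inc 3)) (s2 0, out @ [True, odd m]) (m div 2 * Suc 3 + 1)
        (s(3 := m div 2), out @ [True, odd m])" by simp
    show ?thesis
      unfolding c_def
      by (rule run_mono[OF run_seq[OF 1 run_seq[OF run_emit run_seq[OF 2 3]]]]) simp
  qed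
  \<comment> \<open>The bound stays linear because a round costs about \<open>11 * m\<close> and
    halves the value: the slope 100 leaves at least \<open>50 * m\<close> for the round.\<close>
  have "run x (UntilSym 3 3 c) (s(3 := m), out) (100 * m + 1) (s(3 := 0), out @ g (bits m))" for m
  proof (induction m arbitrary: out rule: less_induct)
    case (less m)
    show ?case
    proof (cases "m = 0")
      case True
      then show ?thesis
        unfolding True bits.simps[of 0] g_def
        by (simp, intro run_mono[OF run_until_stop]) (simp_all add: nregs_def)
    next
      case False
      then have "run x (UntilSym 3 3 c) (s(3 := m div 2), out @ [True, odd m]) (100 * (m div 2) + 1)
          (s(3 := 0), (out @ [True, odd m]) @ g (bits (m div 2)))"
        by (intro less) simp
      then have loop: "run x (UntilSym 3 3 c) (s(3 := m), out) (Suc (11 * m + 20 + (100 * (m div 2) + 1)))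
          (s(3 := 0), (out @ [True, odd m]) @ g (bits (m div 2)))"
        using False by (intro run_until_loop[OF _ _ c]) (auto simp: nregs_def)
      have eq: "(out @ [True, odd m]) @ g (bits (m div 2)) = out @ g (bits m)"
        using False by (simp add: bits.simps[of m] g_def)
      show ?thesis
        by (rule run_mono[OF loop[unfolded eq]]) (use False in linarith)
    qed
  qed
  from this[of "s 3"] have "run x (UntilSym 3 3 c) (s, out) (100 * s 3 + 1) (s(3 := 0), out @ g (bits (s 3)))"
    by simp
  from run_seq[OF this run_emit, of False] show ?thesis
    unfolding emit_binary_def c_def by (simp add: enc_word_def enc_list_def g_def eval_nat_numeral)
qed

section \<open>Loop programs\<close>

text \<open>Induction eta-expands function updates, and the simplifier then rewrites under the lambda.\<close>

declare fun_upd_def [symmetric, simp]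

datatype cond = Le "nat list" "nat list" | Bit nat | CNot cond | CAnd cond cond

fun holds :: "bool list \<Rightarrow> (nat \<Rightarrow> nat) \<Rightarrow> cond \<Rightarrow> bool" where
  "holds x e (Le is js) \<longleftrightarrow> sum_list (map e is) \<le> sum_list (map e js)"
| "holds x e (Bit k) \<longleftrightarrow> e k < length x \<and> x ! e k"
| "holds x e (CNot c) \<longleftrightarrow> \<not> holds x e c"
| "holds x e (CAnd c d) \<longleftrightarrow> holds x e c \<and> holds x e d"

text \<open>The instruction type is a parameter, so one enumeration can be read as a mathematical
  list through \<open>trace\<close> and be turned by \<open>map_loop\<close> into several printing
  passes over the same indices.\<close>

datatype 'a loop =
    Do 'a
  | Skip
  | Then "'a loop" "'a loop"
  | When cond "'a loop" "'a loop"
  | For nat nat "'a loop"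

fun trace :: "bool list \<Rightarrow> 'a loop \<Rightarrow> (nat \<Rightarrow> nat) \<Rightarrow> ('a \<times> (nat \<Rightarrow> nat)) list" where
  "trace x (Do a) e = [(a, e)]"
| "trace x Skip e = []"
| "trace x (Then P Q) e = trace x P e @ trace x Q e"
| "trace x (When c P Q) e = (if holds x e c then trace x P e else trace x Q e)"
| "trace x (For i b P) e = concat (map (\<lambda>j. trace x P (e(i := j))) [0..<e b])"

lemma trace_map: "trace x (map_loop f P) e = map (apfst f) (trace x P e)"
  by (induction P arbitrary: e) (auto simp: map_concat o_def)

fun cond_vars :: "cond \<Rightarrow> nat set" where
  "cond_vars (Le is js) = set is \<union> set js"
| "cond_vars (Bit k) = {k}"
| "cond_vars (CNot c) = cond_vars c"
| "cond_vars (CAnd c d) = cond_vars c \<union> cond_vars d"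

fun bound_vars :: "'a loop \<Rightarrow> nat set" where
  "bound_vars (Do a) = {}"
| "bound_vars Skip = {}"
| "bound_vars (Then P Q) = bound_vars P \<union> bound_vars Q"
| "bound_vars (When c P Q) = bound_vars P \<union> bound_vars Q"
| "bound_vars (For i b P) = insert i (bound_vars P)"

text \<open>Sixteen variables with two counters each fit into \<open>nregs\<close>. A loop may not
  rebind the variable of an enclosing loop, because both would use the same counters
  \<open>var i\<close> and \<open>lim i\<close>.\<close>

fun wf_loop :: "('a \<Rightarrow> nat set) \<Rightarrow> 'a loop \<Rightarrow> bool" where
  "wf_loop V (Do a) \<longleftrightarrow> V a \<subseteq> {..<16}"
| "wf_loop V Skip \<longleftrightarrow> True"
| "wf_loop V (Then P Q) \<longleftrightarrow> wf_loop V P \<and> wf_loop V Q"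
| "wf_loop V (When c P Q) \<longleftrightarrow> cond_vars c \<subseteq> {..<16} \<and> wf_loop V P \<and> wf_loop V Q"
| "wf_loop V (For i b P) \<longleftrightarrow> i < 16 \<and> b < 16 \<and> i \<notin> bound_vars P \<and> wf_loop V P"

lemma bound_vars_map [simp]: "bound_vars (map_loop f P) = bound_vars P"
  by (induction P) auto

lemma wf_loop_map [simp]: "wf_loop V (map_loop f P) = wf_loop (V \<circ> f) P"
  by (induction P) auto

section \<open>Printing instructions and their compilation to counter programs\<close>

datatype atom = Put "bool list" | PutVar nat | PutCount | Tick | Reset | PutBinary

text \<open>A unary number takes two symbols per unit because \<open>enc_word\<close> puts the
  marker \<open>True\<close> in front of each letter.\<close>

fun apply_atom :: "(nat \<Rightarrow> nat) \<Rightarrow> atom \<Rightarrow> nat \<times> bool list \<Rightarrow> nat \<times> bool list" where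
  "apply_atom e (Put w) (c, out) = (c, out @ w)"
| "apply_atom e (PutVar i) (c, out) = (c, out @ replicate (2 * e i) True)"
| "apply_atom e PutCount (c, out) = (c, out @ replicate (2 * c) True)"
| "apply_atom e Tick (c, out) = (Suc c, out)"
| "apply_atom e Reset (c, out) = (0, out)"
| "apply_atom e PutBinary (c, out) = (0, out @ enc_word (bits c))"

fun atom_vars :: "atom \<Rightarrow> nat set" where
  "atom_vars (PutVar i) = {i}"
| "atom_vars _ = {}"

definition apply_trace :: "(atom list \<times> (nat \<Rightarrow> nat)) list \<Rightarrow> nat \<times> bool list \<Rightarrow> nat \<times> bool list" where
  "apply_trace = fold (\<lambda>(as, e). fold (apply_atom e) as)"

lemma apply_trace_append: "apply_trace (xs @ ys) \<sigma> = apply_trace ys (apply_trace xs \<sigma>)"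
  by (simp add: apply_trace_def)

abbreviation wf_prog :: "atom list loop \<Rightarrow> bool" where
  "wf_prog \<equiv> wf_loop (\<lambda>as. \<Union> (atom_vars ` set as))"

definition var :: "nat \<Rightarrow> nat" where "var i = 6 + 2 * i"
definition lim :: "nat \<Rightarrow> nat" where "lim i = 7 + 2 * i"

lemma var_lim [simp]:
  "var i = var j \<longleftrightarrow> i = j" "lim i = lim j \<longleftrightarrow> i = j" "var i \<noteq> lim j" "lim j \<noteq> var i"
  "i < 16 \<Longrightarrow> var i < nregs" "i < 16 \<Longrightarrow> lim i < nregs"
  "var i \<noteq> 0" "lim i \<noteq> 0" "0 < var i" "0 < lim i"
  "var i \<noteq> Suc 0" "lim i \<noteq> Suc 0" "Suc 0 \<noteq> var i" "Suc 0 \<noteq> lim i"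

  by (simp_all add: var_def lim_def nregs_def) presburger+

lemma var_lim_numeral [simp]:
  "var i \<noteq> 2" "var i \<noteq> 3" "var i \<noteq> 4" "var i \<noteq> 5" "2 \<noteq> var i" "3 \<noteq> var i" "4 \<noteq> var i" "5 \<noteq> var i"
  "lim i \<noteq> 2" "lim i \<noteq> 3" "lim i \<noteq> 4" "lim i \<noteq> 5" "2 \<noteq> lim i" "3 \<noteq> lim i" "4 \<noteq> lim i" "5 \<noteq> lim i"
  by (simp_all add: var_def lim_def)

lemma nregs_numeral [simp]: "0 < nregs" "Suc 0 < nregs" "1 < nregs" "2 < nregs" "3 < nregs" "4 < nregs" "5 < nregs"
  by (simp_all add: nregs_def)

text \<open>Between the instructions of a loop program, counter 3 holds the number of ticks, loop variable \<open>i\<close>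
  sits in counter \<open>var i\<close>, and \<open>lim i\<close> counts the iterations that remain; the scratch counters 0, 1, 2, 4
  and 5 are empty.\<close>

definition idle :: "(nat \<Rightarrow> nat) \<Rightarrow> bool" where
  "idle s \<longleftrightarrow> s 0 = 0 \<and> s 1 = 0 \<and> s 2 = 0 \<and> s 4 = 0 \<and> s 5 = 0"

abbreviation env :: "(nat \<Rightarrow> nat) \<Rightarrow> nat \<Rightarrow> nat" where
  "env s \<equiv> \<lambda>i. s (var i)"

fun seq_list :: "com list \<Rightarrow> com" where
  "seq_list [] = skip"
| "seq_list (c # cs) = c ;; seq_list cs"

lemma run_emits: "run x (seq_list (map emit w)) (s, out) (2 * length w + 1) (s, out @ w)"
proof (induction w arbitrary: out)
  case Nil
  then show ?case by (simp add: run_mono[OF run_skip])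
next
  case (Cons b w)
  show ?case
    using run_mono[OF run_seq[OF run_emit Cons.IH], of _ b] by simp
qed

fun compile_atom :: "atom \<Rightarrow> com" where
  "compile_atom (Put w) = seq_list (map emit w)"
| "compile_atom (PutVar i) = emit_unary (var i)"
| "compile_atom PutCount = emit_unary 3"
| "compile_atom Tick = inc 3"
| "compile_atom Reset = clear 3"
| "compile_atom PutBinary = emit_binary"

fun atom_time :: "atom \<Rightarrow> nat \<Rightarrow> nat \<Rightarrow> nat" where
  "atom_time (Put w) B C = 2 * length w + 1"
| "atom_time (PutVar i) B C = 12 * B + 3"
| "atom_time PutCount B C = 12 * C + 3"
| "atom_time Tick B C = 1"
| "atom_time Reset B C = 2 * C + 1"
| "atom_time PutBinary B C = 100 * C + 3"

lemma run_compile_atom: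
  assumes "idle s" "atom_vars a \<subseteq> {..<16}" "\<And>i. i < 16 \<Longrightarrow> env s i \<le> B" "s 3 \<le> C"
    and "apply_atom (env s) a (s 3, out) = (c', out')"
  shows "run x (compile_atom a) (s, out) (atom_time a B C) (s(3 := c'), out')"
proof (cases a)
  case (Put w)
  then show ?thesis using run_emits assms(5) by (auto simp: fun_upd_idem)
next
  case (PutVar i)
  then have "env s i \<le> B" using assms(2,3) by auto
  with PutVar show ?thesis
    using assms run_mono[OF run_emit_unary[of "var i" s x out], of "12 * B + 3"]
    by (auto simp: fun_upd_idem idle_def)
next
  case PutCount
  then show ?thesis
    using assms run_mono[OF run_emit_unary[of 3 s x out], of "12 * C + 3"]
    by (auto simp: fun_upd_idem idle_def)
next
  case Tick
  then show ?thesis using assms(5) run_inc[of 3 x s out] by auto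
next
  case Reset
  then show ?thesis
    using assms(4,5) run_mono[OF run_clear[of 3 x s out], of "2 * C + 1"] by auto
next
  case PutBinary
  then show ?thesis
    using assms run_mono[OF run_emit_binary[of s x out], of "100 * C + 3"] by (auto simp: idle_def)
qed

fun atoms_time :: "atom list \<Rightarrow> nat \<Rightarrow> nat \<Rightarrow> nat" where
  "atoms_time [] B C = 1"
| "atoms_time (a # as) B C = Suc (atom_time a B C + atoms_time as B C)"

lemma apply_atom_count: "fst (apply_atom e a \<sigma>) \<le> Suc (fst \<sigma>)"
  by (cases \<sigma>; cases a) auto

lemma run_compile_atoms:
  assumes "idle s" "\<Union> (atom_vars ` set as) \<subseteq> {..<16}" "\<And>i. i < 16 \<Longrightarrow> env s i \<le> B"
    and "s 3 + length as \<le> C" "fold (apply_atom (env s)) as (s 3, out) = (c', out')"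
  shows "c' \<le> s 3 + length as \<and>
    run x (seq_list (map compile_atom as)) (s, out) (atoms_time as B C) (s(3 := c'), out')"
  using assms
proof (induction as arbitrary: s out)
  case Nil
  then show ?case by (auto simp: fun_upd_idem run_skip)
next
  case (Cons a as)
  obtain c1 out1 where 1: "apply_atom (env s) a (s 3, out) = (c1, out1)"
    by force
  have c1: "c1 \<le> Suc (s 3)"
    using apply_atom_count[of "env s" a "(s 3, out)"] 1 by simp
  have run1: "run x (compile_atom a) (s, out) (atom_time a B C) (s(3 := c1), out1)"
    using Cons.prems 1 by (intro run_compile_atom) auto
  have "c' \<le> (s(3 := c1)) 3 + length as \<and> run x (seq_list (map compile_atom as)) (s(3 := c1), out1)
      (atoms_time as B C) ((s(3 := c1))(3 := c'), out')"
    using Cons.prems c1 1 by (intro Cons.IH) (auto simp: idle_def)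
  then show ?case
    using c1 run_seq[OF run1, of "seq_list (map compile_atom as)" "atoms_time as B C" "(s(3 := c'), out')"]
    by simp
qed

lemma run_add_regs:
  assumes "idle (s(2 := 0))" "set is \<subseteq> {..<16}" "\<And>i. i < 16 \<Longrightarrow> env s i \<le> B"
  shows "run x (seq_list (map (\<lambda>i. add_reg (var i) 2) is)) (s, out) (length is * (10 * B + 4) + 1)
    (s(2 := s 2 + sum_list (map (env s) is)), out)"
  using assms
proof (induction "is" arbitrary: s)
  case Nil
  then show ?case by (simp add: fun_upd_idem run_skip)
next
  case (Cons i "is")
  define s' where "s' = s(2 := s 2 + env s i)"
  have i: "i < 16" "env s i \<le> B" using Cons.prems by auto
  have 1: "run x (add_reg (var i) 2) (s, out) (10 * B + 3) (s', out)"
    unfolding s'_def using i Cons.prems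
    by (intro run_mono[OF run_add_reg]) (auto simp: idle_def)
  have "run x (seq_list (map (\<lambda>i. add_reg (var i) 2) is)) (s', out) (length is * (10 * B + 4) + 1)
      (s'(2 := s' 2 + sum_list (map (env s') is)), out)"
    by (rule Cons.IH) (use Cons.prems in \<open>simp_all add: s'_def\<close>)
  from run_mono[OF run_seq[OF 1 this]] show ?case
    by (simp add: s'_def add_ac)
qed

lemma run_sub_regs:
  assumes "idle (s(2 := 0))" "set is \<subseteq> {..<16}" "\<And>i. i < 16 \<Longrightarrow> env s i \<le> B"
  shows "run x (seq_list (map (\<lambda>i. sub_reg (var i) 2) is)) (s, out) (length is * (10 * B + 4) + 1)
    (s(2 := s 2 - sum_list (map (env s) is)), out)"
  using assms
proof (induction "is" arbitrary: s)
  case Nil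
  then show ?case by (simp add: fun_upd_idem run_skip)
next
  case (Cons i "is")
  define s' where "s' = s(2 := s 2 - env s i)"
  have i: "i < 16" "env s i \<le> B" using Cons.prems by auto
  have 1: "run x (sub_reg (var i) 2) (s, out) (10 * B + 3) (s', out)"
    unfolding s'_def using i Cons.prems
    by (intro run_mono[OF run_sub_reg]) (auto simp: idle_def)
  have "run x (seq_list (map (\<lambda>i. sub_reg (var i) 2) is)) (s', out) (length is * (10 * B + 4) + 1)
      (s'(2 := s' 2 - sum_list (map (env s') is)), out)"
    by (rule Cons.IH) (use Cons.prems in \<open>simp_all add: s'_def\<close>)
  from run_mono[OF run_seq[OF 1 this]] show ?case
    by (simp add: s'_def add_ac)
qed

text \<open>The branches are passed as continuations, so a test leaves no truth value behind in a
  counter. Truncated subtraction decides \<open>Le\<close>: the difference is zero iff the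
  inequality holds. For \<open>Bit\<close> the extra \<open>inc 0\<close> compensates that counter
  value \<open>k + 1\<close> scans the input bit \<open>k\<close>.\<close>

fun compile_cond :: "cond \<Rightarrow> com \<Rightarrow> com \<Rightarrow> com" where
  "compile_cond (Le is js) a b = seq_list (map (\<lambda>i. add_reg (var i) 2) is) ;;
     seq_list (map (\<lambda>i. sub_reg (var i) 2) js) ;; IfSym 2 3 a (clear 2 ;; b)"
| "compile_cond (Bit k) a b = add_reg (var k) 0 ;; inc 0 ;; IfSym 0 2 (clear 0 ;; a) (clear 0 ;; b)"
| "compile_cond (CNot c) a b = compile_cond c b a"
| "compile_cond (CAnd c d) a b = compile_cond c (compile_cond d a b) b"

fun cond_time :: "cond \<Rightarrow> nat \<Rightarrow> nat" where
  "cond_time (Le is js) B = length is * (10 * B + 4) + length js * (10 * B + 4) + 2 * (length is * B) + 7"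
| "cond_time (Bit k) B = 12 * B + 12"
| "cond_time (CNot c) B = cond_time c B"
| "cond_time (CAnd c d) B = cond_time c B + cond_time d B"

lemma sum_list_env_le:
  "set is \<subseteq> {..<16} \<Longrightarrow> (\<And>i. i < (16::nat) \<Longrightarrow> e i \<le> (B::nat)) \<Longrightarrow> sum_list (map e is) \<le> length is * B"
  by (induction "is") (auto intro: add_mono)

lemma run_compile_cond:
  assumes "idle s" "cond_vars c \<subseteq> {..<16}" "\<And>i. i < 16 \<Longrightarrow> env s i \<le> B"
    and "run x (if holds x (env s) c then a else b) (s, out) t \<sigma>"
  shows "run x (compile_cond c a b) (s, out) (cond_time c B + t) \<sigma>"
  using assms
proof (induction c arbitrary: a b t)
  case (Le "is" js)
  define s1 where "s1 = s(2 := sum_list (map (env s) is))"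
  define s2 where "s2 = s(2 := sum_list (map (env s) is) - sum_list (map (env s) js))"
  have 1: "run x (seq_list (map (\<lambda>i. add_reg (var i) 2) is)) (s, out) (length is * (10 * B + 4) + 1) (s1, out)"
    using run_add_regs[of s "is" B x out] Le.prems by (auto simp: s1_def idle_def)
  have 2: "run x (seq_list (map (\<lambda>i. sub_reg (var i) 2) js)) (s1, out) (length js * (10 * B + 4) + 1) (s2, out)"
    using run_sub_regs[of s1 js B x out] Le.prems by (auto simp: s1_def s2_def idle_def)
  have "s2 2 \<le> length is * B"
    using sum_list_env_le[of "is" "env s" B] Le.prems by (auto simp: s2_def)
  then have clear: "run x (clear 2) (s2, out) (2 * (length is * B) + 1) (s, out)"
    using run_mono[OF run_clear[of 2 x s2 out]] Le.prems(1)
    by (auto simp: s2_def  idle_def fun_upd_idem)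
  have "run x (if scanned x 2 (s2 2) = 3 then a else clear 2 ;; b) (s2, out) (2 * (length is * B) + 2 + t) \<sigma>"
  proof (cases "holds x (env s) (Le is js)")
    case True
    then have "s2 = s"
      using Le.prems(1) by (auto simp: s2_def idle_def fun_eq_iff)
    then show ?thesis
      using True Le.prems by (auto simp: idle_def intro: run_mono)
  next
    case False
    then have "run x b (s, out) t \<sigma>" using Le.prems by simp
    from run_seq[OF clear this] show ?thesis
      using False by (auto simp: s2_def elim: run_mono)
  qed
  then have "run x (IfSym 2 3 a (clear 2 ;; b)) (s2, out) (Suc (2 * (length is * B) + 2 + t)) \<sigma>"
    by (intro run_if) auto
  then show ?case
    by (simp add: run_mono[OF run_seq[OF 1 run_seq[OF 2]]])
next
  case (Bit k)
  define s1 where "s1 = s(0 := env s k)"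
  define s2 where "s2 = s(0 := Suc (env s k))"
  have k: "k < 16" "env s k \<le> B" using Bit.prems by auto
  have 1: "run x (add_reg (var k) 0) (s, out) (10 * B + 3) (s1, out)"
    using run_mono[OF run_add_reg[of "var k" 0 s x out]] k Bit.prems by (auto simp: s1_def idle_def)
  have 2: "run x (inc 0) (s1, out) 1 (s2, out)"
    using run_inc[of 0 x s1 out] by (simp add: s1_def s2_def)
  have clear: "run x (clear 0) (s2, out) (2 * B + 3) (s, out)"
    using run_mono[OF run_clear[of 0 x s2 out]] Bit.prems(1) k
    by (auto simp: s2_def  idle_def fun_upd_idem)
  have "(scanned x 0 (s2 0) = 2) = holds x (env s) (Bit k)"
    by (auto simp: scanned_def s2_def word_tape_def sym_of_bit_def)
  then have "run x (if scanned x 0 (s2 0) = 2 then clear 0 ;; a else clear 0 ;; b) (s2, out) (Suc (2 * B + 3 + t)) \<sigma>"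
    using Bit.prems(4) run_seq[OF clear, of _ t \<sigma>] by (auto split: if_splits)
  then have "run x (IfSym 0 2 (clear 0 ;; a) (clear 0 ;; b)) (s2, out) (Suc (Suc (2 * B + 3 + t))) \<sigma>"
    by (intro run_if) auto
  then show ?case
    by (simp add: run_mono[OF run_seq[OF 1 run_seq[OF 2]]])
next
  case (CNot c)
  then show ?case by (auto split: if_splits)
next
  case (CAnd c d)
  have "run x (if holds x (env s) c then compile_cond d a b else b) (s, out) (cond_time d B + t) \<sigma>"
    using CAnd.IH(2)[of a b t] CAnd.prems by (auto intro: run_mono)
  then show ?case
    using CAnd.IH(1)[of "compile_cond d a b" b "cond_time d B + t"] CAnd.prems by (auto simp: add_ac)
qed

fun compile :: "atom list loop \<Rightarrow> com" where
  "compile (Do as) = seq_list (map compile_atom as)"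
| "compile Skip = skip"
| "compile (Then P Q) = compile P ;; compile Q"
| "compile (When c P Q) = compile_cond c (compile P) (compile Q)"
| "compile (For i b P) = add_reg (var b) (lim i) ;;
     UntilSym (lim i) 3 (compile P ;; inc (var i) ;; dec (lim i)) ;; clear (var i)"

text \<open>A crude bound on the growth of the tick counter: every instruction counts as a tick and
  both branches of a test are added. It only has to be polynomial in \<open>B\<close>.\<close>

fun ticks :: "atom list loop \<Rightarrow> nat \<Rightarrow> nat" where
  "ticks (Do as) B = length as"
| "ticks Skip B = 0"
| "ticks (Then P Q) B = ticks P B + ticks Q B"
| "ticks (When c P Q) B = ticks P B + ticks Q B"
| "ticks (For i b P) B = B * ticks P B"

fun time :: "atom list loop \<Rightarrow> nat \<Rightarrow> nat \<Rightarrow> nat" where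
  "time (Do as) B C = atoms_time as B C"
| "time Skip B C = 1"
| "time (Then P Q) B C = Suc (time P B C + time Q B C)"
| "time (When c P Q) B C = cond_time c B + time P B C + time Q B C"
| "time (For i b P) B C = B * (time P B C + 5) + 12 * B + 7"

text \<open>\<open>B\<close> bounds the loop variables and \<open>C\<close> bounds the counter during the whole run.\<close>

lemma run_compile:
  assumes "wf_prog P" "idle s" "\<And>i. i < 16 \<Longrightarrow> env s i \<le> B"
    and "\<And>i. i \<in> bound_vars P \<Longrightarrow> s (var i) = 0 \<and> s (lim i) = 0"
    and "s 3 + ticks P B \<le> C" "apply_trace (trace x P (env s)) (s 3, out) = (c', out')"
  shows "c' \<le> s 3 + ticks P B \<and> run x (compile P) (s, out) (time P B C) (s(3 := c'), out')"
  using assms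
proof (induction P arbitrary: s out c' out')
  case (Do as)
  then show ?case
    using run_compile_atoms[of s as B C out c' out' x] by (simp add: apply_trace_def)
next
  case Skip
  then show ?case by (auto simp: apply_trace_def fun_upd_idem run_skip)
next
  case (Then P Q)
  obtain c1 out1 where 1: "apply_trace (trace x P (env s)) (s 3, out) = (c1, out1)"
    by force
  have P: "c1 \<le> s 3 + ticks P B \<and> run x (compile P) (s, out) (time P B C) (s(3 := c1), out1)"
    using Then.prems 1 by (intro Then.IH) auto
  have "c' \<le> (s(3 := c1)) 3 + ticks Q B \<and>
      run x (compile Q) (s(3 := c1), out1) (time Q B C) ((s(3 := c1))(3 := c'), out')"
    using Then.prems 1 P by (intro Then.IH) (auto simp: idle_def apply_trace_append)
  then show ?case
    using P run_seq[of x "compile P" "(s, out)" "time P B C" "(s(3 := c1), out1)"] by auto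
next
  case (When c P Q)
  have "c' \<le> s 3 + ticks (When c P Q) B \<and>
      run x (if holds x (env s) c then compile P else compile Q) (s, out) (time P B C + time Q B C) (s(3 := c'), out')"
  proof (cases "holds x (env s) c")
    case True
    then show ?thesis
      using When.IH(1)[of s out c' out'] When.prems by (auto intro: run_mono)
  next
    case False
    then show ?thesis
      using When.IH(2)[of s out c' out'] When.prems by (auto intro: run_mono)
  qed
  then show ?case
    using When.prems run_compile_cond[of s c B x "compile P" "compile Q" out "time P B C + time Q B C"]
    by (simp add: add.assoc)
next
  case (For i b P)
  define n where "n = env s b"
  have i: "i < 16" "b < 16" "i \<notin> bound_vars P" "wf_prog P" "s (var i) = 0" "s (lim i) = 0"
    using For.prems by auto
  have n: "n \<le> B" using For.prems i by (simp add: n_def)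
  define \<tau> where "\<tau> j = apply_trace (concat (map (\<lambda>j. trace x P ((env s)(i := j))) [0..<j])) (s 3, out)" for j
  have \<tau>_Suc: "\<tau> (Suc j) = apply_trace (trace x P ((env s)(i := j))) (\<tau> j)" for j
    by (simp add: \<tau>_def apply_trace_append)
  define f where "f j = s(var i := j, lim i := n - j, 3 := fst (\<tau> j))" for j
  have env_f: "env (f j) = (env s)(i := j)" for j
    by (auto simp: f_def fun_eq_iff)
  have f_3: "f j 3 = fst (\<tau> j)" for j
    by (simp add: f_def)
  have mono: "j * ticks P B + ticks P B \<le> B * ticks P B" if "j < n" for j
    using that n mult_le_mono1[of "Suc j" B "ticks P B"] by simp
  have body: "fst (\<tau> (Suc j)) \<le> fst (\<tau> j) + ticks P B \<and>
      run x (compile P) (f j, snd (\<tau> j)) (time P B C) ((f j)(3 := fst (\<tau> (Suc j))), snd (\<tau> (Suc j)))"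
    if "j < n" "fst (\<tau> j) \<le> s 3 + j * ticks P B" for j
  proof -
    have "fst (\<tau> (Suc j)) \<le> f j 3 + ticks P B \<and>
      run x (compile P) (f j, snd (\<tau> j)) (time P B C) ((f j)(3 := fst (\<tau> (Suc j))), snd (\<tau> (Suc j)))"
    proof (rule For.IH)
      show "wf_prog P" by (fact i)
      show "idle (f j)"
        using For.prems(2) by (simp add: idle_def f_def)
      show "env (f j) k \<le> B" if "k < 16" for k
        using that \<open>j < n\<close> n For.prems(3)[of k] by (simp add: f_def)
      show "f j (var k) = 0 \<and> f j (lim k) = 0" if "k \<in> bound_vars P" for k
        using that i For.prems(4)[of k] by (auto simp: f_def)
      show "f j 3 + ticks P B \<le> C"
        using that mono[of j] For.prems(5) by (simp add: f_3)
      show "apply_trace (trace x P (env (f j))) (f j 3, snd (\<tau> j)) = (fst (\<tau> (Suc j)), snd (\<tau> (Suc j)))"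
        unfolding env_f f_3 \<tau>_Suc by simp
    qed
    then show ?thesis by (simp add: f_3)
  qed
  have count: "fst (\<tau> j) \<le> s 3 + j * ticks P B" if "j \<le> n" for j
    using that
  proof (induction j)
    case (Suc j)
    then show ?case using body[of j] by simp
  qed (simp add: \<tau>_def apply_trace_def)
  have step: "run x (compile P ;; inc (var i) ;; dec (lim i)) (f j, snd (\<tau> j)) (time P B C + 4)
      (f (Suc j), snd (\<tau> (Suc j)))" if "j < n" for j
  proof -
    define g where "g = (f j)(3 := fst (\<tau> (Suc j)))"
    have "run x (compile P) (f j, snd (\<tau> j)) (time P B C) (g, snd (\<tau> (Suc j)))"
      using body[OF that] count[of j] that by (simp add: g_def)
    moreover have "run x (inc (var i)) (g, snd (\<tau> (Suc j))) 1 (g(var i := Suc j), snd (\<tau> (Suc j)))"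
      using run_inc[of "var i" x g "snd (\<tau> (Suc j))"] i by (simp add: g_def f_def)
    moreover have "run x (dec (lim i)) (g(var i := Suc j), snd (\<tau> (Suc j))) 1 (f (Suc j), snd (\<tau> (Suc j)))"
    proof -
      have "g(var i := Suc j, lim i := n - j - 1) = f (Suc j)"
        by (auto simp: g_def f_def fun_eq_iff)
      then show ?thesis
        using run_dec[of "lim i" x "g(var i := Suc j)" "snd (\<tau> (Suc j))"] i by (simp add: g_def f_def)
    qed
    ultimately show ?thesis
      by (rule run_mono[OF run_seq[OF _ run_seq]]) simp
  qed
  have f_lim: "f j (lim i) = n - j" for j
    by (simp add: f_def)
  have loop: "run x (UntilSym (lim i) 3 (compile P ;; inc (var i) ;; dec (lim i))) (f 0, snd (\<tau> 0))
      (n * Suc (time P B C + 4) + 1) (f n, snd (\<tau> n))"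
    using step i by (intro run_until[where out = "\<lambda>j. snd (\<tau> j)"] conjI) (simp_all add: f_lim)
  have "f 0 = s(lim i := n)"
    using i by (auto simp: f_def \<tau>_def apply_trace_def fun_eq_iff)
  then have init: "run x (add_reg (var b) (lim i)) (s, out) (10 * B + 3) (f 0, snd (\<tau> 0))"
    using run_mono[OF run_add_reg[of "var b" "lim i" s x out]] i n For.prems(2)
    by (simp add: idle_def n_def \<tau>_def apply_trace_def)
  have \<tau>_n: "\<tau> n = (c', out')"
    using For.prems(6) by (simp add: \<tau>_def n_def)
  have "(f n)(var i := 0) = s(3 := c')"
    using i \<tau>_n by (auto simp: f_def fun_eq_iff)
  then have final: "run x (clear (var i)) (f n, snd (\<tau> n)) (2 * B + 1) (s(3 := c'), out')"
    using run_mono[OF run_clear[of "var i" x "f n" out']] i n \<tau>_n by (simp add: f_def)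
  have "run x (compile (For i b P)) (s, out) (time (For i b P) B C) (s(3 := c'), out')"
    unfolding compile.simps
    by (rule run_mono[OF run_seq[OF init run_seq[OF loop final]]]) (use n in \<open>simp add: algebra_simps add_mono mult_le_mono1\<close>)
  moreover have "c' \<le> s 3 + ticks (For i b P) B"
    using count[of n] \<tau>_n add_left_mono[OF mult_le_mono1[OF n, of "ticks P B"], of "s 3"]
    by (auto intro: order_trans simp del: mult_le_cancel2)
  ultimately show ?case by simp
qed

section \<open>Loop programs run in polynomial time\<close>

text \<open>Being bounded by a polynomial is closed under the operations in the running times, so
  the bounds can follow their recursion without any polynomial being written down.\<close>

definition poly_bounded :: "(nat \<Rightarrow> nat) \<Rightarrow> bool" where
  "poly_bounded f \<longleftrightarrow> (\<exists>q :: nat poly. \<forall>n. f n \<le> poly q n)"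

lemma poly_bounded_poly: "poly_bounded (poly q)"
  unfolding poly_bounded_def by blast

lemma poly_bounded_const: "poly_bounded (\<lambda>n. c)"
  unfolding poly_bounded_def by (intro exI[of _ "[:c:]"]) simp

lemma poly_bounded_ident: "poly_bounded (\<lambda>n. n)"
  unfolding poly_bounded_def by (intro exI[of _ "[:0, 1:]"]) simp

lemma poly_bounded_add: "poly_bounded f \<Longrightarrow> poly_bounded g \<Longrightarrow> poly_bounded (\<lambda>n. f n + g n)"
  unfolding poly_bounded_def by (metis add_mono poly_add)

lemma poly_bounded_mult: "poly_bounded f \<Longrightarrow> poly_bounded g \<Longrightarrow> poly_bounded (\<lambda>n. f n * g n)"
  unfolding poly_bounded_def by (metis mult_le_mono poly_mult)

lemma poly_bounded_Suc: "poly_bounded f \<Longrightarrow> poly_bounded (\<lambda>n. Suc (f n))"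
  using poly_bounded_add[OF poly_bounded_const[of 1]] by simp

lemmas poly_bounded_intros = poly_bounded_poly poly_bounded_const poly_bounded_ident
  poly_bounded_add poly_bounded_mult poly_bounded_Suc

lemma poly_bounded_cond_time: "poly_bounded B \<Longrightarrow> poly_bounded (\<lambda>n. cond_time c (B n))"
  by (induction c) (auto intro!: poly_bounded_intros)

lemma poly_bounded_atoms_time:
  assumes "poly_bounded B" "poly_bounded C"
  shows "poly_bounded (\<lambda>n. atoms_time as (B n) (C n))"
proof (induction as)
  case Nil
  then show ?case by (simp add: poly_bounded_const)
next
  case (Cons a as)
  have "poly_bounded (\<lambda>n. atom_time a (B n) (C n))"
    by (cases a) (auto intro!: poly_bounded_intros assms)
  with Cons show ?case
    by (auto intro!: poly_bounded_intros)
qed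

lemma poly_bounded_ticks: "poly_bounded B \<Longrightarrow> poly_bounded (\<lambda>n. ticks P (B n))"
  by (induction P) (auto intro!: poly_bounded_intros)

lemma poly_bounded_time:
  "poly_bounded B \<Longrightarrow> poly_bounded C \<Longrightarrow> poly_bounded (\<lambda>n. time P (B n) (C n))"
  by (induction P)
    (auto intro!: poly_bounded_intros poly_bounded_atoms_time poly_bounded_cond_time)

section \<open>Loading the input length and polynomials of it into counters\<close>

fun horner :: "nat list \<Rightarrow> nat \<Rightarrow> com" where
  "horner [] r = skip"
| "horner (a # cs) r = horner cs r ;; times 5 (var 1) (add_reg r 4) ;; clear r ;; add_reg 4 r ;;
     clear 4 ;; seq_list (replicate a (inc r))"

fun horner_time :: "nat list \<Rightarrow> nat \<Rightarrow> nat" where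
  "horner_time [] n = 1"
| "horner_time (a # cs) n = horner_time cs n + 22 * n * poly (Poly cs) n + 12 * n
     + 2 * poly (Poly cs) n + 2 * a + 14"

lemma run_incs:
  "r < nregs \<Longrightarrow> run x (seq_list (replicate a (inc r))) (s, out) (2 * a + 1) (s(r := s r + a), out)"
proof (induction a arbitrary: s)
  case 0
  then show ?case by (simp add: run_skip)
next
  case (Suc a)
  have "run x (seq_list (replicate a (inc r))) (s(r := Suc (s r)), out) (2 * a + 1) (s(r := Suc (s r) + a), out)"
    using Suc.IH[of "s(r := Suc (s r))"] Suc.prems by simp
  from run_seq[OF run_inc this] show ?case
    using Suc.prems by simp
qed

text \<open>Horner's scheme. The product of \<open>n\<close> with the value reached so far is formed
  in counter 4 by repeated addition; counter 5 records the rounds because \<open>add_reg\<close>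
  itself already occupies counter 1.\<close>

lemma run_horner:
  assumes "idle s" "s (var k) = 0" "s (var 1) = n" "k < 16" "k \<noteq> 1"
  shows "run x (horner cs (var k)) (s, out) (horner_time cs n) (s(var k := poly (Poly cs) n), out)"
proof (induction cs)
  case Nil
  then show ?case using assms(2) by (simp add: run_skip fun_upd_idem)
next
  case (Cons a cs)
  define v where "v = poly (Poly cs) n"
  define r where "r = var k"
  have r: "r < nregs" "r \<noteq> 1" "r \<noteq> 4" "r \<noteq> 5" "r \<noteq> var 1"
    using assms by (auto simp: r_def)
  have s: "s 1 = 0" "s 4 = 0" "s 5 = 0" "s r = 0" "s (var 1) = n"
    using assms by (auto simp: idle_def r_def)
  define f where "f i = s(r := v, 4 := i * v)" for i
  have "run x (times 5 (var 1) (add_reg r 4)) (f 0, out) (n * (10 * v + 3 + 9) + 3) (f n, out)"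
  proof (rule run_times[where out = "\<lambda>_. out"])
    fix i
    assume "i < n"
    let ?s = "(f i)(var 1 := n - Suc i, 5 := Suc i)"
    have "?s(4 := ?s 4 + ?s r) = (f (Suc i))(var 1 := n - Suc i, 5 := Suc i)"
      using r by (auto simp: f_def fun_eq_iff)
    moreover have "run x (add_reg r 4) (?s, out) (10 * ?s r + 3) (?s(4 := ?s 4 + ?s r), out)"
      using r s by (intro run_add_reg) (auto simp: f_def)
    ultimately show "run x (add_reg r 4) (?s, out) (10 * v + 3) ((f (Suc i))(var 1 := n - Suc i, 5 := Suc i), out)"
      using r by (simp add: f_def)
  qed (use r s in \<open>auto simp: f_def\<close>)
  moreover have "f 0 = s(r := v)"
    using s r by (auto simp: f_def fun_eq_iff)
  ultimately have 1: "run x (times 5 (var 1) (add_reg r 4)) (s(r := v), out) (n * (10 * v + 3 + 9) + 3) (f n, out)"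
    by simp
  have 2: "run x (clear r) (f n, out) (2 * v + 1) (s(4 := n * v), out)"
    using run_clear[OF r(1), of x "f n" out] r s by (simp add: f_def fun_upd_idem fun_upd_twist)
  have 3: "run x (add_reg 4 r) (s(4 := n * v), out) (10 * (n * v) + 3) (s(4 := n * v, r := n * v), out)"
    using run_add_reg[of 4 r "s(4 := n * v)" x out] r s by simp
  have 4: "run x (clear 4) (s(4 := n * v, r := n * v), out) (2 * (n * v) + 1) (s(r := n * v), out)"
    using run_clear[of 4 x "s(4 := n * v, r := n * v)" out] r s by (simp add: fun_upd_idem fun_upd_twist)
  have 5: "run x (seq_list (replicate a (inc r))) (s(r := n * v), out) (2 * a + 1) (s(r := a + n * v), out)"
    using run_incs[OF r(1), of x a "s(r := n * v)" out] by (simp add: add.commute)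
  have "run x (horner (a # cs) r) (s, out) (horner_time (a # cs) n) (s(r := a + n * v), out)"
    unfolding horner.simps
    by (rule run_mono[OF run_seq[OF Cons.IH[folded r_def v_def] run_seq[OF 1 run_seq[OF 2 run_seq[OF 3 run_seq[OF 4 5]]]]]])
      (simp add: v_def algebra_simps)
  then show ?case
    by (simp add: r_def v_def)
qed

lemma poly_bounded_horner_time: "poly_bounded (horner_time cs)"
  by (induction cs) (auto intro!: poly_bounded_intros)

definition base_env :: "nat poly \<Rightarrow> nat poly \<Rightarrow> nat poly \<Rightarrow> nat \<Rightarrow> nat \<Rightarrow> nat" where
  "base_env p q r n = (\<lambda>_. 0)(0 := 1, 1 := n, 2 := poly p n, 3 := poly q n, 4 := poly r n)"

text \<open>The first \<open>inc 0\<close> steps off the marker onto the first input cell; counter 0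
  then walks to the first blank while loop variable 1 measures the length.\<close>

definition load_env :: "nat poly \<Rightarrow> nat poly \<Rightarrow> nat poly \<Rightarrow> com" where
  "load_env p q r = inc 0 ;; UntilSym 0 0 (inc 0 ;; inc (var 1)) ;; clear 0 ;; inc (var 0) ;;
     horner (coeffs p) (var 2) ;; horner (coeffs q) (var 3) ;; horner (coeffs r) (var 4)"

definition load_time :: "nat poly \<Rightarrow> nat poly \<Rightarrow> nat poly \<Rightarrow> nat \<Rightarrow> nat" where
  "load_time p q r n = 6 * n + 13 + horner_time (coeffs p) n + horner_time (coeffs q) n + horner_time (coeffs r) n"

lemma run_load_env:
  "\<exists>s. run x (load_env p q r) (\<lambda>_. 0, []) (load_time p q r (length x)) (s, []) \<and>
     env s = base_env p q r (length x) \<and> (\<forall>j. s j \<noteq> 0 \<longrightarrow> j \<in> var ` {..<5})"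
proof -
  define n where "n = length x"
  define f where "f i = (\<lambda>_. 0 :: nat)(0 := Suc i, var 1 := i)" for i
  have 1: "run x (inc 0) (\<lambda>_. 0, []) 1 (f 0, [])"
    using run_inc[of 0 x "\<lambda>_. 0" "[]"] by (simp add: f_def fun_upd_idem)
  have "run x (inc 0 ;; inc (var 1)) (f i, []) 3 (f (Suc i), [])" for i
  proof -
    have "(f i)(0 := Suc (f i 0), var 1 := Suc i) = f (Suc i)"
      by (auto simp: f_def fun_eq_iff)
    then show ?thesis
      using run_seq[OF run_inc run_inc, of 0 "var 1" x "f i" "[]"] by (simp add: f_def eval_nat_numeral)
  qed
  moreover have "scanned x 0 (f i 0) = 0 \<longleftrightarrow> n \<le> i" for i
    by (auto simp: f_def scanned_def word_tape_def sym_of_bit_def n_def)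
  ultimately have 2: "run x (UntilSym 0 0 (inc 0 ;; inc (var 1))) (f 0, []) (n * Suc 3 + 1) (f n, [])"
    by (intro run_until[where out = "\<lambda>_. []"] conjI) auto
  define s1 where "s1 = (\<lambda>_. 0 :: nat)(var 1 := n)"
  define s2 where "s2 = s1(var 0 := 1)"
  define s3 where "s3 = s2(var 2 := poly p n)"
  define s4 where "s4 = s3(var 3 := poly q n)"
  define s5 where "s5 = s4(var 4 := poly r n)"
  have "(f n)(0 := 0) = s1"
    by (auto simp: f_def s1_def fun_eq_iff)
  then have 3: "run x (clear 0) (f n, []) (2 * Suc n + 1) (s1, [])"
    using run_clear[of 0 x "f n" "[]"] by (simp add: f_def)
  have 4: "run x (inc (var 0)) (s1, []) 1 (s2, [])"
    using run_inc[of "var 0" x s1 "[]"] by (simp add: s2_def s1_def)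
  have 5: "run x (horner (coeffs p) (var 2)) (s2, []) (horner_time (coeffs p) n) (s3, [])"
    using run_horner[of s2 2 n x "coeffs p" "[]"] by (simp add: s3_def s2_def s1_def idle_def)
  have 6: "run x (horner (coeffs q) (var 3)) (s3, []) (horner_time (coeffs q) n) (s4, [])"
    using run_horner[of s3 3 n x "coeffs q" "[]"] by (simp add: s4_def s3_def s2_def s1_def idle_def)
  have 7: "run x (horner (coeffs r) (var 4)) (s4, []) (horner_time (coeffs r) n) (s5, [])"
    using run_horner[of s4 4 n x "coeffs r" "[]"] by (simp add: s5_def s4_def s3_def s2_def s1_def idle_def)
  have "run x (load_env p q r) (\<lambda>_. 0, []) (load_time p q r n) (s5, [])"
    unfolding load_env_def
    by (rule run_mono[OF run_seq[OF 1 run_seq[OF 2 run_seq[OF 3 run_seq[OF 4 run_seq[OF 5 run_seq[OF 6 7]]]]]]])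
      (simp add: load_time_def)
  moreover have "env s5 = base_env p q r n"
    by (auto simp: s5_def s4_def s3_def s2_def s1_def base_env_def fun_eq_iff)
  moreover have "\<forall>j. s5 j \<noteq> 0 \<longrightarrow> j \<in> var ` {..<5}"
    by (auto simp: s5_def s4_def s3_def s2_def s1_def)
  ultimately show ?thesis
    by (auto simp: n_def)
qed

text \<open>An action writes before it moves, so two atoms are needed to put the marker into cell
  -1: one brings the counter heads there, the other writes.\<close>

definition prepare :: com where
  "prepare = Atom (\<lambda>rs. map (\<lambda>j. (rs ! j, if Suc j = length rs then Stay else Left)) [0..<length rs]) ;;
     Atom (\<lambda>rs. map (\<lambda>j. if Suc j = length rs then (rs ! j, Stay) else (3, Stay)) [0..<length rs])"

lemma prepare:
  "texec prepare ((word_tape x, 0) # replicate nregs (word_tape [], 0)) 3 (tapes x (\<lambda>_. 0) [])"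
proof -
  define ts where "ts = (word_tape x, 0 :: int) # replicate nregs (word_tape [], 0)"
  define w where "w j = word_tape (if j = 0 then x else [])" for j :: nat
  have len: "length ts = Suc nregs" by (simp add: ts_def)
  have nth: "ts ! j = (w j, 0)" if "j < length ts" for j
    using that by (cases j) (auto simp: ts_def w_def)
  have scan_ts: "scan ts ! j = w j 0" if "j < length ts" for j
    using that nth by simp
  define ts' where "ts' = map (\<lambda>j. (w j, if j = nregs then 0 else -1 :: int)) [0..<Suc nregs]"
  have len': "length ts' = Suc nregs" by (simp add: ts'_def)
  have nth': "ts' ! j = (w j, if j = nregs then 0 else -1)" if "j < Suc nregs" for j
    using that by (simp add: ts'_def del: upt_Suc)
  have w_less: "w j i < 4" for j i
    by (simp add: w_def word_tape_less)
  have "map (\<lambda>j. act (scan ts ! j, if Suc j = length (scan ts) then Stay else Left) (ts ! j)) [0..<length ts] = ts'"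
    unfolding ts'_def using scan_ts nth
    by (intro nth_equalityI) (auto simp: len simp del: upt_Suc)
  then have 1: "texec (Atom (\<lambda>rs. map (\<lambda>j. (rs ! j, if Suc j = length rs then Stay else Left)) [0..<length rs])) ts 1 ts'"
    using texec_atom[of ts "\<lambda>rs j. (rs ! j, if Suc j = length rs then Stay else Left)"] scan_ts w_less by simp
  have "map (\<lambda>j. act (if Suc j = length (scan ts') then (scan ts' ! j, Stay) else (3, Stay)) (ts' ! j)) [0..<length ts'] =
      tapes x (\<lambda>_. 0) []"
    using nregs_numeral(1) by (intro nth_equalityI)
      (auto simp: len' nth' nth_tapes reg_tape_def w_def less_Suc_eq simp del: upt_Suc nregs_numeral)
  then have 2: "texec (Atom (\<lambda>rs. map (\<lambda>j. if Suc j = length rs then (rs ! j, Stay) else (3, Stay)) [0..<length rs])) ts' 1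
      (tapes x (\<lambda>_. 0) [])"
    using texec_atom[of ts' "\<lambda>rs j. if Suc j = length rs then (rs ! j, Stay) else (3, Stay)"] w_less
    by (simp add: nth' len')
  show ?thesis
    using texec.Seq[OF 1 2] by (simp add: prepare_def ts_def eval_nat_numeral)
qed

text \<open>Bound variables start at 5 because the compiled loops expect their counters to be empty,
  whereas 0 to 4 are preloaded with the values of \<open>base_env\<close>.\<close>

theorem poly_time_loop:
  assumes "wf_prog P" "bound_vars P \<subseteq> {5..}"
  shows "poly_time (\<lambda>x. snd (apply_trace (trace x P (base_env p q r (length x))) (0, [])))"
proof -
  define c where "c = prepare ;; load_env p q r ;; compile P"
  \<comment> \<open>A loop variable stays below the value of another variable, so the sum of the
    preloaded values bounds all of them throughout the run.\<close>
  define B where "B n = 1 + n + poly p n + poly q n + poly r n" for n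
  define C where "C n = ticks P (B n)" for n
  define T where "T n = 5 + load_time p q r n + time P (B n) (C n)" for n
  obtain M where M: "wf_tm M" "num_tapes M = Suc nregs"
    and exec: "\<And>ts t ts'. texec c ts t ts' \<Longrightarrow> (step M ^^ t) (0, ts) = (1, ts')"
    using com_turing_machine[of "Suc nregs" c] by auto
  have B: "poly_bounded B"
    unfolding B_def by (intro poly_bounded_intros)
  have "poly_bounded C"
    unfolding C_def by (intro poly_bounded_ticks B)
  then have "poly_bounded T"
    unfolding T_def load_time_def
    by (intro poly_bounded_intros poly_bounded_time poly_bounded_horner_time B)
  then obtain Q :: "nat poly" where Q: "\<And>n. T n \<le> poly Q n"
    unfolding poly_bounded_def by blast
  have "\<exists>t\<le>poly Q (length x). halts_with ((step M ^^ t) (initial M x))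
      (snd (apply_trace (trace x P (base_env p q r (length x))) (0, [])))" for x
  proof -
    define n where "n = length x"
    obtain s where s: "run x (load_env p q r) (\<lambda>_. 0, []) (load_time p q r n) (s, [])"
      "env s = base_env p q r n" "\<And>j. s j \<noteq> 0 \<Longrightarrow> j \<in> var ` {..<5}"
      using run_load_env[of x p q r] by (auto simp: n_def)
    obtain c' out where out: "apply_trace (trace x P (base_env p q r n)) (0, []) = (c', out)"
      by force
    have s0: "s j = 0" if "j \<notin> var ` {..<5}" for j
      using s(3) that by blast
    have "c' \<le> s 3 + ticks P (B n) \<and> run x (compile P) (s, []) (time P (B n) (C n)) (s(3 := c'), out)"
    proof (rule run_compile)
      show "idle s"
        by (auto simp: idle_def intro!: s0)
      show "env s i \<le> B n" for i
        using fun_cong[OF s(2), of i] by (auto simp: base_env_def B_def)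
      show "s (var i) = 0 \<and> s (lim i) = 0" if "i \<in> bound_vars P" for i
        using that assms(2) by (auto intro!: s0)
      have "s 3 = 0" by (auto intro!: s0)
      then show "s 3 + ticks P (B n) \<le> C n"
        "apply_trace (trace x P (env s)) (s 3, []) = (c', out)"
        using out by (simp_all add: C_def s(2))
    qed (rule assms(1))
    then have run: "run x (load_env p q r ;; compile P) (\<lambda>_. 0, []) (Suc (load_time p q r n + time P (B n) (C n))) (s(3 := c'), out)"
      using run_seq[OF s(1)] by auto
    then obtain t where t: "t \<le> Suc (load_time p q r n + time P (B n) (C n))"
      "texec (load_env p q r ;; compile P) (tapes x (\<lambda>_. 0) []) t (tapes x (s(3 := c')) out)"
      by (auto simp: run.simps)
    have "texec c ((word_tape x, 0) # replicate nregs (word_tape [], 0)) (Suc (3 + t)) (tapes x (s(3 := c')) out)"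
      unfolding c_def by (rule texec.Seq[OF prepare t(2)])
    then have "(step M ^^ Suc (3 + t)) (initial M x) = (1, tapes x (s(3 := c')) out)"
      using exec by (simp add: initial_def M(2) del: funpow.simps)
    moreover have "halts_with (1, tapes x (s(3 := c')) out) out"
      by (simp add: halts_with_def tapes_def holds_word_def word_tape_def)
    moreover have "Suc (3 + t) \<le> poly Q n"
      using t(1) Q[of n] by (simp add: T_def)
    ultimately show ?thesis
      using out by (metis n_def snd_conv)
  qed
  then show ?thesis
    unfolding poly_time_def using M(1) by blast
qed

section \<open>Common subgraphs of labelled paths\<close>

text \<open>Vertex names come from an injection \<open>f\<close>; the index behind an edge is then
  unique by \<open>path_edge_eq\<close>, so that \<open>THE\<close> is well defined on
  edges.\<close>

definition path_graph :: "(nat \<Rightarrow> 'v) \<Rightarrow> 'l list \<Rightarrow> ('v, 'l) lgraph" where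
  "path_graph f ls = \<lparr>verts = f ` {..length ls}, edges = {{f i, f (Suc i)} | i. i < length ls},
     lab = (\<lambda>e. ls ! (THE i. e = {f i, f (Suc i)}))\<rparr>"

lemma path_edge_eq: "inj f \<Longrightarrow> {f i, f (Suc i)} = {f j, f (Suc j)} \<longleftrightarrow> i = j"
  by (auto simp: doubleton_eq_iff inj_eq)

lemma lab_path_graph: "inj f \<Longrightarrow> lab (path_graph f ls) {f i, f (Suc i)} = ls ! i"
  by (simp add: path_graph_def path_edge_eq)

lemma is_path_path_graph:
  assumes "inj f"
  shows "is_path (path_graph f ls)"
  unfolding is_path_def
proof (intro exI conjI)
  let ?vs = "map f [0..<Suc (length ls)]"
  show "?vs \<noteq> []" "distinct ?vs"
    by (auto simp: distinct_map simp del: upt_Suc intro: inj_on_subset[OF assms])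
  show "verts (path_graph f ls) = set ?vs"
    by (auto simp: path_graph_def atMost_def less_Suc_eq_le simp del: upt_Suc)
  have "?vs ! i = f i" if "i < Suc (length ls)" for i
    using that by (simp del: upt_Suc)
  then have "(e = {?vs ! i, ?vs ! Suc i} \<and> Suc i < length ?vs) = (e = {f i, f (Suc i)} \<and> i < length ls)" for e i
    by (auto simp del: upt_Suc)
  then show "edges (path_graph f ls) = {{?vs ! i, ?vs ! Suc i} | i. Suc i < length ?vs}"
    unfolding path_graph_def by simp
qed

lemma lists_graph_path_graph:
  assumes "inj f"
  shows "lists_graph (map f [0..<Suc (length ls)])
    (map (\<lambda>i. (f i, f (Suc i), ls ! i)) [0..<length ls]) (path_graph f ls)"
  unfolding lists_graph_def
proof (intro conjI)
  show "distinct (map f [0..<Suc (length ls)])"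
    by (auto simp: distinct_map simp del: upt_Suc intro: inj_on_subset[OF assms])
  show "set (map f [0..<Suc (length ls)]) = verts (path_graph f ls)"
    by (auto simp: path_graph_def atMost_def less_Suc_eq_le simp del: upt_Suc)
  show "distinct (map (\<lambda>(u, v, l). {u, v}) (map (\<lambda>i. (f i, f (Suc i), ls ! i)) [0..<length ls]))"
    by (auto simp: distinct_map inj_on_def path_edge_eq[OF assms])
  show "{{u, v} | u v l. (u, v, l) \<in> set (map (\<lambda>i. (f i, f (Suc i), ls ! i)) [0..<length ls])}
      = edges (path_graph f ls)"
  proof -
    have X: "{{u, v} | u v l. (u, v, l) \<in> X} = (\<lambda>(u, v, l). {u, v}) ` X" for X :: "('a \<times> 'a \<times> 'b) set"
      by force
    have "{{u, v} | u v l. (u, v, l) \<in> set (map (\<lambda>i. (f i, f (Suc i), ls ! i)) [0..<length ls])}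
        = (\<lambda>i. {f i, f (Suc i)}) ` {..<length ls}"
      by (simp only: X image_image set_map set_upt atLeast0LessThan split)
    also have "\<dots> = edges (path_graph f ls)"
      unfolding path_graph_def by (simp add: image_def Bex_def) metis
    finally show ?thesis .
  qed
  show "\<forall>(u, v, l)\<in>set (map (\<lambda>i. (f i, f (Suc i), ls ! i)) [0..<length ls]). lab (path_graph f ls) {u, v} = l"
    by (auto simp: lab_path_graph[OF assms])
qed

text \<open>The letters of \<open>cs\<close> sit on the edges whose index is a multiple of 4, so no
  two of them share a vertex. Three separators per letter yield groups of four edges, the unit in
  which paths are printed.\<close>

definition spread :: "'l \<Rightarrow> 'l list \<Rightarrow> 'l list" where
  "spread s cs = concat (map (\<lambda>c. [c, s, s, s]) cs)"

lemma length_spread: "length (spread s cs) = 4 * length cs"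
  by (induction cs) (auto simp: spread_def)

lemma nth_spread:
  "i < 4 * length cs \<Longrightarrow> spread s cs ! i = (if i mod 4 = 0 then cs ! (i div 4) else s)"
proof (induction cs arbitrary: i)
  case (Cons c cs)
  show ?case
  proof (cases "i < 4")
    case True
    then have "i = 0 \<or> i = 1 \<or> i = 2 \<or> i = 3" by auto
    then show ?thesis by (auto simp: spread_def)
  next
    case False
    then obtain j where j: "i = j + 4"
      using le_Suc_ex[of 4 i] by (auto simp: add.commute)
    have "spread s (c # cs) ! (j + 4) = spread s cs ! j"
      by (simp add: spread_def eval_nat_numeral)
    moreover have "(j + 4) mod 4 = j mod 4" "(j + 4) div 4 = Suc (j div 4)"
      by simp_all
    ultimately show ?thesis
      using Cons j by simp
  qed
qed simp

text \<open>Inclusion allows a selection to contain a label several times; one position per label is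
  picked only when a common subgraph is built from it.\<close>

definition selectable :: "'l list \<Rightarrow> 'l set \<Rightarrow> bool" where
  "selectable ls C \<longleftrightarrow>
     (\<exists>I\<subseteq>{..<length ls}. (\<forall>i\<in>I. Suc i \<notin> I) \<and> C \<subseteq> (!) ls ` I)"

text \<open>The label \<open>s\<close> does not occur on the first path, so every common edge is
  matched with a letter edge of the second path. Letter edges are pairwise disjoint, hence their
  preimages are not adjacent; the letters are distinct, hence \<open>length cs\<close> common edges
  exhaust them.\<close>

lemma selectable_if_MCES:
  assumes "inj f" "distinct cs" "s \<notin> set ls" "s \<notin> set cs"
    and "MCES (path_graph f ls) (path_graph f (spread s cs)) \<ge> length cs"
  shows "selectable ls (set cs)"
proof -
  let ?G = "path_graph f ls" and ?H = "path_graph f (spread s cs)"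
  have "wf_lgraph ?G"
    by (rule is_path_wf[OF is_path_path_graph[OF assms(1)]])
  from Max_in[OF common_subgraph_sizes[OF this, of ?H]] obtain S
    where cs: "common_subgraph S ?G ?H" and "MCES ?G ?H = card (edges S)"
    unfolding MCES_def by blast
  with assms(5) have S: "length cs \<le> card (edges S)" by simp
  from cs obtain T \<phi> where T: "subgraph T ?H" and \<phi>: "lgraph_iso \<phi> S T" and SG: "subgraph S ?G"
    unfolding common_subgraph_def by blast
  have iso_edge: "{\<phi> u, \<phi> v} \<in> edges T" if "{u, v} \<in> edges S" "u \<in> verts S" "v \<in> verts S" for u v
    using \<phi> that unfolding lgraph_iso_def by blast
  have iso_lab: "lab T (\<phi> ` e) = lab S e" if "e \<in> edges S" for e
    using \<phi> that unfolding lgraph_iso_def by blast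
  define I where "I = {i. i < length ls \<and> {f i, f (Suc i)} \<in> edges S}"
  have inj\<phi>: "inj_on \<phi> (verts S)"
    using \<phi> by (simp add: lgraph_iso_def bij_betw_def)
  have sub: "{f i, f (Suc i)} \<subseteq> verts S" if "i \<in> I" for i
    using that SG by (auto simp: I_def subgraph_def wf_lgraph_def)
  have image: "\<exists>k<length cs. \<phi> ` {f i, f (Suc i)} = {f (4 * k), f (Suc (4 * k))} \<and> cs ! k = ls ! i"
    if i: "i \<in> I" for i
  proof -
    let ?e = "{f i, f (Suc i)}"
    have e: "?e \<in> edges S" "i < length ls" using i by (auto simp: I_def)
    have "\<phi> ` ?e \<in> edges T"
      using iso_edge[of "f i" "f (Suc i)"] e(1) sub[OF i] by simp
    then have "\<phi> ` ?e \<in> edges ?H" and lab1: "lab T (\<phi> ` ?e) = lab ?H (\<phi> ` ?e)"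
      using T unfolding subgraph_def by blast+
    then obtain j where j: "\<phi> ` ?e = {f j, f (Suc j)}" "j < 4 * length cs"
      by (auto simp: path_graph_def length_spread)
    have "lab T (\<phi> ` ?e) = lab S ?e"
      by (rule iso_lab[OF e(1)])
    also have "\<dots> = lab ?G ?e"
      using SG e(1) unfolding subgraph_def by blast
    also have "\<dots> = ls ! i"
      by (rule lab_path_graph[OF assms(1)])
    finally have "spread s cs ! j = ls ! i"
      using lab1 lab_path_graph[OF assms(1), of "spread s cs" j] unfolding j(1) by simp
    moreover have "ls ! i \<noteq> s"
      using assms(3) e(2) nth_mem by blast
    ultimately have "j mod 4 = 0" "cs ! (j div 4) = ls ! i"
      using nth_spread[OF j(2), of s] by (auto split: if_splits)
    moreover from this have "4 * (j div 4) = j" "j div 4 < length cs"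
      using j(2) by auto
    ultimately show ?thesis
      using j(1) by metis
  qed
  have same: "i = i'" if "i \<in> I" "i' \<in> I" "\<phi> ` {f i, f (Suc i)} = \<phi> ` {f i', f (Suc i')}" for i i'
    using that(3) path_edge_eq[OF assms(1)]
    unfolding inj_on_image_eq_iff[OF inj\<phi> sub[OF that(1)] sub[OF that(2)]] by blast
  have "Suc i \<notin> I" if i: "i \<in> I" for i
  proof
    assume "Suc i \<in> I"
    obtain k where k: "\<phi> ` {f i, f (Suc i)} = {f (4 * k), f (Suc (4 * k))}"
      using image[OF i] by blast
    obtain k' where k': "\<phi> ` {f (Suc i), f (Suc (Suc i))} = {f (4 * k'), f (Suc (4 * k'))}"
      using image[OF \<open>Suc i \<in> I\<close>] by blast
    have "\<phi> (f (Suc i)) \<in> {f (4 * k), f (Suc (4 * k))} \<inter> {f (4 * k'), f (Suc (4 * k'))}"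
      unfolding k[symmetric] k'[symmetric] by blast
    then have "4 * k = 4 * k' \<or> 4 * k = Suc (4 * k') \<or> Suc (4 * k) = 4 * k'"
      by (auto simp: inj_eq[OF assms(1)])
    then have "k = k'" by presburger
    then show False
      using same[OF i \<open>Suc i \<in> I\<close>] k k' by simp
  qed
  then have nonadjacent: "\<forall>i\<in>I. Suc i \<notin> I"
    by blast
  have "inj_on ((!) ls) I"
  proof (rule inj_onI)
    fix i i'
    assume "i \<in> I" "i' \<in> I" "ls ! i = ls ! i'"
    obtain k where k: "k < length cs" "\<phi> ` {f i, f (Suc i)} = {f (4 * k), f (Suc (4 * k))}" "cs ! k = ls ! i"
      using image[OF \<open>i \<in> I\<close>] by blast
    obtain k' where k': "k' < length cs" "\<phi> ` {f i', f (Suc i')} = {f (4 * k'), f (Suc (4 * k'))}" "cs ! k' = ls ! i'"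
      using image[OF \<open>i' \<in> I\<close>] by blast
    have "k = k'"
      using k k' \<open>ls ! i = ls ! i'\<close> assms(2) by (metis nth_eq_iff_index_eq)
    then show "i = i'"
      using same[OF \<open>i \<in> I\<close> \<open>i' \<in> I\<close>] k k' by simp
  qed
  then have "card ((!) ls ` I) = card I"
    by (rule card_image)
  moreover have "edges S = (\<lambda>i. {f i, f (Suc i)}) ` I"
    using SG by (auto simp: subgraph_def I_def path_graph_def)
  moreover have "inj_on (\<lambda>i. {f i, f (Suc i)}) I"
    using path_edge_eq[OF assms(1)] by (auto simp: inj_on_def)
  ultimately have "card ((!) ls ` I) \<ge> card (set cs)"
    using S assms(2) by (simp add: card_image distinct_card)
  moreover have "(!) ls ` I \<subseteq> set cs"
  proof clarify
    fix i
    assume "i \<in> I"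
    from image[OF this] show "ls ! i \<in> set cs"
      using nth_mem by metis
  qed
  ultimately have "(!) ls ` I = set cs"
    by (intro card_seteq) auto
  moreover have "I \<subseteq> {..<length ls}"
    by (auto simp: I_def)
  ultimately show ?thesis
    unfolding selectable_def using nonadjacent by blast
qed

text \<open>The common subgraph is a matching with one edge per letter. It is defined once on
  abstract vertices \<open>(k, d)\<close> and embedded into both paths by \<open>g1\<close> and
  \<open>g2\<close>; the isomorphism is one embedding after the inverse of the other.\<close>

lemma MCES_if_selectable:
  assumes "inj f" "distinct cs" "selectable ls (set cs)"
  shows "MCES (path_graph f ls) (path_graph f (spread s cs)) \<ge> length cs"
proof -
  let ?G = "path_graph f ls" and ?H = "path_graph f (spread s cs)"
  define K where "K = length cs"
  obtain I where I: "I \<subseteq> {..<length ls}" "\<And>i. i \<in> I \<Longrightarrow> Suc i \<notin> I" "set cs \<subseteq> (!) ls ` I"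
    using assms(3) unfolding selectable_def by auto
  have "\<forall>k<K. \<exists>i\<in>I. ls ! i = cs ! k"
    using I(3) nth_mem[of _ cs] unfolding K_def by (metis image_iff subset_iff)
  then obtain h where h: "\<And>k. k < K \<Longrightarrow> h k \<in> I \<and> ls ! h k = cs ! k"
    by metis
  have h_eq: "h k = h k' \<longleftrightarrow> k = k'" if "k < K" "k' < K" for k k'
    using that h[of k] h[of k'] assms(2) by (metis K_def nth_eq_iff_index_eq)
  have h_less: "h k < length ls" if "k < K" for k
    using h[OF that] I(1) by auto
  define P where "P = {..<K} \<times> {0, 1 :: nat}"
  define g1 where "g1 = (\<lambda>(k, d). f (h k + d))"
  define g2 where "g2 = (\<lambda>(k :: nat, d :: nat). f (4 * k + d))"
  define E where "E = {{(k, 0), (k, 1 :: nat)} | k. k < K}"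
  have E_sub: "e \<subseteq> P" if "e \<in> E" for e
    using that by (auto simp: E_def P_def)
  have "finite P" by (simp add: P_def)
  \<comment> \<open>Different \<open>d\<close> and \<open>d'\<close> would give two selected
    positions that differ by one; this is where non-adjacency of the selection enters.\<close>
  have inj1: "inj_on g1 P"
  proof (rule inj_onI; clarify)
    fix k d k' d'
    assume *: "(k, d) \<in> P" "(k', d') \<in> P" "g1 (k, d) = g1 (k', d')"
    then have kd: "k < K" "k' < K" "d = 0 \<or> d = 1" "d' = 0 \<or> d' = 1" "h k + d = h k' + d'"
      by (auto simp: P_def g1_def inj_eq[OF assms(1)])
    then show "k = k' \<and> d = d'"
      using h[of k] h[of k'] I(2)[of "h k"] I(2)[of "h k'"] h_eq[of k k'] by auto
  qed
  have inj2: "inj_on g2 P"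
  proof (rule inj_onI; clarify)
    fix k d k' d'
    assume *: "(k, d) \<in> P" "(k', d') \<in> P" "g2 (k, d) = g2 (k', d')"
    then have "d = 0 \<or> d = 1" "d' = 0 \<or> d' = 1" "4 * k + d = 4 * k' + d'"
      by (auto simp: P_def g2_def inj_eq[OF assms(1)])
    then show "k = k' \<and> d = d'"
      by presburger
  qed
  define S where "S = \<lparr>verts = g1 ` P, edges = (`) g1 ` E, lab = lab ?G\<rparr>"
  define T where "T = \<lparr>verts = g2 ` P, edges = (`) g2 ` E, lab = lab ?H\<rparr>"
  define \<phi> where "\<phi> = g2 \<circ> the_inv_into P g1"
  have \<phi>: "\<phi> (g1 p) = g2 p" if "p \<in> P" for p
    using that inj1 by (simp add: \<phi>_def the_inv_into_f_f)
  have \<phi>_image: "\<phi> ` g1 ` e = g2 ` e" if "e \<subseteq> P" for e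
    using that \<phi> by (force simp: image_image)
  have card2: "card (g1 ` e) = 2" "card (g2 ` e) = 2" if "e \<in> E" for e
  proof -
    have "card e = 2" using that by (auto simp: E_def)
    then show "card (g1 ` e) = 2" "card (g2 ` e) = 2"
      using E_sub[OF that] inj1 inj2 by (metis card_image inj_on_subset)+
  qed
  have "subgraph S ?G"
    unfolding subgraph_def wf_lgraph_def
  proof (intro conjI ballI)
    show "verts S \<subseteq> verts ?G"
      using h_less less_imp_le[OF h_less] by (auto simp: S_def P_def g1_def path_graph_def Suc_le_eq)
    show "edges S \<subseteq> edges ?G"
      using h_less by (auto simp: S_def E_def g1_def path_graph_def)
  qed (use E_sub card2 \<open>finite P\<close> in \<open>auto simp: S_def\<close>)
  moreover have "subgraph T ?H"
    unfolding subgraph_def wf_lgraph_def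
  proof (intro conjI ballI)
    show "verts T \<subseteq> verts ?H"
      by (auto simp: T_def P_def g2_def path_graph_def length_spread K_def)
    show "edges T \<subseteq> edges ?H"
      by (auto simp: T_def E_def g2_def path_graph_def length_spread K_def)
  qed (use E_sub card2 \<open>finite P\<close> in \<open>auto simp: T_def\<close>)
  moreover have "lgraph_iso \<phi> S T"
    unfolding lgraph_iso_def
  proof (intro conjI ballI)
    have "bij_betw (the_inv_into P g1) (g1 ` P) P"
      using inj1 by (simp add: bij_betw_the_inv_into inj_on_imp_bij_betw)
    then show "bij_betw \<phi> (verts S) (verts T)"
      unfolding \<phi>_def S_def T_def using inj2 by (auto intro!: bij_betw_trans simp: inj_on_imp_bij_betw)
  next
    fix u v
    assume "u \<in> verts S" "v \<in> verts S"
    then obtain p q where pq: "p \<in> P" "q \<in> P" "u = g1 p" "v = g1 q"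
      by (auto simp: S_def)
    have "{u, v} \<in> edges S \<longleftrightarrow> (\<exists>e\<in>E. g1 ` {p, q} = g1 ` e)"
      by (auto simp: S_def pq)
    also have "\<dots> \<longleftrightarrow> {p, q} \<in> E"
      using inj_on_image_eq_iff[OF inj1, of "{p, q}"] pq E_sub by blast
    also have "\<dots> \<longleftrightarrow> (\<exists>e\<in>E. g2 ` {p, q} = g2 ` e)"
      using inj_on_image_eq_iff[OF inj2, of "{p, q}"] pq E_sub by blast
    also have "\<dots> \<longleftrightarrow> {\<phi> u, \<phi> v} \<in> edges T"
      by (auto simp: T_def pq \<phi>)
    finally show "{u, v} \<in> edges S \<longleftrightarrow> {\<phi> u, \<phi> v} \<in> edges T" .
  next
    fix e
    assume "e \<in> edges S"
    then obtain k where k: "k < K" "e = g1 ` {(k, 0), (k, 1)}"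
      by (auto simp: S_def E_def)
    have "{(k, 0), (k, 1)} \<subseteq> P" using k(1) by (auto simp: P_def)
    then have "\<phi> ` e = {f (4 * k), f (Suc (4 * k))}"
      unfolding k(2) by (simp only: \<phi>_image) (simp add: g2_def)
    then have "lab T (\<phi> ` e) = spread s cs ! (4 * k)"
      by (simp add: T_def lab_path_graph[OF assms(1)])
    moreover have "lab S e = ls ! h k"
      unfolding k(2) by (simp add: S_def g1_def lab_path_graph[OF assms(1)])
    ultimately show "lab T (\<phi> ` e) = lab S e"
      using k(1) h[of k] nth_spread[of "4 * k" cs s] by (simp add: K_def)
  qed
  ultimately have S: "common_subgraph S ?G ?H"
    unfolding common_subgraph_def by blast
  have "inj_on ((`) g1) E"
    by (rule inj_on_subset[OF inj_on_image_Pow[OF inj1]]) (use E_sub in auto)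
  then have "card (edges S) = card E"
    by (simp add: S_def card_image)
  also have "E = (\<lambda>k. {(k, 0), (k, 1)}) ` {..<K}"
    by (auto simp: E_def)
  also have "card \<dots> = K"
    by (subst card_image) (auto simp: inj_on_def doubleton_eq_iff)
  finally have "card (edges S) = K" .
  moreover have "card (edges S) \<le> MCES ?G ?H"
    unfolding MCES_def
    by (rule Max_ge[OF common_subgraph_sizes(1)[OF is_path_wf[OF is_path_path_graph[OF assms(1)]]]])
      (use S in blast)
  ultimately show ?thesis
    by (simp add: K_def)
qed

section \<open>Satisfiability as a selection of edges\<close>

datatype ('v, 'c) block = Free | Lit 'v bool 'c

text \<open>\<open>Sep\<close> fills the gaps of the first path and \<open>Sep'\<close> those of the
  second. Neither occurs on the other path, so separator edges are never common.\<close>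

datatype 'c label = Link nat | Clause 'c | Sep | Sep'

text \<open>Block \<open>i\<close> is a copy of its variable. Choosing \<open>Link i\<close> in it makes the copy true, choosing
  \<open>Link (Suc i)\<close> makes it false, and the label \<open>Link i\<close> as a whole stands for the implication
  from copy \<open>i - 1\<close> to copy \<open>i\<close>. A free block cuts the chain of implications.\<close>

fun block_labels :: "nat \<Rightarrow> ('v, 'c) block \<Rightarrow> 'c label list" where
  "block_labels i Free = [Link i, Sep, Link (Suc i), Sep]"
| "block_labels i (Lit v s c) =
     (if s then [Clause c, Link (Suc i), Link i, Sep] else [Clause c, Link i, Link (Suc i), Sep])"

definition blocks_labels :: "('v, 'c) block list \<Rightarrow> 'c label list" where
  "blocks_labels bs = concat (map (\<lambda>i. block_labels i (bs ! i)) [0..<length bs])"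

lemma length_block_labels [simp]: "length (block_labels i b) = 4"
  by (cases b) auto

lemma length_concat_quads: "(\<And>i. length (f i) = 4) \<Longrightarrow> length (concat (map f [0..<n])) = 4 * n"
  by (induction n) auto

lemma nth_concat_quads:
  "(\<And>i. length (f i) = 4) \<Longrightarrow> i < n \<Longrightarrow> k < 4 \<Longrightarrow> concat (map f [0..<n]) ! (4 * i + k) = f i ! k"
proof (induction n)
  case (Suc n)
  then show ?case
    by (cases "i = n") (auto simp: nth_append length_concat_quads)
qed simp

lemma length_blocks_labels: "length (blocks_labels bs) = 4 * length bs"
  unfolding blocks_labels_def by (rule length_concat_quads) simp

lemma nth_blocks_labels:
  "i < length bs \<Longrightarrow> k < 4 \<Longrightarrow> blocks_labels bs ! (4 * i + k) = block_labels i (bs ! i) ! k"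
  unfolding blocks_labels_def by (rule nth_concat_quads) simp_all

text \<open>Implications connect only copies of the same variable, and every positive copy reaches
  every negative copy of its variable along a chain that no free block cuts. The initial free block
  supplies \<open>Link 0\<close>, which has no predecessor block to fall back on.\<close>

definition chained :: "('v, 'c) block list \<Rightarrow> bool" where
  "chained bs \<longleftrightarrow> bs \<noteq> [] \<and> bs ! 0 = Free \<and>
     (\<forall>i v s c w t d. Suc i < length bs \<and> bs ! i = Lit v s c \<and> bs ! Suc i = Lit w t d \<longrightarrow> v = w) \<and>
     (\<forall>i j v c d. i < length bs \<and> j < length bs \<and> bs ! i = Lit v True c \<and> bs ! j = Lit v False d \<longrightarrow>
        i < j \<and> (\<forall>k. i < k \<and> k < j \<longrightarrow> bs ! k \<noteq> Free))"

lemma chained_0: "chained bs \<Longrightarrow> bs \<noteq> [] \<and> bs ! 0 = Free"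
  unfolding chained_def by blast

lemma chained_link: "chained bs \<Longrightarrow> Suc i < length bs \<Longrightarrow> bs ! i = Lit v s c \<Longrightarrow> bs ! Suc i = Lit w t d \<Longrightarrow> v = w"
  unfolding chained_def by blast

lemma chained_order:
  assumes "chained bs" "i < length bs" "j < length bs" "bs ! i = Lit v True c" "bs ! j = Lit v False d"
  shows "i < j" "i < k \<Longrightarrow> k < j \<Longrightarrow> bs ! k \<noteq> Free"
proof -
  have "\<forall>i j v c d. i < length bs \<and> j < length bs \<and> bs ! i = Lit v True c \<and> bs ! j = Lit v False d \<longrightarrow>
        i < j \<and> (\<forall>k. i < k \<and> k < j \<longrightarrow> bs ! k \<noteq> Free)"
    using assms(1) unfolding chained_def by (elim conjE)
  from this[THEN spec[of _ i], THEN spec[of _ j], THEN spec[of _ v], THEN spec[of _ c], THEN spec[of _ d], THEN mp]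
  have "i < j \<and> (\<forall>k. i < k \<and> k < j \<longrightarrow> bs ! k \<noteq> Free)"
    using assms(2-) by simp
  then show "i < j" "i < k \<Longrightarrow> k < j \<Longrightarrow> bs ! k \<noteq> Free"
    by blast+
qed

lemma less_4_cases: "k < 4 \<Longrightarrow> k = 0 \<or> k = 1 \<or> k = 2 \<or> k = (3 :: nat)"
  by linarith

text \<open>A variable is declared true iff the clause edge of one of its positive copies is
  selected. Such a copy is true, and truth travels along the chain to every negative copy, where it
  forces the middle edge and thereby blocks the clause edge.\<close>

lemma sat_if_selectable:
  assumes "chained bs" "selectable (blocks_labels bs) (Link ` {..<length bs} \<union> Clause ` C)"
  shows "\<exists>\<alpha>. \<forall>c\<in>C. \<exists>v. Lit v (\<alpha> v) c \<in> set bs"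
proof -
  let ?L = "blocks_labels bs"
  obtain I where I1: "I \<subseteq> {..<length ?L}" and I2: "\<forall>i\<in>I. Suc i \<notin> I"
    and I3: "Link ` {..<length bs} \<union> Clause ` C \<subseteq> (!) ?L ` I"
    using assms(2) unfolding selectable_def by blast
  have I: "Suc i \<notin> I" if "i \<in> I" for i
    using I2 that by blast
  have position: "\<exists>i<length bs. \<exists>k<4. 4 * i + k \<in> I \<and> block_labels i (bs ! i) ! k = l"
    if l: "l \<in> Link ` {..<length bs} \<union> Clause ` C" for l
  proof -
    obtain q where q: "q \<in> I" "?L ! q = l"
      using subsetD[OF I3 l] by blast
    have "q < 4 * length bs"
      using q(1) I1 by (auto simp: length_blocks_labels)
    then have "q div 4 < length bs" "q mod 4 < 4"
      by auto
    moreover from this have "block_labels (q div 4) (bs ! (q div 4)) ! (q mod 4) = l"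
      using nth_blocks_labels[of "q div 4" bs "q mod 4"] q(2) by simp
    moreover have "4 * (q div 4) + q mod 4 \<in> I"
      using q(1) by simp
    ultimately show ?thesis by blast
  qed
  \<comment> \<open>In a literal block, \<open>tr i\<close> and \<open>fa i\<close> are the
    positions of \<open>Link i\<close> and \<open>Link (Suc i)\<close>. They are the neighbours 1
    and 2 in one order or the other, so at most one of them is selected. Free blocks only get
    default values.\<close>
  define tr where "tr i = 4 * i + (case bs ! i of Lit v True c \<Rightarrow> 2 | _ \<Rightarrow> 1)" for i
  define fa where "fa i = 4 * i + (case bs ! i of Lit v True c \<Rightarrow> 1 | _ \<Rightarrow> 2)" for i
  have link: "fa i \<in> I \<or> tr (Suc i) \<in> I" if i: "Suc i < length bs" "bs ! i \<noteq> Free" "bs ! Suc i \<noteq> Free" for i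
  proof -
    obtain j k where jk: "j < length bs" "k < 4" "4 * j + k \<in> I" "block_labels j (bs ! j) ! k = Link (Suc i)"
      using position[of "Link (Suc i)"] i by auto
    obtain v s c where b: "bs ! j = Free \<or> bs ! j = Lit v s c"
      by (cases "bs ! j") auto
    have "k = 0 \<or> k = 1 \<or> k = 2 \<or> k = 3"
      by (rule less_4_cases[OF jk(2)])
    then have "j = i \<or> j = Suc i"
      using jk(4) b by (elim disjE) (auto split: if_splits)
    then show ?thesis
      using \<open>k = 0 \<or> k = 1 \<or> k = 2 \<or> k = 3\<close> jk(3,4) b i
      by (elim disjE) (auto simp: tr_def fa_def split: if_splits)
  qed
  have excl: "fa i \<notin> I" if "tr i \<in> I" for i
    using that I[of "fa i"] I[of "tr i"]
    by (auto simp: tr_def fa_def split: block.splits bool.splits)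
  have chain: "fa (i + n) \<notin> I \<and> (n > 0 \<longrightarrow> tr (i + n) \<in> I)"
    if "bs ! i = Lit v True c" "4 * i \<in> I" "i + n < length bs" "\<And>k. i \<le> k \<Longrightarrow> k \<le> i + n \<Longrightarrow> bs ! k \<noteq> Free" for i n v c
    using that(3,4)
  proof (induction n)
    case 0
    then show ?case using that(1) I[OF that(2)] by (simp add: fa_def)
  next
    case (Suc n)
    then have "tr (Suc (i + n)) \<in> I"
      using link[of "i + n"] by auto
    then show ?case using excl by auto
  qed
  define \<alpha> where "\<alpha> v \<longleftrightarrow> (\<exists>i<length bs. \<exists>c. bs ! i = Lit v True c \<and> 4 * i \<in> I)" for v
  have "\<exists>v. Lit v (\<alpha> v) c \<in> set bs" if c: "c \<in> C" for c
  proof -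
    obtain j k where jk: "j < length bs" "k < 4" "4 * j + k \<in> I" "block_labels j (bs ! j) ! k = Clause c"
      using position[of "Clause c"] c by blast
    from less_4_cases[OF jk(2)] obtain v s where b: "bs ! j = Lit v s c" and "k = 0"
      using jk(4) by (cases "bs ! j") (auto split: if_splits)
    then have j: "4 * j \<in> I" using jk(3) by simp
    have "\<alpha> v = s"
    proof (cases s)
      case True
      then show ?thesis using b j jk(1) unfolding \<alpha>_def by auto
    next
      case False
      have "\<not> \<alpha> v"
      proof
        assume "\<alpha> v"
        then obtain i d where i: "i < length bs" "bs ! i = Lit v True d" "4 * i \<in> I"
          unfolding \<alpha>_def by auto
        have "bs ! j = Lit v False c" using b False by simp
        note ij = chained_order[OF assms(1) i(1) jk(1) i(2) this]
        have "bs ! k \<noteq> Free" if "i \<le> k" "k \<le> j" for k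
          using ij(2)[of k] that i b by (cases "k = i"; cases "k = j") auto
        then have "tr j \<in> I"
          using chain[of i v d "j - i"] i ij(1) jk(1) by auto
        then show False
          using I[OF j] b False by (simp add: tr_def)
      qed
      then show ?thesis using False by simp
    qed
    then show ?thesis
      using b nth_mem[OF jk(1)] by auto
  qed
  then show ?thesis by blast
qed

text \<open>Take the middle edge where the literal is false and the outer edges elsewhere. If block
  \<open>i\<close> does not supply \<open>Link i\<close>, it is a copy of a false variable; the
  block before it is then free or another copy of that variable, and supplies the label
  instead.\<close>

lemma selectable_if_sat:
  assumes "chained bs" "\<And>c. c \<in> C \<Longrightarrow> \<exists>v. Lit v (\<alpha> v) c \<in> set bs"
  shows "selectable (blocks_labels bs) (Link ` {..<length bs} \<union> Clause ` C)"
proof -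
  let ?L = "blocks_labels bs"
  define mid where "mid i \<longleftrightarrow> (case bs ! i of Free \<Rightarrow> False | Lit v s c \<Rightarrow> \<alpha> v \<noteq> s)" for i
  define sel where "sel i k \<longleftrightarrow> (if mid i then k = 1 else k = 0 \<or> k = 2)" for i and k :: nat
  define I where "I = {4 * i + k | i k. i < length bs \<and> k < 4 \<and> sel i k}"
  have I: "4 * i + k \<in> I \<longleftrightarrow> i < length bs \<and> sel i k" if "k < 4" for i k
  proof
    assume "4 * i + k \<in> I"
    then obtain i' k' where *: "i' < length bs" "k' < 4" "sel i' k'" "4 * i + k = 4 * i' + k'"
      unfolding I_def by blast
    have "i = i' \<and> k = k'"
      using *(2,4) that by presburger
    with * show "i < length bs \<and> sel i k" by simp
  next
    assume "i < length bs \<and> sel i k"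
    with that show "4 * i + k \<in> I"
      unfolding I_def by blast
  qed
  have chosen: "l \<in> (!) ?L ` I" if "i < length bs" "k < 4" "sel i k" "block_labels i (bs ! i) ! k = l" for i k l
    using that I[of k i] nth_blocks_labels[of i bs k] by (intro image_eqI[of _ _ "4 * i + k"]) auto
  have "Suc q \<notin> I" if q: "q \<in> I" for q
  proof
    assume "Suc q \<in> I"
    obtain i k where ik: "k < 4" "sel i k" "q = 4 * i + k"
      using q unfolding I_def by blast
    then have "k < 3" by (auto simp: sel_def split: if_splits)
    then have "sel i (Suc k)"
      using I[of "Suc k" i] \<open>Suc q \<in> I\<close> ik(3) by simp
    with ik(2) show False by (auto simp: sel_def split: if_splits)
  qed
  moreover have "I \<subseteq> {..<length ?L}"
    by (auto simp: I_def length_blocks_labels)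
  moreover have "Link i \<in> (!) ?L ` I" if i: "i < length bs" for i
  proof (cases "\<exists>k<4. sel i k \<and> block_labels i (bs ! i) ! k = Link i")
    case True
    then show ?thesis using chosen i by blast
  next
    case False
    have not_sel: "\<not> (sel i k \<and> block_labels i (bs ! i) ! k = Link i)" if "k < 4" for k
      using False that by blast
    obtain v s c where b: "bs ! i = Lit v s c" and v: "\<not> \<alpha> v"
    proof (cases "bs ! i")
      case Free
      then show ?thesis using not_sel[of 0] by (simp add: sel_def mid_def)
    next
      case (Lit v s c)
      then show ?thesis
        using not_sel[of 1] not_sel[of 2] that by (cases s; cases "\<alpha> v") (auto simp: sel_def mid_def)
    qed
    have "i \<noteq> 0"
    proof
      assume "i = 0"
      then show False using b chained_0[OF assms(1)] by simp
    qed
    then obtain j where j: "i = Suc j" by (cases i) auto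
    have "\<exists>k<4. sel j k \<and> block_labels j (bs ! j) ! k = Link i"
    proof (cases "bs ! j")
      case Free
      then show ?thesis using j by (intro exI[of _ 2]) (auto simp: sel_def mid_def)
    next
      case (Lit w t d)
      then have "w = v"
        using chained_link[OF assms(1), of j w t d v s c] b i j by simp
      with Lit v j show ?thesis
        by (intro exI[of _ "if t then 1 else 2"]) (auto simp: sel_def mid_def)
    qed
    then show ?thesis
      using chosen[of j] i j by auto
  qed
  moreover have "Clause c \<in> (!) ?L ` I" if c: "c \<in> C" for c
  proof -
    obtain v where "Lit v (\<alpha> v) c \<in> set bs"
      using assms(2)[OF c] by blast
    then obtain i where i: "i < length bs" "bs ! i = Lit v (\<alpha> v) c"
      unfolding in_set_conv_nth by blast
    then have "sel i 0" "block_labels i (bs ! i) ! 0 = Clause c"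
      by (simp_all add: sel_def mid_def)
    from chosen[OF i(1) _ this] show ?thesis by simp
  qed
  ultimately have "I \<subseteq> {..<length ?L} \<and> (\<forall>i\<in>I. Suc i \<notin> I) \<and> Link ` {..<length bs} \<union> Clause ` C \<subseteq> (!) ?L ` I"
    by blast
  then show ?thesis
    unfolding selectable_def by blast
qed

text \<open>Positive before negative is the order that \<open>chained\<close> demands, and the
  closing free block cuts the chain before the next variable.\<close>

definition var_blocks :: "'v \<Rightarrow> 'c list \<Rightarrow> 'c list \<Rightarrow> ('v, 'c) block list" where
  "var_blocks v ps ns = map (Lit v True) ps @ map (Lit v False) ns @ [Free]"

lemma chained_append:
  assumes "chained bs" "last bs = Free" "\<And>s c. Lit v s c \<notin> set bs"
  shows "chained (bs @ var_blocks v ps ns)"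
proof -
  define w where "w = var_blocks v ps ns"
  define m where "m = length bs"
  have m: "m > 0" using chained_0[OF assms(1)] by (simp add: m_def)
  have w_var: "u = v" if "k < length w" "w ! k = Lit u s c" for k u s c
    using nth_mem[OF that(1)] unfolding that(2) by (auto simp: w_def var_blocks_def)
  have w_pos: "k < length ps" if "k < length w" "w ! k = Lit u True c" for k u c
    using that by (auto simp: w_def var_blocks_def nth_append split: if_splits)
  have w_neg: "length ps \<le> k" "k < length ps + length ns" if "k < length w" "w ! k = Lit u False c" for k u c
    using that by (auto simp: w_def var_blocks_def nth_append nth_Cons' split: if_splits)
  have w_lit: "w ! k \<noteq> Free" if "k < length ps + length ns" for k
    using that by (auto simp: w_def var_blocks_def nth_append)
  note old = chained_link[OF assms(1), folded m_def] chained_order[OF assms(1), folded m_def]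
  have nth: "(bs @ w) ! i = (if i < m then bs ! i else w ! (i - m))" for i
    by (simp add: nth_append m_def)
  have last: "bs ! i = Free" if "Suc i = m" for i
  proof -
    have i: "i = length bs - 1" using that by (simp add: m_def)
    show ?thesis
      unfolding i using assms(2) m by (simp add: last_conv_nth m_def)
  qed
  have not_v: "bs ! i \<noteq> Lit v s c" if "i < m" for i s c
  proof
    assume "bs ! i = Lit v s c"
    then have "Lit v s c \<in> set bs"
      using nth_mem[of i bs] that by (simp add: m_def)
    with assms(3) show False by blast
  qed
  have "u = u'" if "Suc i < length (bs @ w)" "(bs @ w) ! i = Lit u s c" "(bs @ w) ! Suc i = Lit u' t d" for i u s c u' t d
  proof -
    consider "Suc i < m" | "Suc i = m" | "m \<le> i" by linarith
    then show ?thesis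
    proof cases
      case 1
      then show ?thesis using that old(1)[of i u s c u' t d] by (auto simp: nth)
    next
      case 2
      then show ?thesis using that last by (auto simp: nth)
    next
      case 3
      then show ?thesis
        using that w_var[of "i - m" u s c] w_var[of "Suc i - m" u' t d] by (auto simp: nth m_def)
    qed
  qed
  then have A: "\<forall>i v s c u t d. Suc i < length (bs @ w) \<and> (bs @ w) ! i = Lit v s c \<and>
      (bs @ w) ! Suc i = Lit u t d \<longrightarrow> v = u"
    by blast
  have "i < j \<and> (\<forall>k. i < k \<and> k < j \<longrightarrow> (bs @ w) ! k \<noteq> Free)"
    if ij: "i < length (bs @ w)" "j < length (bs @ w)" "(bs @ w) ! i = Lit u True c" "(bs @ w) ! j = Lit u False d" for i j u c d
  proof (cases "i < m \<or> j < m")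
    case True
    \<comment> \<open>Both copies lie on the same side of the seam, because the literals of the new
      blocks all belong to \<open>v\<close> and none of the old ones does.\<close>
    then have "i < m \<and> j < m"
      using ij not_v w_var[of "i - m" u True c] w_var[of "j - m" u False d]
      by (auto simp: nth m_def split: if_splits)
    then show ?thesis
      using ij old(2,3)[of i j u c d] by (auto simp: nth)
  next
    case False
    then have "i - m < length ps" "length ps \<le> j - m" "j - m < length ps + length ns"
      using ij w_pos[of "i - m" u c] w_neg[of "j - m" u d] by (auto simp: nth m_def)
    then show ?thesis
      using False w_lit by (auto simp: nth)
  qed
  then have B: "\<forall>i j v c d. i < length (bs @ w) \<and> j < length (bs @ w) \<and> (bs @ w) ! i = Lit v True c \<and>
      (bs @ w) ! j = Lit v False d \<longrightarrow> i < j \<and> (\<forall>k. i < k \<and> k < j \<longrightarrow> (bs @ w) ! k \<noteq> Free)"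
    by blast
  show ?thesis
    unfolding chained_def w_def[symmetric]
  proof (intro conjI)
    show "bs @ w \<noteq> []" "(bs @ w) ! 0 = Free"
      using chained_0[OF assms(1)] m by (simp_all add: nth)
  qed (rule A B)+
qed

definition formula_blocks :: "'v list \<Rightarrow> ('v \<Rightarrow> 'c list) \<Rightarrow> ('v \<Rightarrow> 'c list) \<Rightarrow> ('v, 'c) block list" where
  "formula_blocks vs ps ns = Free # concat (map (\<lambda>v. var_blocks v (ps v) (ns v)) vs)"

lemma Lit_in_formula_blocks:
  "Lit v s c \<in> set (formula_blocks vs ps ns) \<longleftrightarrow> v \<in> set vs \<and> c \<in> set (if s then ps v else ns v)"
  by (auto simp: formula_blocks_def var_blocks_def)

lemma chained_formula_blocks: "distinct vs \<Longrightarrow> chained (formula_blocks vs ps ns)"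
proof (induction vs rule: rev_induct)
  case Nil
  then show ?case by (auto simp: formula_blocks_def chained_def)
next
  case (snoc v vs)
  have "last (formula_blocks vs ps ns) = Free"
    by (cases vs rule: rev_cases) (simp_all add: formula_blocks_def var_blocks_def)
  moreover have "Lit v s c \<notin> set (formula_blocks vs ps ns)" for s c
    using snoc.prems by (simp add: Lit_in_formula_blocks)
  ultimately have "chained (formula_blocks vs ps ns @ var_blocks v (ps v) (ns v))"
    using snoc by (intro chained_append) auto
  then show ?case
    by (simp add: formula_blocks_def)
qed

text \<open>The right-hand side is satisfiability of a formula in conjunctive normal form that is
  stored by variables: \<open>ps v\<close> and \<open>ns v\<close> list the clauses in which
  \<open>v\<close> occurs positively and negatively.\<close>

lemma selectable_iff_sat:
  assumes "distinct vs"
  shows "selectable (blocks_labels (formula_blocks vs ps ns))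
      (Link ` {..<length (formula_blocks vs ps ns)} \<union> Clause ` C) \<longleftrightarrow>
    (\<exists>\<alpha>. \<forall>c\<in>C. \<exists>v\<in>set vs. c \<in> set (if \<alpha> v then ps v else ns v))"
proof
  assume "selectable (blocks_labels (formula_blocks vs ps ns))
      (Link ` {..<length (formula_blocks vs ps ns)} \<union> Clause ` C)"
  from sat_if_selectable[OF chained_formula_blocks[OF assms] this]
  show "\<exists>\<alpha>. \<forall>c\<in>C. \<exists>v\<in>set vs. c \<in> set (if \<alpha> v then ps v else ns v)"
    unfolding Lit_in_formula_blocks by blast
next
  assume "\<exists>\<alpha>. \<forall>c\<in>C. \<exists>v\<in>set vs. c \<in> set (if \<alpha> v then ps v else ns v)"
  then obtain \<alpha> where "\<And>c. c \<in> C \<Longrightarrow> \<exists>v. Lit v (\<alpha> v) c \<in> set (formula_blocks vs ps ns)"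
    unfolding Lit_in_formula_blocks by blast
  from selectable_if_sat[OF chained_formula_blocks[OF assms] this]
  show "selectable (blocks_labels (formula_blocks vs ps ns))
      (Link ` {..<length (formula_blocks vs ps ns)} \<union> Clause ` C)" .
qed

section \<open>Printing paths\<close>

datatype item = Word "bool list" | Unary nat | Count

fun item_word :: "(nat \<Rightarrow> nat) \<Rightarrow> nat \<Rightarrow> item \<Rightarrow> bool list" where
  "item_word e c (Word w) = w"
| "item_word e c (Unary i) = replicate (e i) True"
| "item_word e c Count = replicate c True"

definition items_word :: "(nat \<Rightarrow> nat) \<Rightarrow> nat \<Rightarrow> item list \<Rightarrow> bool list" where
  "items_word e c its = concat (map (item_word e c) its)"

fun item_vars :: "item \<Rightarrow> nat set" where
  "item_vars (Unary i) = {i}"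
| "item_vars _ = {}"

fun print_item :: "item \<Rightarrow> atom" where
  "print_item (Word w) = Put (concat (map (\<lambda>b. [True, b]) w))"
| "print_item (Unary i) = PutVar i"
| "print_item Count = PutCount"

definition print_items :: "item list \<Rightarrow> atom list" where
  "print_items its = map print_item its @ [Put [False]]"

lemma concat_replicate_True: "concat (replicate n [True, True]) = replicate (2 * n) True"
  by (induction n) auto

lemma print_items: "fold (apply_atom e) (print_items its) (c, out) = (c, out @ enc_word (items_word e c its))"
proof -
  have "fold (apply_atom e) (map print_item its) (c, out) =
      (c, out @ concat (map (\<lambda>b. [True, b]) (items_word e c its)))"
  proof (induction its arbitrary: out)
    case (Cons it its)
    then show ?case
      by (cases it) (simp_all add: items_word_def concat_replicate_True)
  qed (simp add: items_word_def)
  then show ?thesis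
    by (simp add: print_items_def enc_word_def enc_list_def)
qed

lemma atom_vars_print_items: "\<Union> (atom_vars ` set (print_items its)) = \<Union> (item_vars ` set its)"
proof -
  have "atom_vars (print_item it) = item_vars it" for it
    by (cases it) auto
  then show ?thesis
    by (auto simp: print_items_def)
qed

text \<open>The index is split into group and offset: while printing, the group is the tick counter
  and the offset is a constant of the program.\<close>

definition vertex :: "nat \<Rightarrow> bool list" where
  "vertex i = replicate (i div 4) True @ False # replicate (i mod 4) True"

lemma replicate_True_eq_iff:
  "replicate a True @ False # u = replicate b True @ False # v \<longleftrightarrow> a = b \<and> u = v"
proof (induction a arbitrary: b)
  case 0
  then show ?case by (cases b) auto
next
  case (Suc a)
  then show ?case by (cases b) auto
qed

lemma inj_vertex: "inj vertex"
proof (rule injI)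
  fix i j
  assume "vertex i = vertex j"
  then have "i div 4 = j div 4" "i mod 4 = j mod 4"
    by (auto simp: vertex_def replicate_True_eq_iff)
  then show "i = j" by (metis div_mult_mod_eq)
qed

text \<open>Offset 4 denotes the first vertex of the next group, printed from the current counter
  value with one additional \<open>True\<close>.\<close>

definition vertex_items :: "nat \<Rightarrow> item list" where
  "vertex_items k = [Count, Word (if k < 4 then False # replicate k True else [True, False])]"

lemma items_word_vertex: "k \<le> 4 \<Longrightarrow> items_word e c (vertex_items k) = vertex (4 * c + k)"
proof (cases "k = 4")
  case True
  have "vertex (4 * c + 4) = replicate (Suc c) True @ [False]"
    by (simp add: vertex_def)
  then show ?thesis
    unfolding True by (simp add: items_word_def vertex_items_def replicate_append_same flip: replicate_Suc)
qed (simp add: items_word_def vertex_items_def vertex_def)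

definition vertex_atoms :: "atom list" where
  "vertex_atoms = concat (map (\<lambda>k. Put [True] # print_items (vertex_items k)) [0..<4]) @ [Tick]"

definition edge_atoms :: "item list list \<Rightarrow> atom list" where
  "edge_atoms ls = concat (map (\<lambda>k. Put [True] # print_items (vertex_items k) @
     print_items (vertex_items (Suc k)) @ print_items (ls ! k)) [0..<4]) @ [Tick]"

text \<open>The encoding lists all vertices before the edges, so the same loop is run twice with a
  reset in between. A path has one vertex more than edges; it is printed between the passes, from
  the final counter value.\<close>

definition print_graph :: "item list list loop \<Rightarrow> atom list loop" where
  "print_graph P = Then (map_loop (\<lambda>_. vertex_atoms) P)
     (Then (Do (Put [True] # print_items (vertex_items 0) @ [Put [False], Reset]))
     (Then (map_loop edge_atoms P) (Do [Put [False]])))"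

definition trace_labels :: "(item list list \<times> (nat \<Rightarrow> nat)) list \<Rightarrow> bool list list" where
  "trace_labels tr = concat (map (\<lambda>i. map (items_word (snd (tr ! i)) i) (fst (tr ! i))) [0..<length tr])"

lemma upt_4: "[0..<4] = [0, 1, 2, 3 :: nat]"
  by (simp add: upt_rec)

lemma vertex_atoms: "fold (apply_atom e) vertex_atoms (c, out) =
    (Suc c, out @ concat (map (\<lambda>k. True # enc_word (vertex (4 * c + k))) [0..<4]))"
  unfolding vertex_atoms_def upt_4
  by (simp add: print_items items_word_vertex[of 0, simplified] items_word_vertex del: Suc_eq_plus1)

lemma edge_atoms: "fold (apply_atom e) (edge_atoms ls) (c, out) =
    (Suc c, out @ concat (map (\<lambda>k. True # enc_word (vertex (4 * c + k)) @
      enc_word (vertex (Suc (4 * c + k))) @ enc_word (items_word e c (ls ! k))) [0..<4]))"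
proof -
  have "items_word e c (vertex_items (Suc k)) = vertex (Suc (4 * c + k))" if "k < 4" for k
    using items_word_vertex[of "Suc k"] that by simp
  from this[of 0] this[of 1] this[of 2] this[of 3] show ?thesis
    unfolding edge_atoms_def upt_4
    by (simp add: print_items items_word_vertex[of 0, simplified] items_word_vertex eval_nat_numeral)
qed

text \<open>Since every instruction ticks exactly once, the counter that an instruction sees is its
  index in the trace.\<close>

lemma apply_trace_map:
  assumes "\<And>a e c out. (a, e) \<in> set tr \<Longrightarrow> fold (apply_atom e) (f a) (c, out) = (Suc c, out @ g a e c)"
  shows "apply_trace (map (apfst f) tr) (0, out) =
    (length tr, out @ concat (map (\<lambda>i. g (fst (tr ! i)) (snd (tr ! i)) i) [0..<length tr]))"
  using assms
proof (induction tr rule: rev_induct)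
  case Nil
  then show ?case by (simp add: apply_trace_def)
next
  case (snoc y tr)
  obtain a e where y: "y = (a, e)" by force
  have A: "map (\<lambda>i. g (fst ((tr @ [y]) ! i)) (snd ((tr @ [y]) ! i)) i) [0..<length (tr @ [y])] =
      map (\<lambda>i. g (fst (tr ! i)) (snd (tr ! i)) i) [0..<length tr] @ [g a e (length tr)]"
    by (simp add: nth_append y)
  have B: "apply_trace (map (apfst f) (tr @ [y])) \<sigma> =
      fold (apply_atom e) (f a) (apply_trace (map (apfst f) tr) \<sigma>)" for \<sigma>
    by (simp add: apply_trace_def y)
  have C: "apply_trace (map (apfst f) tr) (0, out) =
      (length tr, out @ concat (map (\<lambda>i. g (fst (tr ! i)) (snd (tr ! i)) i) [0..<length tr]))"
    using snoc.prems by (intro snoc.IH) auto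
  have D: "fold (apply_atom e) (f a) (c, out) = (Suc c, out @ g a e c)" for c out
    using snoc.prems by (auto simp: y)
  show ?case
    unfolding A B C D by simp
qed

lemma apply_trace_single: "apply_trace [(as, e)] \<sigma> = fold (apply_atom e) as \<sigma>"
  by (simp add: apply_trace_def)

lemma concat_map_quads:
  "concat (map h [0..<4 * m]) = concat (map (\<lambda>i. concat (map (\<lambda>k. h (4 * i + k)) [0..<4])) [0..<m])"
proof (induction m)
  case (Suc m)
  have "[0..<4 * Suc m] = [0..<4 * m] @ map (\<lambda>k. 4 * m + k) [0..<4]"
    using upt_add_eq_append[of 0 "4 * m" 4] map_add_upt[of "4 * m" 4] by (simp add: add.commute)
  then show ?case
    using Suc by (simp add: o_def)
qed simp

lemma apply_print_graph:
  assumes "\<And>a e'. (a, e') \<in> set (trace x P e) \<Longrightarrow> length a = 4"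
  defines "ls \<equiv> trace_labels (trace x P e)"
  shows "apply_trace (trace x (print_graph P) e) (0, out) = (length (trace x P e),
    out @ enc_graph (map vertex [0..<Suc (length ls)])
      (map (\<lambda>i. (vertex i, vertex (Suc i), ls ! i)) [0..<length ls]))"
proof -
  define tr where "tr = trace x P e"
  define m where "m = length tr"
  have len: "length (fst (tr ! i)) = 4" if "i < m" for i
    using assms(1)[of "fst (tr ! i)" "snd (tr ! i)"] nth_mem[of i tr] that by (simp add: tr_def m_def)
  define q where "q i = (if i < m then map (items_word (snd (tr ! i)) i) (fst (tr ! i)) else replicate 4 [])" for i
  have ls: "ls = concat (map q [0..<m])"
    unfolding ls_def trace_labels_def tr_def[symmetric] m_def[symmetric]
    by (intro arg_cong[of _ _ concat] map_cong) (simp_all add: q_def)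
  have q: "length (q i) = 4" for i
    using len by (simp add: q_def)
  have len_ls: "length ls = 4 * m"
    unfolding ls by (rule length_concat_quads[OF q])
  have nth_ls: "ls ! (4 * i + k) = items_word (snd (tr ! i)) i (fst (tr ! i) ! k)" if "i < m" "k < 4" for i k
    unfolding ls using nth_concat_quads[of q i m k, OF q that] that len by (simp add: q_def)
  have vs: "apply_trace (trace x (map_loop (\<lambda>_. vertex_atoms) P) e) (0, out) =
      (m, out @ concat (map (\<lambda>v. True # enc_word v) (map vertex [0..<4 * m])))" for out
  proof -
    have "apply_trace (map (apfst (\<lambda>_. vertex_atoms)) tr) (0, out) = (m, out @
        concat (map (\<lambda>i. concat (map (\<lambda>k. True # enc_word (vertex (4 * i + k))) [0..<4])) [0..<m]))"
      unfolding m_def by (rule apply_trace_map) (rule vertex_atoms)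
    then show ?thesis
      using concat_map_quads[of "\<lambda>i. True # enc_word (vertex i)" m] by (simp add: trace_map tr_def o_def)
  qed
  have es: "apply_trace (trace x (map_loop edge_atoms P) e) (0, out) =
      (m, out @ concat (map (\<lambda>(u, v, l). True # enc_word u @ enc_word v @ enc_word l)
        (map (\<lambda>i. (vertex i, vertex (Suc i), ls ! i)) [0..<4 * m])))" for out
  proof -
    have "apply_trace (map (apfst edge_atoms) tr) (0, out) = (m, out @
        concat (map (\<lambda>i. concat (map (\<lambda>k. True # enc_word (vertex (4 * i + k)) @
          enc_word (vertex (Suc (4 * i + k))) @ enc_word (items_word (snd (tr ! i)) i (fst (tr ! i) ! k))) [0..<4])) [0..<m]))"
      unfolding m_def by (rule apply_trace_map) (rule edge_atoms)
    also have "concat (map (\<lambda>i. concat (map (\<lambda>k. True # enc_word (vertex (4 * i + k)) @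
          enc_word (vertex (Suc (4 * i + k))) @ enc_word (items_word (snd (tr ! i)) i (fst (tr ! i) ! k))) [0..<4])) [0..<m]) =
        concat (map (\<lambda>i. concat (map (\<lambda>k. True # enc_word (vertex (4 * i + k)) @
          enc_word (vertex (Suc (4 * i + k))) @ enc_word (ls ! (4 * i + k))) [0..<4])) [0..<m])"
      by (intro arg_cong[of _ _ concat] map_cong refl) (simp add: nth_ls)
    finally show ?thesis
      using concat_map_quads[of "\<lambda>i. True # enc_word (vertex i) @ enc_word (vertex (Suc i)) @ enc_word (ls ! i)" m]
      by (simp add: trace_map tr_def o_def)
  qed
  have "apply_trace (trace x (print_graph P) e) (0, out) = apply_trace [([Put [False]], e)]
      (apply_trace (trace x (map_loop edge_atoms P) e)
      (apply_trace [(Put [True] # print_items (vertex_items 0) @ [Put [False], Reset], e)]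
      (apply_trace (trace x (map_loop (\<lambda>_. vertex_atoms) P) e) (0, out))))"
    by (simp only: print_graph_def trace.simps apply_trace_append)
  also have "\<dots> = (m, out @ enc_graph (map vertex [0..<Suc (4 * m)])
      (map (\<lambda>i. (vertex i, vertex (Suc i), ls ! i)) [0..<4 * m]))"
    unfolding vs using items_word_vertex[of 0 e m]
    by (simp add: apply_trace_single print_items es enc_graph_def enc_list_def case_prod_unfold)
  finally show ?thesis
    unfolding len_ls m_def tr_def .
qed

lemma lessThan_4: "{..<4} = {0, 1, 2, 3 :: nat}"
  by auto

lemma print_items_vars:
  "\<Union> (atom_vars ` set (edge_atoms ls)) \<subseteq> (\<Union>k\<in>{..<4}. \<Union> (item_vars ` set (ls ! k)))"
proof -
  have "\<Union> (item_vars ` set (vertex_items k)) = {}" for k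
    by (simp add: vertex_items_def)
  then show ?thesis
    by (simp add: edge_atoms_def upt_4 lessThan_4 atom_vars_print_items UN_Un)
qed

lemma wf_print_graph:
  assumes "wf_loop (\<lambda>ls. \<Union>k\<in>{..<4}. \<Union> (item_vars ` set (ls ! k))) P"
  shows "wf_prog (print_graph P)" "bound_vars (print_graph P) = bound_vars P"
proof -
  have mono: "wf_loop V P \<Longrightarrow> (\<And>a. W a \<subseteq> V a) \<Longrightarrow> wf_loop W P" for V W and P :: "'a loop"
    by (induction P) (auto intro: subset_trans)
  have no_vars: "\<Union> (item_vars ` set (vertex_items k)) = {}" for k
    by (simp add: vertex_items_def)
  have "\<Union> (atom_vars ` set vertex_atoms) = {}"
    using atom_vars_print_items no_vars by (fastforce simp: vertex_atoms_def)
  then have "wf_loop (\<lambda>_. \<Union> (atom_vars ` set vertex_atoms)) P"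
    by (intro mono[OF assms]) simp
  moreover have "wf_loop (\<lambda>ls. \<Union> (atom_vars ` set (edge_atoms ls))) P"
    by (intro mono[OF assms] print_items_vars)
  ultimately show "wf_prog (print_graph P)"
    using atom_vars_print_items[of "vertex_items 0"] no_vars[of 0]
    by (simp add: print_graph_def o_def)
  show "bound_vars (print_graph P) = bound_vars P"
    by (simp add: print_graph_def)
qed

section \<open>Clause schemes\<close>

text \<open>In loop programs, variable 4 holds the common bound of all loops, variables 5 to 7 index the
  instances of a clause scheme and variables 8 and 9 index the propositional variables of one kind.
  A literal consists of a kind and two sums of loop variables.\<close>

type_synonym 'k literal = "'k \<times> nat list \<times> nat list"
type_synonym 'k scheme = "cond \<times> 'k literal list \<times> 'k literal list"
type_synonym clause_id = "nat \<times> nat \<times> nat \<times> nat"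

definition val :: "(nat \<Rightarrow> nat) \<Rightarrow> nat list \<Rightarrow> nat" where
  "val e ts = sum_list (map e ts)"

text \<open>A literal outside the ranges counts as false in either polarity. This mirrors the
  printed path: the loops reach no variable for it, so it contributes no block.\<close>

definition sat_schemes :: "bool list \<Rightarrow> (nat \<Rightarrow> nat) \<Rightarrow> 'k list \<Rightarrow> 'k scheme list \<Rightarrow> bool" where
  "sat_schemes x e0 ks Ss \<longleftrightarrow> (\<exists>\<alpha>. \<forall>(g, ps, ns)\<in>set Ss. \<forall>a<e0 4. \<forall>b<e0 4. \<forall>c<e0 4.
     let e = e0(5 := a, 6 := b, 7 := c) in holds x e g \<longrightarrow>
       (\<exists>(k, us, vs)\<in>set ps. k \<in> set ks \<and> val e us < e0 4 \<and> val e vs < e0 4 \<and> \<alpha> (k, val e us, val e vs)) \<or>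
       (\<exists>(k, us, vs)\<in>set ns. k \<in> set ks \<and> val e us < e0 4 \<and> val e vs < e0 4 \<and> \<not> \<alpha> (k, val e us, val e vs)))"

definition wf_scheme :: "'k scheme \<Rightarrow> bool" where
  "wf_scheme = (\<lambda>(g, ps, ns). cond_vars g \<subseteq> {..<8} \<and>
     (\<forall>(k, us, vs)\<in>set ps \<union> set ns. set us \<subseteq> {..<8} \<and> set vs \<subseteq> {..<8}))"

definition seqs :: "'a loop list \<Rightarrow> 'a loop" where
  "seqs Ps = foldr Then Ps Skip"

lemma trace_seqs: "trace x (seqs Ps) e = concat (map (\<lambda>P. trace x P e) Ps)"
  by (induction Ps) (auto simp: seqs_def)

lemma wf_loop_seqs: "wf_loop V (seqs Ps) \<longleftrightarrow> (\<forall>P\<in>set Ps. wf_loop V P)"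
  by (induction Ps) (auto simp: seqs_def)

lemma bound_vars_seqs: "bound_vars (seqs Ps) = \<Union> (bound_vars ` set Ps)"
  by (induction Ps) (auto simp: seqs_def)

definition clause_loops :: "'a loop \<Rightarrow> 'a loop" where
  "clause_loops P = For 5 4 (For 6 4 (For 7 4 P))"

lemma trace_clause_loops: "trace x (clause_loops P) e =
    concat (map (\<lambda>a. concat (map (\<lambda>b. concat (map (\<lambda>c. trace x P (e(5 := a, 6 := b, 7 := c)))
      [0..<e 4])) [0..<e 4])) [0..<e 4])"
  by (simp add: clause_loops_def)

definition matches :: "nat list \<Rightarrow> nat list \<Rightarrow> cond" where
  "matches us vs = CAnd (CAnd (Le us [8]) (Le [8] us)) (CAnd (Le vs [9]) (Le [9] vs))"

lemma holds_matches: "holds x e (matches us vs) \<longleftrightarrow> val e us = e 8 \<and> val e vs = e 9"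
  by (auto simp: matches_def val_def)

text \<open>Blocks are grouped by variable, but clauses are generated from loop indices. Running
  through all clauses and testing each literal against variables 8 and 9 avoids having to solve a
  literal for its indices.\<close>

definition occ_body :: "cond \<Rightarrow> 'k literal list \<Rightarrow> 'k \<Rightarrow> nat \<Rightarrow> nat loop" where
  "occ_body g ls k i = When g
     (seqs (map (\<lambda>(k', us, vs). if k' = k then When (matches us vs) (Do i) Skip else Skip) ls)) Skip"

definition occ_loop :: "('k scheme \<Rightarrow> 'k literal list) \<Rightarrow> 'k scheme list \<Rightarrow> 'k \<Rightarrow> nat loop" where
  "occ_loop lits Ss k =
     seqs (map (\<lambda>i. clause_loops (occ_body (fst (Ss ! i)) (lits (Ss ! i)) k i)) [0..<length Ss])"

definition clause_loop :: "'k scheme list \<Rightarrow> nat loop" where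
  "clause_loop Ss = seqs (map (\<lambda>i. clause_loops (When (fst (Ss ! i)) (Do i) Skip)) [0..<length Ss])"

definition block_loop :: "'k list \<Rightarrow> 'k scheme list \<Rightarrow> ('k, nat) block loop" where
  "block_loop ks Ss = Then (Do Free) (seqs (map (\<lambda>k. For 8 4 (For 9 4
     (Then (map_loop (Lit k True) (occ_loop (fst \<circ> snd) Ss k))
     (Then (map_loop (Lit k False) (occ_loop (snd \<circ> snd) Ss k)) (Do Free))))) ks))"

definition clause_id :: "nat \<times> (nat \<Rightarrow> nat) \<Rightarrow> clause_id" where
  "clause_id = (\<lambda>(i, e). (i, e 5, e 6, e 7))"

definition eval_block :: "('k, nat) block \<times> (nat \<Rightarrow> nat) \<Rightarrow> ('k \<times> nat \<times> nat, clause_id) block" where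
  "eval_block = (\<lambda>(b, e). map_block (\<lambda>k. (k, e 8, e 9)) (\<lambda>i. clause_id (i, e)) b)"

lemma trace_env: "(a, e') \<in> set (trace x P e) \<Longrightarrow> i \<notin> bound_vars P \<Longrightarrow> e' i = e i"
proof (induction P arbitrary: e)
  case (For j b P)
  then obtain n where "(a, e') \<in> set (trace x P (e(j := n)))" by auto
  then show ?case using For.IH For.prems by fastforce
qed (auto split: if_splits)

lemma bound_vars_occ_loop: "bound_vars (occ_loop lits Ss k) \<subseteq> {5, 6, 7}"
  by (auto simp: occ_loop_def occ_body_def bound_vars_seqs clause_loops_def split: prod.splits if_splits)

section \<open>The formula that is listed by the block and clause loops\<close>

definition all_vars :: "nat \<Rightarrow> 'k list \<Rightarrow> ('k \<times> nat \<times> nat) list" where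
  "all_vars N ks = concat (map (\<lambda>k. concat (map (\<lambda>t. map (\<lambda>p. (k, t, p)) [0..<N]) [0..<N])) ks)"

lemma set_all_vars: "(k, t, p) \<in> set (all_vars N ks) \<longleftrightarrow> k \<in> set ks \<and> t < N \<and> p < N"
  by (auto simp: all_vars_def image_iff)

text \<open>A key that recovers the outer element from an inner one makes the concatenated pieces
  disjoint.\<close>

lemma distinct_concat_key:
  assumes "distinct xs" "\<And>z. z \<in> set xs \<Longrightarrow> distinct (f z)" "\<And>z y. z \<in> set xs \<Longrightarrow> y \<in> set (f z) \<Longrightarrow> key y = z"
  shows "distinct (concat (map f xs))"
  using assms
proof (induction xs)
  case (Cons z zs)
  have "set (f z) \<inter> set (concat (map f zs)) = {}"
  proof (rule ccontr)
    assume "set (f z) \<inter> set (concat (map f zs)) \<noteq> {}"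
    then obtain y z' where "y \<in> set (f z)" "z' \<in> set zs" "y \<in> set (f z')" by auto
    then have "z = z'" using Cons.prems(3)[of z y] Cons.prems(3)[of z' y] by simp
    then show False using Cons.prems(1) \<open>z' \<in> set zs\<close> by simp
  qed
  then show ?case using Cons by simp
qed simp

lemma distinct_all_vars: "distinct ks \<Longrightarrow> distinct (all_vars N ks)"
  unfolding all_vars_def
  by (intro distinct_concat_key[where key = fst] distinct_concat_key[where key = "fst \<circ> snd"])
    (auto simp: distinct_map inj_on_def)

definition occ_ids :: "bool list \<Rightarrow> (nat \<Rightarrow> nat) \<Rightarrow> ('k scheme \<Rightarrow> 'k literal list) \<Rightarrow> 'k scheme list \<Rightarrow>
    'k \<times> nat \<times> nat \<Rightarrow> clause_id list" where
  "occ_ids x e lits Ss = (\<lambda>(k, t, p). map clause_id (trace x (occ_loop lits Ss k) (e(8 := t, 9 := p))))"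

text \<open>The loop nest is laid out in the order of \<open>formula_blocks\<close>, so the printed
  blocks and the abstract formula agree as lists, without any rearrangement.\<close>

lemma eval_block_trace:
  "map eval_block (trace x (block_loop ks Ss) e) =
    formula_blocks (all_vars (e 4) ks) (occ_ids x e (fst \<circ> snd) Ss) (occ_ids x e (snd \<circ> snd) Ss)"
proof -
  have lits: "map eval_block (trace x (map_loop (Lit k s) (occ_loop lits Ss k)) (e(8 := t, 9 := p))) =
      map (Lit (k, t, p) s) (occ_ids x e lits Ss (k, t, p))" for k s lits t p
  proof -
    have "e' 8 = t \<and> e' 9 = p" if "(i, e') \<in> set (trace x (occ_loop lits Ss k) (e(8 := t, 9 := p)))" for i e'
    proof -
      have "8 \<notin> bound_vars (occ_loop lits Ss k)" "9 \<notin> bound_vars (occ_loop lits Ss k)"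
        using bound_vars_occ_loop[of lits Ss k] by fastforce+
      then show ?thesis
        using trace_env[OF that, of 8] trace_env[OF that, of 9] by simp
    qed
    then show ?thesis
      by (auto simp: trace_map occ_ids_def eval_block_def)
  qed
  define body where "body k = Then (map_loop (Lit k True) (occ_loop (fst \<circ> snd) Ss k))
    (Then (map_loop (Lit k False) (occ_loop (snd \<circ> snd) Ss k)) (Do Free))" for k
  have body: "map eval_block (trace x (body k) (e(8 := t, 9 := p))) =
    var_blocks (k, t, p) (occ_ids x e (fst \<circ> snd) Ss (k, t, p)) (occ_ids x e (snd \<circ> snd) Ss (k, t, p))" for k t p
    unfolding body_def trace.simps map_append lits var_blocks_def by (simp add: eval_block_def)
  have concat2: "concat (concat xss) = concat (map concat xss)" for xss :: "'b list list list"
    by (induction xss) auto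
  have "map eval_block (trace x (block_loop ks Ss) e) =
      Free # concat (map (\<lambda>k. concat (map (\<lambda>t. concat (map (\<lambda>p.
        map eval_block (trace x (body k) (e(8 := t, 9 := p)))) [0..<e 4])) [0..<e 4])) ks)"
    unfolding block_loop_def body_def[symmetric]
    by (simp add: trace_seqs map_concat o_def) (simp add: eval_block_def)
  then show ?thesis
    unfolding body formula_blocks_def all_vars_def by (simp add: map_concat o_def concat2)
qed

text \<open>The body must leave the environment alone; then the environment recorded with an
  instruction still shows the three indices of its clause.\<close>

lemma in_clause_loops:
  assumes "\<And>e j e'. (j, e') \<in> set (trace x P e) \<Longrightarrow> e' = e"
  shows "(i, a, b, c) \<in> clause_id ` set (trace x (clause_loops P) e) \<longleftrightarrow>
    a < e 4 \<and> b < e 4 \<and> c < e 4 \<and>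
    (i, e(5 := a, 6 := b, 7 := c)) \<in> set (trace x P (e(5 := a, 6 := b, 7 := c)))"
proof
  assume "(i, a, b, c) \<in> clause_id ` set (trace x (clause_loops P) e)"
  then obtain e' where e': "(i, e') \<in> set (trace x (clause_loops P) e)" "a = e' 5" "b = e' 6" "c = e' 7"
    by (auto simp: clause_id_def)
  then obtain a' b' c' where *: "a' < e 4" "b' < e 4" "c' < e 4" "(i, e') \<in> set (trace x P (e(5 := a', 6 := b', 7 := c')))"
    by (auto simp: trace_clause_loops)
  have "e' = e(5 := a', 6 := b', 7 := c')"
    by (rule assms[OF *(4)])
  with * e' show "a < e 4 \<and> b < e 4 \<and> c < e 4 \<and>
      (i, e(5 := a, 6 := b, 7 := c)) \<in> set (trace x P (e(5 := a, 6 := b, 7 := c)))"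
    by simp
next
  assume *: "a < e 4 \<and> b < e 4 \<and> c < e 4 \<and>
    (i, e(5 := a, 6 := b, 7 := c)) \<in> set (trace x P (e(5 := a, 6 := b, 7 := c)))"
  then have "(i, e(5 := a, 6 := b, 7 := c)) \<in> set (trace x (clause_loops P) e)"
    unfolding trace_clause_loops set_concat set_map set_upt by fastforce
  from imageI[OF this, of clause_id] show "(i, a, b, c) \<in> clause_id ` set (trace x (clause_loops P) e)"
    by (simp add: clause_id_def)
qed

lemma in_occ_body: "(j, e') \<in> set (trace x (occ_body g ls k i) e) \<longleftrightarrow> e' = e \<and> j = i \<and> holds x e g \<and>
    (\<exists>(k', us, vs)\<in>set ls. k' = k \<and> val e us = e 8 \<and> val e vs = e 9)"
proof -
  have "(j, e') \<in> set (trace x (case l of (k', us, vs) \<Rightarrow> if k' = k then When (matches us vs) (Do i) Skip else Skip) e) \<longleftrightarrow>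
      e' = e \<and> j = i \<and> (case l of (k', us, vs) \<Rightarrow> k' = k \<and> val e us = e 8 \<and> val e vs = e 9)" for l :: "'a literal"
    by (cases l) (auto simp: holds_matches)
  then show ?thesis
    by (auto simp: occ_body_def trace_seqs)
qed

lemma holds_cong: "(\<And>j. j \<in> cond_vars g \<Longrightarrow> e j = e' j) \<Longrightarrow> holds x e g = holds x e' g"
proof (induction g)
  case (Le us vs)
  then have "map e us = map e' us" "map e vs = map e' vs" by simp_all
  then show ?case by (simp only: holds.simps)
next
  case (CAnd g h)
  have "holds x e g = holds x e' g" "holds x e h = holds x e' h"
    by (rule CAnd.IH, rule CAnd.prems, simp)+
  then show ?case by simp
qed simp_all

lemma val_cong: "(\<And>j. j \<in> set us \<Longrightarrow> e j = e' j) \<Longrightarrow> val e us = val e' us"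
  unfolding val_def by (auto cong: map_cong)

lemma in_occ_ids:
  assumes "\<And>S. S \<in> set Ss \<Longrightarrow> wf_scheme S" "lits = fst \<circ> snd \<or> lits = snd \<circ> snd"
  shows "(i, a, b, c) \<in> set (occ_ids x e lits Ss (k, t, p)) \<longleftrightarrow>
    i < length Ss \<and> a < e 4 \<and> b < e 4 \<and> c < e 4 \<and> holds x (e(5 := a, 6 := b, 7 := c)) (fst (Ss ! i)) \<and>
    (\<exists>(k', us, vs)\<in>set (lits (Ss ! i)). k' = k \<and>
      val (e(5 := a, 6 := b, 7 := c)) us = t \<and> val (e(5 := a, 6 := b, 7 := c)) vs = p)"
proof -
  define e' where "e' = e(8 := t, 9 := p, 5 := a, 6 := b, 7 := c)"
  have "(i, a, b, c) \<in> set (occ_ids x e lits Ss (k, t, p)) \<longleftrightarrow>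
      (\<exists>j<length Ss. (i, a, b, c) \<in> clause_id ` set (trace x (clause_loops (occ_body (fst (Ss ! j)) (lits (Ss ! j)) k j)) (e(8 := t, 9 := p))))"
    by (simp add: occ_ids_def occ_loop_def trace_seqs image_UN Bex_def)
  also have "\<dots> \<longleftrightarrow> (\<exists>j<length Ss. a < e 4 \<and> b < e 4 \<and> c < e 4 \<and>
      (i, e') \<in> set (trace x (occ_body (fst (Ss ! j)) (lits (Ss ! j)) k j) e'))"
  proof -
    have "(i, a, b, c) \<in> clause_id ` set (trace x (clause_loops (occ_body g ls k j)) (e(8 := t, 9 := p))) \<longleftrightarrow>
        a < (e(8 := t, 9 := p)) 4 \<and> b < (e(8 := t, 9 := p)) 4 \<and> c < (e(8 := t, 9 := p)) 4 \<and>
        (i, e') \<in> set (trace x (occ_body g ls k j) e')" for g ls j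
      unfolding e'_def by (rule in_clause_loops) (simp add: in_occ_body)
    then show ?thesis by simp
  qed
  also have "\<dots> \<longleftrightarrow> i < length Ss \<and> a < e 4 \<and> b < e 4 \<and> c < e 4 \<and> holds x e' (fst (Ss ! i)) \<and>
      (\<exists>(k', us, vs)\<in>set (lits (Ss ! i)). k' = k \<and> val e' us = e' 8 \<and> val e' vs = e' 9)"
    by (auto simp only: in_occ_body)
  also have "\<dots> \<longleftrightarrow> i < length Ss \<and> a < e 4 \<and> b < e 4 \<and> c < e 4 \<and> holds x (e(5 := a, 6 := b, 7 := c)) (fst (Ss ! i)) \<and>
    (\<exists>(k', us, vs)\<in>set (lits (Ss ! i)). k' = k \<and>
      val (e(5 := a, 6 := b, 7 := c)) us = t \<and> val (e(5 := a, 6 := b, 7 := c)) vs = p)"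
  proof (intro conj_cong refl)
    assume i: "i < length Ss"
    have wf: "wf_scheme (Ss ! i)" by (rule assms(1)[OF nth_mem[OF i]])
    \<comment> \<open>Guards and literals mention only variables below 8, so setting variables 8 and
      9 to the sought variable does not change them.\<close>
    have same: "e' j = (e(5 := a, 6 := b, 7 := c)) j" if "j \<in> {..<8}" for j
      using that by (simp add: e'_def)
    show "holds x e' (fst (Ss ! i)) = holds x (e(5 := a, 6 := b, 7 := c)) (fst (Ss ! i))"
      by (rule holds_cong, rule same) (use wf in \<open>auto simp: wf_scheme_def\<close>)
    have "val e' us = val (e(5 := a, 6 := b, 7 := c)) us \<and> val e' vs = val (e(5 := a, 6 := b, 7 := c)) vs"
      if "(k', us, vs) \<in> set (lits (Ss ! i))" for k' us vs
    proof -
      have "set us \<subseteq> {..<8} \<and> set vs \<subseteq> {..<8}"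
      proof -
        have "(k', us, vs) \<in> set (fst (snd (Ss ! i))) \<union> set (snd (snd (Ss ! i)))"
          using that assms(2) by auto
        moreover have "\<forall>(k, us, vs)\<in>set (fst (snd (Ss ! i))) \<union> set (snd (snd (Ss ! i))). set us \<subseteq> {..<8} \<and> set vs \<subseteq> {..<8}"
          using wf unfolding wf_scheme_def case_prod_unfold by blast
        ultimately show ?thesis by fast
      qed
      then show ?thesis
        by (intro conjI val_cong same) auto
    qed
    moreover have "e' 8 = t" "e' 9 = p"
      by (simp_all add: e'_def)
    ultimately show "(\<exists>(k', us, vs)\<in>set (lits (Ss ! i)). k' = k \<and> val e' us = e' 8 \<and> val e' vs = e' 9) \<longleftrightarrow>
      (\<exists>(k', us, vs)\<in>set (lits (Ss ! i)). k' = k \<and>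
        val (e(5 := a, 6 := b, 7 := c)) us = t \<and> val (e(5 := a, 6 := b, 7 := c)) vs = p)"
      by (intro bex_cong refl) (simp only: split_paired_all split)
  qed
  finally show ?thesis .
qed

definition clause_ids :: "bool list \<Rightarrow> (nat \<Rightarrow> nat) \<Rightarrow> 'k scheme list \<Rightarrow> clause_id list" where
  "clause_ids x e Ss = map clause_id (trace x (clause_loop Ss) e)"

lemma clause_ids_eq: "clause_ids x e Ss = concat (map (\<lambda>i. concat (map (\<lambda>a. concat (map (\<lambda>b. concat (map (\<lambda>c.
    if holds x (e(5 := a, 6 := b, 7 := c)) (fst (Ss ! i)) then [(i, a, b, c)] else [])
      [0..<e 4])) [0..<e 4])) [0..<e 4])) [0..<length Ss])"
  by (auto simp: clause_ids_def clause_loop_def trace_seqs trace_clause_loops map_concat o_def clause_id_def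
      intro!: arg_cong[of _ _ concat])

lemma in_clause_ids: "(i, a, b, c) \<in> set (clause_ids x e Ss) \<longleftrightarrow>
    i < length Ss \<and> a < e 4 \<and> b < e 4 \<and> c < e 4 \<and> holds x (e(5 := a, 6 := b, 7 := c)) (fst (Ss ! i))"
  by (auto simp: clause_ids_eq split: if_splits)

lemma distinct_clause_ids: "distinct (clause_ids x e Ss)"
proof -
  have 1: "distinct (concat (map (\<lambda>c. if h c then [(i, a, b, c)] else []) [0..<n]))" for h i a b n
    by (rule distinct_concat_key[where key = "snd \<circ> snd \<circ> snd"]) (auto split: if_splits)
  have 2: "distinct (concat (map (\<lambda>b. concat (map (\<lambda>c. if h b c then [(i, a, b, c)] else []) [0..<n])) [0..<n]))" for h i a n
    by (rule distinct_concat_key[where key = "fst \<circ> snd \<circ> snd"]) (auto simp only: 1 distinct_upt, auto split: if_splits)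
  have 3: "distinct (concat (map (\<lambda>a. concat (map (\<lambda>b. concat (map (\<lambda>c. if h a b c then [(i, a, b, c)] else [])
      [0..<n])) [0..<n])) [0..<n]))" for h i n
    by (rule distinct_concat_key[where key = "fst \<circ> snd"]) (auto simp only: 2 distinct_upt, auto split: if_splits)
  show ?thesis
    unfolding clause_ids_eq
    by (rule distinct_concat_key[where key = fst]) (auto simp only: 3 distinct_upt, auto split: if_splits)
qed

lemma selectable_iff_sat_schemes:
  fixes x e
  assumes "\<And>S. S \<in> set Ss \<Longrightarrow> wf_scheme S" "distinct ks"
  defines "bs \<equiv> map eval_block (trace x (block_loop ks Ss) e)"
  shows "selectable (blocks_labels bs) (Link ` {..<length bs} \<union> Clause ` set (clause_ids x e Ss)) \<longleftrightarrow>
    sat_schemes x e ks Ss"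
proof -
  let ?pos = "occ_ids x e (fst \<circ> snd) Ss" and ?neg = "occ_ids x e (snd \<circ> snd) Ss"
  let ?e = "\<lambda>a b c. e(5 := a, 6 := b, 7 := c)"
  define true where "true \<alpha> f ls \<longleftrightarrow> (\<exists>(k, us, vs)\<in>set ls. k \<in> set ks \<and> val f us < e 4 \<and> val f vs < e 4 \<and>
    \<alpha> (k, val f us, val f vs))" for \<alpha> :: "'a \<times> nat \<times> nat \<Rightarrow> bool" and f and ls :: "'a literal list"
  \<comment> \<open>Occurrences are stored per variable while satisfaction is stated per clause;
    this equivalence passes from one view to the other.\<close>
  have occ: "(\<exists>v\<in>set (all_vars (e 4) ks). (i, a, b, c) \<in> set (if \<alpha> v then ?pos v else ?neg v)) \<longleftrightarrow>
      true \<alpha> (?e a b c) (fst (snd (Ss ! i))) \<or> true (\<lambda>v. \<not> \<alpha> v) (?e a b c) (snd (snd (Ss ! i)))"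
    if *: "(i, a, b, c) \<in> set (clause_ids x e Ss)" for i a b c \<alpha>
  proof -
    define f where "f = ?e a b c"
    have lits: "(i, a, b, c) \<in> set (occ_ids x e lits Ss (k, t, p)) \<longleftrightarrow>
        (\<exists>(k', us, vs)\<in>set (lits (Ss ! i)). k' = k \<and> val f us = t \<and> val f vs = p)"
      if "lits = fst \<circ> snd \<or> lits = snd \<circ> snd" for lits k t p
      using in_occ_ids[of Ss lits i a b c x e k t p, OF assms(1) that] * unfolding in_clause_ids f_def by simp
    have "(\<exists>v\<in>set (all_vars (e 4) ks). (i, a, b, c) \<in> set (if \<alpha> v then ?pos v else ?neg v)) \<longleftrightarrow>
        (\<exists>k t p. k \<in> set ks \<and> t < e 4 \<and> p < e 4 \<and> (i, a, b, c) \<in> set (if \<alpha> (k, t, p) then ?pos (k, t, p) else ?neg (k, t, p)))"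
      unfolding Bex_def split_paired_Ex set_all_vars by (simp only: conj_assoc)
    also have "\<dots> \<longleftrightarrow> (\<exists>k t p. k \<in> set ks \<and> t < e 4 \<and> p < e 4 \<and> \<alpha> (k, t, p) \<and>
          (\<exists>(k', us, vs)\<in>set (fst (snd (Ss ! i))). k' = k \<and> val f us = t \<and> val f vs = p)) \<or>
        (\<exists>k t p. k \<in> set ks \<and> t < e 4 \<and> p < e 4 \<and> \<not> \<alpha> (k, t, p) \<and>
          (\<exists>(k', us, vs)\<in>set (snd (snd (Ss ! i))). k' = k \<and> val f us = t \<and> val f vs = p))"
    proof -
      have mem_if: "z \<in> set (if P then A else B) \<longleftrightarrow> P \<and> z \<in> set A \<or> \<not> P \<and> z \<in> set B" for z :: clause_id and P A B
        by simp
      show ?thesis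
        using lits[of "fst \<circ> snd"] lits[of "snd \<circ> snd"]
        by (simp only: mem_if o_apply conj_disj_distribL ex_disj_distrib simp_thms)
    qed
    also have "\<dots> \<longleftrightarrow> true \<alpha> f (fst (snd (Ss ! i))) \<or> true (\<lambda>v. \<not> \<alpha> v) f (snd (snd (Ss ! i)))"
      unfolding true_def by (intro arg_cong2[of _ _ _ _ "(\<or>)"]; force)
    finally show ?thesis by (simp only: f_def)
  qed
  have "selectable (blocks_labels bs) (Link ` {..<length bs} \<union> Clause ` set (clause_ids x e Ss)) \<longleftrightarrow>
      (\<exists>\<alpha>. \<forall>c\<in>set (clause_ids x e Ss). \<exists>v\<in>set (all_vars (e 4) ks). c \<in> set (if \<alpha> v then ?pos v else ?neg v))"
    unfolding bs_def eval_block_trace by (rule selectable_iff_sat[OF distinct_all_vars[OF assms(2)]])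
  also have "\<dots> \<longleftrightarrow> (\<exists>\<alpha>. \<forall>(i, a, b, c)\<in>set (clause_ids x e Ss).
      true \<alpha> (?e a b c) (fst (snd (Ss ! i))) \<or> true (\<lambda>v. \<not> \<alpha> v) (?e a b c) (snd (snd (Ss ! i))))"
    by (intro arg_cong[of _ _ Ex] ext ball_cong refl) (simp only: occ split_paired_all split)
  also have "\<dots> \<longleftrightarrow> (\<exists>\<alpha>. \<forall>i<length Ss. \<forall>a<e 4. \<forall>b<e 4. \<forall>c<e 4. holds x (?e a b c) (fst (Ss ! i)) \<longrightarrow>
      true \<alpha> (?e a b c) (fst (snd (Ss ! i))) \<or> true (\<lambda>v. \<not> \<alpha> v) (?e a b c) (snd (snd (Ss ! i))))"
    unfolding Ball_def split_paired_All split in_clause_ids by (intro arg_cong[of _ _ Ex] ext) blast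
  also have "\<dots> \<longleftrightarrow> (\<exists>\<alpha>. \<forall>S\<in>set Ss. \<forall>a<e 4. \<forall>b<e 4. \<forall>c<e 4. holds x (?e a b c) (fst S) \<longrightarrow>
      true \<alpha> (?e a b c) (fst (snd S)) \<or> true (\<lambda>v. \<not> \<alpha> v) (?e a b c) (snd (snd S)))"
    by (simp only: all_set_conv_all_nth)
  also have "\<dots> \<longleftrightarrow> sat_schemes x e ks Ss"
    unfolding sat_schemes_def true_def Let_def case_prod_unfold ..
  finally show ?thesis .
qed

section \<open>The reduction\<close>

text \<open>Two leading bits distinguish the four kinds of labels. All numbers are unary, so a label
  can be printed directly from loop variables and the tick counter.\<close>

fun label_word :: "clause_id label \<Rightarrow> bool list" where
  "label_word (Link i) = [False, False] @ replicate i True"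
| "label_word (Clause (i, a, b, c)) = [False, True] @ replicate i True @ [False] @ replicate a True @
     [False] @ replicate b True @ [False] @ replicate c True"
| "label_word Sep = [True, False]"
| "label_word Sep' = [True, True]"

lemma inj_label_word: "inj label_word"
proof (rule injI)
  fix l m
  assume eq: "label_word l = label_word m"
  have "replicate i True = replicate j True \<longleftrightarrow> i = j" for i j
    by (metis length_replicate)
  with eq show "l = m"
    by (cases l rule: label_word.cases; cases m rule: label_word.cases) (simp_all add: replicate_True_eq_iff)
qed

definition link_items :: "nat \<Rightarrow> item list" where
  "link_items d = [Word ([False, False] @ replicate d True), Count]"

definition clause_items :: "nat \<Rightarrow> item list" where
  "clause_items i = [Word ([False, True] @ replicate i True @ [False]), Unary 5, Word [False], Unary 6, Word [False], Unary 7]"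

abbreviation sep_items :: "item list" where "sep_items \<equiv> [Word [True, False]]"
abbreviation sep'_items :: "item list" where "sep'_items \<equiv> [Word [True, True]]"

fun block_items :: "('k, nat) block \<Rightarrow> item list list" where
  "block_items Free = [link_items 0, sep_items, link_items (Suc 0), sep_items]"
| "block_items (Lit k s i) = (if s then [clause_items i, link_items (Suc 0), link_items 0, sep_items]
     else [clause_items i, link_items 0, link_items (Suc 0), sep_items])"

lemma items_word_label:
  "items_word e c (link_items 0) = label_word (Link c)"
  "items_word e c (link_items (Suc 0)) = label_word (Link (Suc c))"
  "items_word e c (clause_items i) = label_word (Clause (clause_id (i, e)))"
  "items_word e c sep_items = label_word Sep"
  "items_word e c sep'_items = label_word Sep'"
  by (simp_all add: items_word_def link_items_def clause_items_def clause_id_def)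

lemma block_items: "map (items_word e c) (block_items b) = map label_word (block_labels c (eval_block (b, e)))"
  by (cases b) (auto simp: items_word_label eval_block_def simp del: label_word.simps)

definition block_graph_loop :: "'k list \<Rightarrow> 'k scheme list \<Rightarrow> item list list loop" where
  "block_graph_loop ks Ss = map_loop block_items (block_loop ks Ss)"

text \<open>The block loop is repeated only to tick once per block: its counter numbers the links
  that have to be selected, from \<open>Link 0\<close> to one below the number of blocks. The link
  leaving the last block is not among them.\<close>

definition colour_graph_loop :: "'k list \<Rightarrow> 'k scheme list \<Rightarrow> item list list loop" where
  "colour_graph_loop ks Ss =
     Then (map_loop (\<lambda>_. [link_items 0, sep'_items, sep'_items, sep'_items]) (block_loop ks Ss))
       (map_loop (\<lambda>i. [clause_items i, sep'_items, sep'_items, sep'_items]) (clause_loop Ss))"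

lemma trace_labels_block_graph:
  "trace_labels (trace x (block_graph_loop ks Ss) e) =
    map label_word (blocks_labels (map eval_block (trace x (block_loop ks Ss) e)))"
proof -
  define tr where "tr = trace x (block_loop ks Ss) e"
  have "map (items_word (snd ((map (apfst block_items) tr) ! i)) i) (fst ((map (apfst block_items) tr) ! i)) =
      map label_word (block_labels i (map eval_block tr ! i))" if "i < length tr" for i
    using that block_items[of "snd (tr ! i)" i "fst (tr ! i)"] by simp
  then show ?thesis
    unfolding trace_labels_def blocks_labels_def block_graph_loop_def trace_map tr_def[symmetric] map_concat map_map o_def
    by (intro arg_cong[of _ _ concat]) simp
qed

lemma trace_labels_spread:
  assumes "length cs = length tr"
    and "\<And>i. i < length tr \<Longrightarrow> map (items_word (snd (tr ! i)) i) (fst (tr ! i)) = [cs ! i, s, s, s]"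
  shows "trace_labels tr = spread s cs"
proof -
  have "trace_labels tr = concat (map (\<lambda>i. [cs ! i, s, s, s]) [0..<length cs])"
    unfolding trace_labels_def assms(1) using assms(2) by (intro arg_cong[of _ _ concat] map_cong) auto
  also have "map (\<lambda>i. [cs ! i, s, s, s]) [0..<length cs] = map (\<lambda>c. [c, s, s, s]) (map ((!) cs) [0..<length cs])"
    by simp
  finally show ?thesis
    by (simp only: map_nth spread_def)
qed

lemma trace_labels_colour_graph:
  "trace_labels (trace x (colour_graph_loop ks Ss) e) = spread (label_word Sep')
    (map label_word (map Link [0..<length (trace x (block_loop ks Ss) e)] @ map Clause (clause_ids x e Ss)))"
proof (rule trace_labels_spread)
  define tb where "tb = trace x (block_loop ks Ss) e"
  define tc where "tc = trace x (clause_loop Ss) e"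
  define tr where "tr = trace x (colour_graph_loop ks Ss) e"
  have tr: "tr = map (apfst (\<lambda>_. [link_items 0, sep'_items, sep'_items, sep'_items])) tb @
      map (apfst (\<lambda>i. [clause_items i, sep'_items, sep'_items, sep'_items])) tc"
    by (simp add: tr_def tb_def tc_def colour_graph_loop_def trace_map)
  show "length (map label_word (map Link [0..<length (trace x (block_loop ks Ss) e)] @ map Clause (clause_ids x e Ss))) =
      length (trace x (colour_graph_loop ks Ss) e)"
    by (simp add: colour_graph_loop_def trace_map clause_ids_def)
  fix i
  assume "i < length (trace x (colour_graph_loop ks Ss) e)"
  then have i: "i < length tb + length tc"
    by (simp add: tr flip: tr_def)
  show "map (items_word (snd (trace x (colour_graph_loop ks Ss) e ! i)) i) (fst (trace x (colour_graph_loop ks Ss) e ! i)) =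
      [map label_word (map Link [0..<length (trace x (block_loop ks Ss) e)] @ map Clause (clause_ids x e Ss)) ! i,
        label_word Sep', label_word Sep', label_word Sep']"
    unfolding tr_def[symmetric] clause_ids_def tb_def[symmetric] tc_def[symmetric]
    using i by (cases "i < length tb") (simp_all add: tr nth_append items_word_label del: label_word.simps)
qed

text \<open>After the second graph the tick counter holds its number of groups, hence of letters.
  This is the threshold, so it can be printed at once.\<close>

definition reduction_loop :: "'k list \<Rightarrow> 'k scheme list \<Rightarrow> atom list loop" where
  "reduction_loop ks Ss = Then (print_graph (block_graph_loop ks Ss)) (Then (Do [Reset])
     (Then (print_graph (colour_graph_loop ks Ss)) (Do [PutBinary])))"

definition block_graph :: "bool list \<Rightarrow> (nat \<Rightarrow> nat) \<Rightarrow> 'k list \<Rightarrow> 'k scheme list \<Rightarrow> (bool list, bool list) lgraph" where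
  "block_graph x e ks Ss = path_graph vertex (trace_labels (trace x (block_graph_loop ks Ss) e))"

definition colour_graph :: "bool list \<Rightarrow> (nat \<Rightarrow> nat) \<Rightarrow> 'k list \<Rightarrow> 'k scheme list \<Rightarrow> (bool list, bool list) lgraph" where
  "colour_graph x e ks Ss = path_graph vertex (trace_labels (trace x (colour_graph_loop ks Ss) e))"

lemma encodes_reduction:
  "encodes_input (snd (apply_trace (trace x (reduction_loop ks Ss) e) (0, [])))
    (block_graph x e ks Ss) (colour_graph x e ks Ss) (length (trace x (colour_graph_loop ks Ss) e))"
proof -
  have 1: "length a = 4" if "(a, e') \<in> set (trace x (block_graph_loop ks Ss) e)" for a e'
  proof -
    have "length (block_items b) = 4" for b :: "('a, nat) block"
      by (cases b) auto
    then show ?thesis using that by (auto simp: block_graph_loop_def trace_map)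
  qed
  have 2: "length a = 4" if "(a, e') \<in> set (trace x (colour_graph_loop ks Ss) e)" for a e'
    using that by (auto simp: colour_graph_loop_def trace_map)
  have wf: "wf_lgraph (path_graph vertex ls)" for ls :: "bool list list"
    by (rule is_path_wf[OF is_path_path_graph[OF inj_vertex]])
  define enc where "enc ls = enc_graph (map vertex [0..<Suc (length ls)])
      (map (\<lambda>i. (vertex i, vertex (Suc i), ls ! i)) [0..<length ls])" for ls
  have eq: "snd (apply_trace (trace x (reduction_loop ks Ss) e) (0, [])) =
      enc (trace_labels (trace x (block_graph_loop ks Ss) e)) @
      enc (trace_labels (trace x (colour_graph_loop ks Ss) e)) @
      enc_word (bits (length (trace x (colour_graph_loop ks Ss) e)))"
    unfolding reduction_loop_def trace.simps apply_trace_append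
    by (simp add: apply_print_graph[OF 1] apply_print_graph[OF 2] apply_trace_single enc_def)
  show ?thesis
    unfolding encodes_input_def block_graph_def colour_graph_def
  proof (intro conjI wf)
    show "\<exists>vs es vs' es' ks'. lists_graph vs es (path_graph vertex (trace_labels (trace x (block_graph_loop ks Ss) e))) \<and>
        lists_graph vs' es' (path_graph vertex (trace_labels (trace x (colour_graph_loop ks Ss) e))) \<and>
        length (trace x (colour_graph_loop ks Ss) e) = horner_sum of_bool 2 ks' \<and>
        snd (apply_trace (trace x (reduction_loop ks Ss) e) (0, [])) = enc_graph vs es @ enc_graph vs' es' @ enc_word ks'"
      by (intro exI conjI, rule lists_graph_path_graph[OF inj_vertex], rule lists_graph_path_graph[OF inj_vertex],
          rule horner_sum_bits[symmetric], rule eq[unfolded enc_def])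
  qed
qed

text \<open>A word determines labels on edges only. Membership in \<open>MCES_yes\<close> speaks of
  any graphs encoded by the word, and this lemma transfers their value to the graphs constructed
  here.\<close>

lemma MCES_cong:
  assumes "verts G = verts G'" "edges G = edges G'" "\<And>e. e \<in> edges G \<Longrightarrow> lab G e = lab G' e"
    and "verts H = verts H'" "edges H = edges H'" "\<And>e. e \<in> edges H \<Longrightarrow> lab H e = lab H' e"
  shows "MCES G H = MCES G' H'"
proof -
  have "subgraph S G = subgraph S G'" for S
    using assms(1-3) by (auto simp: subgraph_def)
  moreover have "subgraph S H = subgraph S H'" for S
    using assms(4-6) by (auto simp: subgraph_def)
  ultimately show ?thesis
    by (simp add: MCES_def common_subgraph_def)
qed

section \<open>Well-formedness of the reduction loops and correctness of the reduction\<close>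

lemma wf_occ_loop:
  assumes "\<And>S. S \<in> set Ss \<Longrightarrow> wf_scheme S" "lits = fst \<circ> snd \<or> lits = snd \<circ> snd" "\<And>i. V i \<subseteq> {..<16}"
  shows "wf_loop V (occ_loop lits Ss k)"
proof -
  have "wf_loop V (occ_body g ls k i) \<and> bound_vars (occ_body g ls k i) = {}"
    if "cond_vars g \<subseteq> {..<8}" "\<forall>(k, us, vs)\<in>set ls. set us \<subseteq> {..<8} \<and> set vs \<subseteq> {..<8}" for g ls i
  proof -
    have "cond_vars g \<subseteq> {..<16}"
      using that(1) by auto
    moreover have "cond_vars (matches us vs) \<subseteq> {..<16}" if "set us \<subseteq> {..<8}" "set vs \<subseteq> {..<8}" for us vs
      using that by (auto simp: matches_def)
    ultimately show ?thesis
      using that(2) assms(3) by (auto simp: occ_body_def wf_loop_seqs bound_vars_seqs split: prod.splits)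
  qed
  moreover have "cond_vars (fst S) \<subseteq> {..<8}" "\<forall>(k, us, vs)\<in>set (lits S). set us \<subseteq> {..<8} \<and> set vs \<subseteq> {..<8}"
    if "S \<in> set Ss" for S
    using assms(1)[OF that] assms(2) by (auto simp: wf_scheme_def case_prod_unfold)
  ultimately have "wf_loop V (occ_body (fst S) (lits S) k i)" "bound_vars (occ_body (fst S) (lits S) k i) = {}"
    if "S \<in> set Ss" for S i
    using that by blast+
  then show ?thesis
    by (simp add: occ_loop_def wf_loop_seqs clause_loops_def)
qed

lemma wf_block_loop:
  assumes "\<And>S. S \<in> set Ss \<Longrightarrow> wf_scheme S" "\<And>b. V b \<subseteq> {..<16}"
  shows "wf_loop V (block_loop ks Ss)"
proof -
  have "wf_loop (V \<circ> Lit k s) (occ_loop lits Ss k)" "8 \<notin> bound_vars (occ_loop lits Ss k)" "9 \<notin> bound_vars (occ_loop lits Ss k)"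
    if "lits = fst \<circ> snd \<or> lits = snd \<circ> snd" for k s lits
    using wf_occ_loop[OF assms(1) that] assms(2) bound_vars_occ_loop[of lits Ss k] by fastforce+
  from this[of "fst \<circ> snd"] this[of "snd \<circ> snd"] show ?thesis
    using assms(2) by (simp add: block_loop_def wf_loop_seqs)
qed

lemma wf_clause_loop:
  assumes "\<And>S. S \<in> set Ss \<Longrightarrow> wf_scheme S" "\<And>i. V i \<subseteq> {..<16}"
  shows "wf_loop V (clause_loop Ss)"
proof -
  have "cond_vars (fst S) \<subseteq> {..<16}" if "S \<in> set Ss" for S
    using assms(1)[OF that] by (auto simp: wf_scheme_def case_prod_unfold)
  then show ?thesis
    using assms(2) by (simp add: clause_loop_def wf_loop_seqs clause_loops_def)
qed

lemma wf_graph_loops: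
  assumes "\<And>S. S \<in> set Ss \<Longrightarrow> wf_scheme S"
  shows "wf_loop (\<lambda>ls. \<Union>k\<in>{..<4}. \<Union> (item_vars ` set (ls ! k))) (block_graph_loop ks Ss)"
    and "wf_loop (\<lambda>ls. \<Union>k\<in>{..<4}. \<Union> (item_vars ` set (ls ! k))) (colour_graph_loop ks Ss)"
proof -
  have "\<Union> (item_vars ` set (link_items d)) = {}" "\<Union> (item_vars ` set (clause_items i)) = {5, 6, 7}" for d i
    by (auto simp: link_items_def clause_items_def)
  note vars = this
  have "(\<Union>k\<in>{..<4}. \<Union> (item_vars ` set (block_items b ! k))) \<subseteq> {..<16}" for b :: "('b, nat) block"
    by (cases b) (simp_all add: lessThan_4 vars)
  then show "wf_loop (\<lambda>ls. \<Union>k\<in>{..<4}. \<Union> (item_vars ` set (ls ! k))) (block_graph_loop ks Ss)"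
    unfolding block_graph_loop_def wf_loop_map by (intro wf_block_loop assms) simp_all
  show "wf_loop (\<lambda>ls. \<Union>k\<in>{..<4}. \<Union> (item_vars ` set (ls ! k))) (colour_graph_loop ks Ss)"
    unfolding colour_graph_loop_def wf_loop.simps wf_loop_map
    by (intro wf_block_loop wf_clause_loop conjI assms) (simp_all add: lessThan_4 vars)
qed

lemma bound_vars_graph_loops:
  "bound_vars (block_graph_loop ks Ss) \<subseteq> {5..}" "bound_vars (colour_graph_loop ks Ss) \<subseteq> {5..}"
proof -
  have "bound_vars (occ_loop lits Ss k) \<subseteq> {5..}" for lits k
    by (rule subset_trans[OF bound_vars_occ_loop]) auto
  then have "bound_vars (block_loop ks Ss) \<subseteq> {5..}"
    by (auto simp: block_loop_def bound_vars_seqs)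
  moreover have "bound_vars (clause_loop Ss) \<subseteq> {5..}"
    by (auto simp: clause_loop_def bound_vars_seqs clause_loops_def)
  ultimately show "bound_vars (block_graph_loop ks Ss) \<subseteq> {5..}" "bound_vars (colour_graph_loop ks Ss) \<subseteq> {5..}"
    by (simp_all add: block_graph_loop_def colour_graph_loop_def)
qed

theorem scheme_reduction:
  assumes "\<And>S. S \<in> set Ss \<Longrightarrow> wf_scheme S" "distinct ks"
  shows "\<exists>f. poly_time f \<and> (\<forall>x. f x \<in> path_inputs \<and>
    (f x \<in> MCES_yes \<longleftrightarrow> sat_schemes x (base_env p q r (length x)) ks Ss))"
proof (intro exI conjI allI)
  let ?f = "\<lambda>x. snd (apply_trace (trace x (reduction_loop ks Ss) (base_env p q r (length x))) (0, []))"
  show "poly_time ?f"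
  proof (rule poly_time_loop)
    show "wf_prog (reduction_loop ks Ss)"
      unfolding reduction_loop_def
      using wf_print_graph(1)[OF wf_graph_loops(1)[OF assms(1)]] wf_print_graph(1)[OF wf_graph_loops(2)[OF assms(1)]]
      by simp
    show "bound_vars (reduction_loop ks Ss) \<subseteq> {5..}"
      using bound_vars_graph_loops[of ks Ss] by (simp add: reduction_loop_def print_graph_def)
  qed
  fix x :: "bool list"
  define e where "e = base_env p q r (length x)"
  let ?G = "block_graph x e ks Ss" and ?H = "colour_graph x e ks Ss" and ?K = "length (trace x (colour_graph_loop ks Ss) e)"
  have enc: "encodes_input (?f x) ?G ?H ?K"
    unfolding e_def by (rule encodes_reduction)
  then show "?f x \<in> path_inputs"
    unfolding path_inputs_def block_graph_def colour_graph_def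
    using is_path_path_graph[OF inj_vertex] by blast
  define bs where "bs = map eval_block (trace x (block_loop ks Ss) e)"
  define cs where "cs = map Link [0..<length bs] @ map Clause (clause_ids x e Ss)"
  have distinct: "distinct (map label_word cs)"
    using distinct_clause_ids[of x e Ss] inj_on_subset[OF inj_label_word subset_UNIV]
    by (auto simp: distinct_map cs_def inj_on_def)
  have Sep': "label_word Sep' \<notin> label_word ` set ls" if "Sep' \<notin> set ls" for ls
    using that by (simp add: inj_image_mem_iff[OF inj_label_word] del: label_word.simps)
  have "Sep' \<notin> set (blocks_labels bs)"
  proof -
    have "Sep' \<notin> set (block_labels i b)" for i and b :: "('a \<times> nat \<times> nat, clause_id) block"
      by (cases b) auto
    then show ?thesis by (auto simp: blocks_labels_def)
  qed
  note no_Sep' = Sep'[OF this]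
  have K: "?K = length (map label_word cs)"
    by (simp add: colour_graph_loop_def trace_map cs_def bs_def clause_ids_def)
  have graphs: "?G = path_graph vertex (map label_word (blocks_labels bs))"
      "?H = path_graph vertex (spread (label_word Sep') (map label_word cs))"
    by (simp_all add: block_graph_def colour_graph_def trace_labels_block_graph trace_labels_colour_graph cs_def bs_def
        del: label_word.simps map_append)
  have "?f x \<in> MCES_yes \<longleftrightarrow> ?K \<le> MCES ?G ?H"
  proof
    assume "?f x \<in> MCES_yes"
    then obtain G H K where *: "encodes_input (?f x) G H K" "K \<le> MCES G H"
      unfolding MCES_yes_def by blast
    have "MCES G H = MCES ?G ?H"
      using encodes_input_unique[OF *(1) enc] by (intro MCES_cong) auto
    then show "?K \<le> MCES ?G ?H"
      using * encodes_input_unique(3)[OF *(1) enc] by simp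
  next
    assume "?K \<le> MCES ?G ?H"
    with enc show "?f x \<in> MCES_yes"
      unfolding MCES_yes_def by blast
  qed
  also have "\<dots> \<longleftrightarrow> selectable (map label_word (blocks_labels bs)) (set (map label_word cs))"
    unfolding graphs K
    using selectable_if_MCES[OF inj_vertex distinct, of "label_word Sep'" "map label_word (blocks_labels bs)"]
      MCES_if_selectable[OF inj_vertex distinct, of "map label_word (blocks_labels bs)" "label_word Sep'"]
      no_Sep' Sep'[of cs] by (auto simp: cs_def simp del: label_word.simps)
  also have "\<dots> \<longleftrightarrow> selectable (blocks_labels bs) (set cs)"
  proof -
    have "(!) (map label_word ls) ` I = label_word ` (!) ls ` I" if "I \<subseteq> {..<length ls}" for ls I
      using that by (force simp: image_image)
    then show ?thesis
      unfolding selectable_def length_map set_map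
      by (metis inj_image_subset_iff[OF inj_label_word])
  qed
  also have "set cs = Link ` {..<length bs} \<union> Clause ` set (clause_ids x e Ss)"
    by (auto simp: cs_def)
  also have "selectable (blocks_labels bs) (Link ` {..<length bs} \<union> Clause ` set (clause_ids x e Ss)) \<longleftrightarrow>
      sat_schemes x e ks Ss"
    unfolding bs_def by (rule selectable_iff_sat_schemes[OF assms])
  finally show "?f x \<in> MCES_yes \<longleftrightarrow> sat_schemes x (base_env p q r (length x)) ks Ss"
    by (simp add: e_def)
qed

section \<open>Computations as clause schemes\<close>

definition state_at :: "tm \<Rightarrow> bool list \<Rightarrow> nat \<Rightarrow> nat" where
  "state_at M w t = fst ((step M ^^ t) (initial M w))"

definition cells_at :: "tm \<Rightarrow> bool list \<Rightarrow> nat \<Rightarrow> nat \<Rightarrow> int \<Rightarrow> nat" where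
  "cells_at M w t j = fst (snd ((step M ^^ t) (initial M w)) ! j)"

definition head_at :: "tm \<Rightarrow> bool list \<Rightarrow> nat \<Rightarrow> nat \<Rightarrow> int" where
  "head_at M w t j = snd (snd ((step M ^^ t) (initial M w)) ! j)"

definition reads_at :: "tm \<Rightarrow> bool list \<Rightarrow> nat \<Rightarrow> nat list" where
  "reads_at M w t = map (\<lambda>j. cells_at M w t j (head_at M w t j)) [0..<num_tapes M]"

text \<open>The transition function extended to the halting state by an idle step, so that the
  clauses treat all states alike.\<close>

definition move_result :: "tm \<Rightarrow> nat \<Rightarrow> nat list \<Rightarrow> nat \<times> (nat \<times> move) list" where
  "move_result M q rs = (if q = 1 then (q, stay rs) else delta M q rs)"

lemma word_tape_less_3: "word_tape x i < 3"
  by (simp add: word_tape_def sym_of_bit_def)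

lemma initial_at:
  assumes "j < num_tapes M"
  shows "state_at M w 0 = 0" "head_at M w 0 j = 0"
    "cells_at M w 0 j = word_tape (if j = 0 then w else [])"
  using assms by (cases j; simp add: state_at_def head_at_def cells_at_def initial_def)+

lemma move_result_wf:
  assumes "wf_tm M" "q < num_states M" "length rs = num_tapes M" "\<forall>a\<in>set rs. a < num_syms M"
  shows "fst (move_result M q rs) < num_states M" "length (snd (move_result M q rs)) = num_tapes M"
    "\<And>j. j < num_tapes M \<Longrightarrow> fst (snd (move_result M q rs) ! j) < num_syms M"
proof -
  obtain q' acts where eq: "move_result M q rs = (q', acts)" by force
  have "q' < num_states M \<and> length acts = num_tapes M \<and> (\<forall>(a, m)\<in>set acts. a < num_syms M)"
  proof (cases "q = 1")
    case True
    then show ?thesis using eq assms by (auto simp: move_result_def stay_def)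
  next
    case False
    then have "delta M q rs = (q', acts)" using eq by (simp add: move_result_def)
    moreover have "case delta M q rs of (q', acts) \<Rightarrow>
        q' < num_states M \<and> length acts = num_tapes M \<and> (\<forall>(a, m)\<in>set acts. a < num_syms M)"
    proof -
      have "\<forall>q rs. q < num_states M \<and> length rs = num_tapes M \<and> (\<forall>a\<in>set rs. a < num_syms M) \<longrightarrow>
          (case delta M q rs of (q', acts) \<Rightarrow>
             q' < num_states M \<and> length acts = num_tapes M \<and> (\<forall>(a, m)\<in>set acts. a < num_syms M))"
        using assms(1) unfolding wf_tm_def by (elim conjE)
      from this[THEN spec[of _ q], THEN spec[of _ rs], THEN mp] show ?thesis
        using assms(2-4) by simp
    qed
    ultimately show ?thesis by simp
  qed
  then have *: "q' < num_states M" "length acts = num_tapes M" "\<And>z. z \<in> set acts \<Longrightarrow> fst z < num_syms M"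
    by auto
  then show "fst (move_result M q rs) < num_states M" "length (snd (move_result M q rs)) = num_tapes M"
    by (simp_all add: eq)
  show "fst (snd (move_result M q rs) ! j) < num_syms M" if "j < num_tapes M" for j
    using *(3)[OF nth_mem[of j acts]] *(2) that by (simp add: eq)
qed

lemma step_move_result: "step M (q, ts) = (fst (move_result M q (scan ts)), map2 act (snd (move_result M q (scan ts))) ts)"
  using act_stay[of ts] by (simp add: move_result_def split: prod.split)

lemma run_invariant:
  assumes "wf_tm M"
  shows "length (snd ((step M ^^ t) (initial M w))) = num_tapes M \<and> state_at M w t < num_states M \<and>
    (\<forall>j<num_tapes M. \<forall>i. cells_at M w t j i < num_syms M)"
proof (induction t)
  case 0
  have "num_tapes M \<ge> 1" "num_syms M \<ge> 3" "num_states M \<ge> 2"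
    using assms by (simp_all add: wf_tm_def)
  then show ?case
    using initial_at[of _ M w] less_le_trans[OF word_tape_less_3]
    by (auto simp: initial_def state_at_def)
next
  case (Suc t)
  obtain q ts where c: "(step M ^^ t) (initial M w) = (q, ts)" by force
  define rs where "rs = scan ts"
  have IH: "length ts = num_tapes M" "q < num_states M" "\<And>j i. j < num_tapes M \<Longrightarrow> fst (ts ! j) i < num_syms M"
    using Suc c by (auto simp: state_at_def cells_at_def)
  have rs: "length rs = num_tapes M" "\<forall>a\<in>set rs. a < num_syms M"
    using IH by (simp_all add: rs_def all_set_conv_all_nth case_prod_unfold)
  note tr = move_result_wf[OF assms IH(2) rs]
  have next_c: "(step M ^^ Suc t) (initial M w) = (fst (move_result M q rs), map2 act (snd (move_result M q rs)) ts)"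
    by (simp add: c step_move_result rs_def del: step.simps)
  have "fst (act (snd (move_result M q rs) ! j) (ts ! j)) i < num_syms M" if "j < num_tapes M" for j i
    using tr(3)[OF that] IH(3)[OF that] by (cases "snd (move_result M q rs) ! j"; cases "ts ! j") auto
  then show ?case
    unfolding state_at_def cells_at_def next_c using tr IH(1) by simp
qed

lemma reads_at:
  assumes "wf_tm M"
  shows "length (reads_at M w t) = num_tapes M" "\<forall>a\<in>set (reads_at M w t). a < num_syms M"
    "\<And>j. j < num_tapes M \<Longrightarrow> reads_at M w t ! j = cells_at M w t j (head_at M w t j)"
  using run_invariant[OF assms] by (auto simp: reads_at_def)

lemma step_at:
  fixes w
  assumes "wf_tm M"
  defines "tr t \<equiv> move_result M (state_at M w t) (reads_at M w t)"
  shows "state_at M w (Suc t) = fst (tr t)"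
    and "j < num_tapes M \<Longrightarrow> cells_at M w (Suc t) j = (cells_at M w t j)(head_at M w t j := fst (snd (tr t) ! j))"
    and "j < num_tapes M \<Longrightarrow> head_at M w (Suc t) j = head_at M w t j + offset (snd (snd (tr t) ! j))"
proof -
  obtain q ts where c: "(step M ^^ t) (initial M w) = (q, ts)" by force
  have len: "length ts = num_tapes M"
    using run_invariant[OF assms(1), of t w] c by simp
  have "reads_at M w t = scan ts"
    unfolding reads_at_def cells_at_def head_at_def c
    by (rule nth_equalityI) (simp_all add: len case_prod_unfold)
  moreover have "state_at M w t = q"
    by (simp add: state_at_def c)
  ultimately have tr: "tr t = move_result M q (scan ts)"
    by (simp add: tr_def)
  have len_tr: "length (snd (tr t)) = num_tapes M"
    unfolding tr_def using run_invariant[OF assms(1)] reads_at[OF assms(1)]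
    by (intro move_result_wf(2) assms(1)) auto
  have next_c: "(step M ^^ Suc t) (initial M w) = (fst (tr t), map2 act (snd (tr t)) ts)"
    by (simp add: c step_move_result tr del: step.simps)
  show "state_at M w (Suc t) = fst (tr t)"
    unfolding state_at_def next_c by simp
  assume j: "j < num_tapes M"
  have nth: "map2 act (snd (tr t)) ts ! j = act (snd (tr t) ! j) (ts ! j)"
    using j len len_tr by simp
  show "cells_at M w (Suc t) j = (cells_at M w t j)(head_at M w t j := fst (snd (tr t) ! j))"
    unfolding cells_at_def head_at_def next_c c snd_conv nth
    by (cases "snd (tr t) ! j"; cases "ts ! j") simp
  show "head_at M w (Suc t) j = head_at M w t j + offset (snd (snd (tr t) ! j))"
    unfolding cells_at_def head_at_def next_c c snd_conv nth
    by (cases "snd (tr t) ! j"; cases "ts ! j") simp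
qed

lemma head_at_bound:
  assumes "wf_tm M" "j < num_tapes M"
  shows "\<bar>head_at M w t j\<bar> \<le> int t"
proof (induction t)
  case 0
  then show ?case using initial_at[OF assms(2)] by simp
next
  case (Suc t)
  have "\<bar>offset m\<bar> \<le> 1" for m by (cases m) auto
  note offset = this
  show ?case
    using Suc step_at(3)[OF assms, of w t] offset[of "snd (snd (move_result M (state_at M w t) (reads_at M w t)) ! j)"]
    by linarith
qed

lemma holds_wordD:
  "holds_word f y \<Longrightarrow> i < length y \<Longrightarrow> f (int i) = sym_of_bit (y ! i)"
  "holds_word f y \<Longrightarrow> f (int (length y)) = 0"
  by (simp_all add: holds_word_def)

lemma holds_word_unique:
  assumes "holds_word f y" "holds_word f z"
  shows "y = z"
proof (rule nth_equalityI)
  have pos: "sym_of_bit b \<noteq> 0" for b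
    by (simp add: sym_of_bit_def)
  have not_less: "\<not> length y < length z" if "holds_word f y" "holds_word f z" for y z
    using holds_wordD(1)[OF that(2), of "length y"] holds_wordD(2)[OF that(1)] pos by metis
  from not_less[OF assms] not_less[OF assms(2,1)] show len: "length y = length z" by simp
  fix i
  assume i: "i < length y"
  have "sym_of_bit (y ! i) = sym_of_bit (z ! i)"
    using holds_wordD(1)[OF assms(1) i] holds_wordD(1)[OF assms(2) i[unfolded len]] by simp
  then show "y ! i = z ! i"
    by (simp add: sym_of_bit_def split: if_splits)
qed

text \<open>A halted configuration repeats forever, so the output can be read at one fixed time
  \<open>T\<close> however early the machine stops; and a tape holds at most one word.\<close>

lemma output_at:
  assumes "wf_tm M" "t \<le> T" "halts_with ((step M ^^ t) (initial M w)) y"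
  shows "holds_word (cells_at M w T (num_tapes M - 1)) z \<longleftrightarrow> y = z"
proof -
  obtain q ts where c: "(step M ^^ t) (initial M w) = (q, ts)" by force
  have q: "q = 1" using assms(3) by (simp add: c halts_with_def)
  have stays: "(step M ^^ n) (1, ts) = (1, ts)" for n
    by (induction n) auto
  have "(step M ^^ (T - t + t)) (initial M w) = (step M ^^ (T - t)) ((step M ^^ t) (initial M w))"
    by (simp only: funpow_add o_apply)
  then have c_T: "(step M ^^ T) (initial M w) = (1, ts)"
    by (simp only: c q stays le_add_diff_inverse2[OF assms(2)])
  have "num_tapes M \<ge> 1"
    using assms(1) by (simp add: wf_tm_def)
  moreover have len: "length ts = num_tapes M"
    using run_invariant[OF assms(1), of T w] by (simp add: c_T)
  ultimately have "ts \<noteq> []" by auto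
  then have "cells_at M w T (num_tapes M - 1) = fst (last ts)"
    by (simp add: cells_at_def c_T last_conv_nth len)
  moreover have "holds_word (fst (last ts)) y"
    using assms(3) by (simp add: c halts_with_def)
  ultimately show ?thesis
    using holds_word_unique by auto
qed

text \<open>\<open>Reads j a\<close> is redundant information about head and cell. It frees the
  transition clauses from the head positions, which would otherwise require a loop variable for
  every tape.\<close>

datatype kind = State nat | Reads nat nat | Head nat | Cell nat nat

definition kinds :: "tm \<Rightarrow> kind list" where
  "kinds M = map State [0..<num_states M] @ map Head [0..<num_tapes M] @
     concat (map (\<lambda>j. map (Reads j) [0..<num_syms M] @ map (Cell j) [0..<num_syms M]) [0..<num_tapes M])"

text \<open>Loop variables 0 to 4 hold 1, the length of the input, the bound on the length of the witness,
  the time bound \<open>Z\<close>, which is also the position of cell 0 on the tapes, and \<open>2 * Z\<close>. Variable 5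
  stands for a time, variables 6 and 7 for positions on the tapes. The schemes are implications from
  one configuration to the next, so that every satisfying assignment contains the tableau of a run but
  may contain more.\<close>

definition lt_cond :: "nat list \<Rightarrow> nat list \<Rightarrow> cond" where
  "lt_cond us vs = Le (us @ [0]) vs"

definition eq_cond :: "nat list \<Rightarrow> nat list \<Rightarrow> cond" where
  "eq_cond us vs = CAnd (Le us vs) (Le vs us)"

definition always :: cond where
  "always = Le [] []"

text \<open>The second scheme is the frame condition: a cell away from the head keeps its symbol.
  The guard keeps the next time below \<open>Z\<close>.\<close>

definition read_schemes :: "nat \<Rightarrow> nat \<Rightarrow> kind scheme list" where
  "read_schemes j a =
    [(always, [(Reads j a, [5], [])], [(Head j, [5], [6]), (Cell j a, [5], [6])]),
     (CAnd (lt_cond [5, 0] [3]) (CNot (eq_cond [6] [7])), [(Cell j a, [5, 0], [7])], [(Head j, [5], [6]), (Cell j a, [5], [7])])]"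

text \<open>Literals contain only sums, so a left move cannot be written with a difference. Variable
  6 is instead the smaller of the old and the new position.\<close>

fun move_from :: "move \<Rightarrow> nat list" where
  "move_from Left = [6, 0]"
| "move_from _ = [6]"

fun move_to :: "move \<Rightarrow> nat list" where
  "move_to Right = [6, 0]"
| "move_to _ = [6]"

definition situation :: "tm \<Rightarrow> nat \<Rightarrow> nat list \<Rightarrow> kind literal list" where
  "situation M q rs = (State q, [5], []) # map (\<lambda>j. (Reads j (rs ! j), [5], [])) [0..<num_tapes M]"

text \<open>A conclusion with an out-of-range position would vanish from its clause and turn it into
  a prohibition. The guard removes such instances and ends the tableau at time
  \<open>Z - 1\<close>.\<close>

definition step_guard :: cond where
  "step_guard = CAnd (lt_cond [5, 0] [3]) (lt_cond [6, 0] [4])"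

definition step_schemes :: "tm \<Rightarrow> nat \<Rightarrow> nat list \<Rightarrow> kind scheme list" where
  "step_schemes M q rs = (case move_result M q rs of (q', acts) \<Rightarrow>
    (step_guard, [(State q', [5, 0], [])], situation M q rs) #
    concat (map (\<lambda>j.
      [(step_guard, [(Cell j (fst (acts ! j)), [5, 0], [6])], (Head j, [5], [6]) # situation M q rs),
       (step_guard, [(Head j, [5, 0], move_to (snd (acts ! j)))],
         (Head j, [5], move_from (snd (acts ! j))) # situation M q rs)]) [0..<num_tapes M]))"

definition start_schemes :: "tm \<Rightarrow> kind scheme list" where
  "start_schemes M = (always, [(State 0, [], [])], []) #
     map (\<lambda>j. (always, [(Head j, [], [3])], [])) [0..<num_tapes M] @
     map (\<lambda>j. (always, [(Cell j 0, [], [6])], [])) [1..<num_tapes M]"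

text \<open>The last two schemes guess the witness: any symbols, but only blanks after the first blank.\<close>

definition input_schemes :: "kind scheme list" where
  "input_schemes =
    [(CNot (CAnd (Le [3] [6]) (lt_cond [6] [3, 1, 1, 0, 2])), [(Cell 0 0, [], [6])], []),
     (CAnd (lt_cond [5] [1]) (eq_cond [6] [3, 5, 5]), [(Cell 0 2, [], [6])], []),
     (CAnd (Bit 5) (eq_cond [6] [3, 5, 5, 0]), [(Cell 0 2, [], [6])], []),
     (CAnd (lt_cond [5] [1]) (CAnd (CNot (Bit 5)) (eq_cond [6] [3, 5, 5, 0])), [(Cell 0 1, [], [6])], []),
     (eq_cond [6] [3, 1, 1], [(Cell 0 1, [], [6])], []),
     (CAnd (Le [3, 1, 1, 0] [6]) (lt_cond [6] [3, 1, 1, 0, 2]),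
       [(Cell 0 0, [], [6]), (Cell 0 1, [], [6]), (Cell 0 2, [], [6])], []),
     (CAnd (Le [3, 1, 1, 0] [6]) (lt_cond [6, 0] [3, 1, 1, 0, 2]),
       [(Cell 0 0, [], [6, 0])], [(Cell 0 0, [], [6])])]"

text \<open>An assignment may hold wrong symbols besides the right one, so acceptance is expressed
  by prohibitions: at time \<open>Z - 1\<close> cell 0 carries nothing but the symbol 2 of
  \<open>True\<close>, and cell 1 nothing but a blank.\<close>

definition output_schemes :: "tm \<Rightarrow> kind scheme list" where
  "output_schemes M =
    map (\<lambda>a. (eq_cond [5, 0] [3], [], [(Cell (num_tapes M - 1) a, [5], [3])])) (filter (\<lambda>a. a \<noteq> 2) [0..<num_syms M]) @
    map (\<lambda>a. (eq_cond [5, 0] [3], [], [(Cell (num_tapes M - 1) a, [5], [3, 0])])) (filter (\<lambda>a. a \<noteq> 0) [0..<num_syms M])"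

definition schemes :: "tm \<Rightarrow> kind scheme list" where
  "schemes M =
     concat (map (\<lambda>j. concat (map (read_schemes j) [0..<num_syms M])) [0..<num_tapes M]) @
     concat (map (\<lambda>q. concat (map (step_schemes M q) (List.n_lists (num_tapes M) [0..<num_syms M]))) [0..<num_states M]) @
     start_schemes M @ input_schemes @ output_schemes M"

lemma wf_schemes:
  assumes "S \<in> set (schemes M)"
  shows "wf_scheme S"
proof -
  have moves: "set (move_from m) \<subseteq> {..<8} \<and> set (move_to m) \<subseteq> {..<8}" for m
    by (cases m) auto
  have "\<forall>(k, us, vs)\<in>set (situation M q rs). set us \<subseteq> {..<8} \<and> set vs \<subseteq> {..<8}" for q rs
    by (auto simp: situation_def)
  then have situation: "list_all (\<lambda>(k, us, vs). set us \<subseteq> {..<8} \<and> set vs \<subseteq> {..<8}) (situation M q rs)" for q rs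
    by (simp add: list_all_iff)
  have wf: "wf_scheme (g, ps, ns) \<longleftrightarrow> cond_vars g \<subseteq> {..<8} \<and>
      list_all (\<lambda>(k, us, vs). set us \<subseteq> {..<8} \<and> set vs \<subseteq> {..<8}) ps \<and>
      list_all (\<lambda>(k, us, vs). set us \<subseteq> {..<8} \<and> set vs \<subseteq> {..<8}) ns" for g and ps ns :: "kind literal list"
    by (simp add: wf_scheme_def list_all_iff ball_Un)
  have "list_all wf_scheme (read_schemes j a)" for j a
    by (simp add: read_schemes_def wf always_def lt_cond_def eq_cond_def)
  moreover have "list_all wf_scheme (step_schemes M q rs)" for q rs
    by (cases "move_result M q rs")
      (simp add: step_schemes_def wf step_guard_def lt_cond_def situation moves list_all_iff[of wf_scheme])
  moreover have "list_all wf_scheme (start_schemes M)"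
    by (simp add: start_schemes_def wf always_def list_all_iff[of wf_scheme])
  moreover have "list_all wf_scheme input_schemes"
    by (simp add: input_schemes_def wf lt_cond_def eq_cond_def)
  moreover have "list_all wf_scheme (output_schemes M)"
    by (simp add: output_schemes_def wf eq_cond_def list_all_iff[of wf_scheme])
  ultimately have "list_all wf_scheme (schemes M)"
    by (auto simp: schemes_def list_all_iff)
  then show ?thesis
    using assms by (simp add: list_all_iff)
qed

lemma distinct_kinds: "distinct (kinds M)"
proof -
  have "distinct (concat (map (\<lambda>j. map (Reads j) [0..<n] @ map (Cell j) [0..<n]) [0..<m]))" for n m
    by (rule distinct_concat_key[where key = "\<lambda>k. case k of Reads j a \<Rightarrow> j | Cell j a \<Rightarrow> j | _ \<Rightarrow> 0"])
      (auto simp: distinct_map inj_on_def)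
  then show ?thesis
    unfolding kinds_def by (auto simp: distinct_map inj_on_def)
qed

lemma in_kinds:
  "State q \<in> set (kinds M) \<longleftrightarrow> q < num_states M" "Head j \<in> set (kinds M) \<longleftrightarrow> j < num_tapes M"
  "Reads j a \<in> set (kinds M) \<longleftrightarrow> j < num_tapes M \<and> a < num_syms M"
  "Cell j a \<in> set (kinds M) \<longleftrightarrow> j < num_tapes M \<and> a < num_syms M"
  by (auto simp: kinds_def image_iff)

section \<open>The tape contents of an input paired with a witness\<close>

lemma length_enc_word: "length (enc_word x) = 2 * length x + 1"
  by (induction x) (auto simp: enc_word_def enc_list_def)

lemma enc_word_Cons: "enc_word (b # x) = True # b # enc_word x"
  by (simp add: enc_word_def enc_list_def)

lemma nth_enc_word:
  "i < length x \<Longrightarrow> enc_word x ! (2 * i) = True \<and> enc_word x ! Suc (2 * i) = x ! i"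
  "enc_word x ! (2 * length x) = False"
proof (induction x arbitrary: i)
  case (Cons b x)
  {
    case 1
    then show ?case using Cons(1) by (cases i) (auto simp: enc_word_Cons)
  next
    case 2
    then show ?case using Cons(2) by (auto simp: enc_word_Cons)
  }
qed (auto simp: enc_word_def enc_list_def)

text \<open>The zones behind \<open>input_schemes\<close>: list markers in even cells, input bits in
  odd cells, the end mark of the first word, the witness, and blanks.\<close>

lemma word_tape_enc_pair:
  "i < length x \<Longrightarrow> word_tape (enc_pair x u) (2 * int i) = 2"
  "i < length x \<Longrightarrow> word_tape (enc_pair x u) (2 * int i + 1) = sym_of_bit (x ! i)"
  "word_tape (enc_pair x u) (2 * int (length x)) = 1"
  "i < length u \<Longrightarrow> word_tape (enc_pair x u) (2 * int (length x) + 1 + int i) = sym_of_bit (u ! i)"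
  "length u \<le> i \<Longrightarrow> word_tape (enc_pair x u) (2 * int (length x) + 1 + int i) = 0"
  "z < 0 \<Longrightarrow> word_tape (enc_pair x u) z = 0"
proof -
  have tape: "word_tape (enc_pair x u) (int i) =
      (if i < 2 * length x + 1 then sym_of_bit (enc_word x ! i)
       else if i < 2 * length x + 1 + length u then sym_of_bit (u ! (i - (2 * length x + 1))) else 0)" for i
    by (auto simp: word_tape_def enc_pair_def length_enc_word nth_append)
  show "word_tape (enc_pair x u) (2 * int i) = 2" if "i < length x"
    using tape[of "2 * i"] nth_enc_word(1)[OF that] that by (simp add: sym_of_bit_def)
  show "word_tape (enc_pair x u) (2 * int i + 1) = sym_of_bit (x ! i)" if "i < length x"
    using tape[of "2 * i + 1"] nth_enc_word(1)[OF that] that by (simp add: add.commute)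
  show "word_tape (enc_pair x u) (2 * int (length x)) = 1"
    using tape[of "2 * length x"] nth_enc_word(2) by (simp add: sym_of_bit_def)
  show "word_tape (enc_pair x u) (2 * int (length x) + 1 + int i) = sym_of_bit (u ! i)" if "i < length u"
    using tape[of "2 * length x + 1 + i"] that by (simp add: add_ac)
  show "word_tape (enc_pair x u) (2 * int (length x) + 1 + int i) = 0" if "length u \<le> i"
    using tape[of "2 * length x + 1 + i"] that by (simp add: add_ac)
  show "word_tape (enc_pair x u) z = 0" if "z < 0"
    using that by (simp add: word_tape_def)
qed

text \<open>Cell \<open>i\<close> has position \<open>i + Z\<close> in a window of
  \<open>2 * Z\<close> positions. Before time \<open>Z\<close> no head can leave the window, and the
  last assumption makes the longest pair of input and witness fit into it.\<close>

locale tableau =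
  fixes M :: tm and x :: "bool list" and e0 :: "nat \<Rightarrow> nat" and P Z :: nat
  assumes wf_M: "wf_tm M"
    and e0: "e0 0 = 1" "e0 (Suc 0) = length x" "e0 2 = P" "e0 3 = Z" "e0 4 = 2 * Z"
    and Z: "2 * length x + P + 2 \<le> Z"
begin

abbreviation inst :: "nat \<Rightarrow> nat \<Rightarrow> nat \<Rightarrow> nat \<Rightarrow> nat" where
  "inst a b c \<equiv> e0(5 := a, 6 := b, 7 := c)"

lemma tapes_pos: "0 < num_tapes M" and syms_ge: "3 \<le> num_syms M" and states_ge: "2 \<le> num_states M"
  using wf_M by (simp_all add: wf_tm_def)

lemma holds_simps:
  "holds x (inst a b c) (lt_cond us vs) \<longleftrightarrow> val (inst a b c) us < val (inst a b c) vs"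
  "holds x (inst a b c) (eq_cond us vs) \<longleftrightarrow> val (inst a b c) us = val (inst a b c) vs"
  "holds x (inst a b c) always"
  by (auto simp: lt_cond_def eq_cond_def always_def val_def e0)

lemma val_simps:
  "val (inst a b c) [] = 0" "val (inst a b c) (i # us) = inst a b c i + val (inst a b c) us"
  by (simp_all add: val_def)

lemma val_moves: "int (val (inst a b c) (move_to m)) = int (val (inst a b c) (move_from m)) + offset m"
  by (cases m) (simp_all add: val_simps e0)

fun model :: "bool list \<Rightarrow> kind \<times> nat \<times> nat \<Rightarrow> bool" where
  "model w (State q, t, p) \<longleftrightarrow> state_at M w t = q"
| "model w (Reads j a, t, p) \<longleftrightarrow> cells_at M w t j (head_at M w t j) = a"
| "model w (Head j, t, p) \<longleftrightarrow> head_at M w t j = int p - int Z"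
| "model w (Cell j a, t, p) \<longleftrightarrow> cells_at M w t j (int p - int Z) = a"

definition in_range :: "(nat \<Rightarrow> nat) \<Rightarrow> kind literal \<Rightarrow> bool" where
  "in_range e = (\<lambda>(k, us, vs). k \<in> set (kinds M) \<and> val e us < 2 * Z \<and> val e vs < 2 * Z)"

definition atom_of :: "(nat \<Rightarrow> nat) \<Rightarrow> kind literal \<Rightarrow> kind \<times> nat \<times> nat" where
  "atom_of e = (\<lambda>(k, us, vs). (k, val e us, val e vs))"

definition fulfils :: "(kind \<times> nat \<times> nat \<Rightarrow> bool) \<Rightarrow> kind scheme \<Rightarrow> bool" where
  "fulfils \<alpha> = (\<lambda>(g, ps, ns). \<forall>a<2 * Z. \<forall>b<2 * Z. \<forall>c<2 * Z. holds x (inst a b c) g \<longrightarrow>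
     (\<exists>l\<in>set ps. in_range (inst a b c) l \<and> \<alpha> (atom_of (inst a b c) l)) \<or>
     (\<exists>l\<in>set ns. in_range (inst a b c) l \<and> \<not> \<alpha> (atom_of (inst a b c) l)))"

lemma fulfilsI:
  assumes "\<And>a b c. a < 2 * Z \<Longrightarrow> b < 2 * Z \<Longrightarrow> c < 2 * Z \<Longrightarrow> holds x (inst a b c) g \<Longrightarrow>
     (\<exists>l\<in>set ps. in_range (inst a b c) l \<and> \<alpha> (atom_of (inst a b c) l)) \<or>
     (\<exists>l\<in>set ns. in_range (inst a b c) l \<and> \<not> \<alpha> (atom_of (inst a b c) l))"
  shows "fulfils \<alpha> (g, ps, ns)"
  using assms by (simp add: fulfils_def)

lemma sat_iff: "sat_schemes x e0 (kinds M) (schemes M) \<longleftrightarrow> (\<exists>\<alpha>. list_all (fulfils \<alpha>) (schemes M))"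
  unfolding sat_schemes_def fulfils_def list_all_iff Let_def in_range_def atom_of_def e0 case_prod_unfold
    fst_conv snd_conv conj_assoc ..

lemma Z_less: "Z < 2 * Z" "Suc Z < 2 * Z" "0 < 2 * Z"
  using Z by auto

subsection \<open>The tableau of a run satisfies the schemes\<close>

context
  fixes w :: "bool list"
begin

text \<open>This is the case split for clauses with this situation as premise: either a negated
  premise already satisfies the clause, or the run really is in the situation and the transition
  applies.\<close>

lemma situation_cases:
  assumes "q < num_states M" "length rs = num_tapes M" "\<forall>a\<in>set rs. a < num_syms M" "a < 2 * Z"
  shows "(\<exists>l\<in>set (situation M q rs). in_range (inst a b c) l \<and> \<not> model w (atom_of (inst a b c) l)) \<or>
    (state_at M w a = q \<and> reads_at M w a = rs)"
proof -
  consider "state_at M w a \<noteq> q" | j where "j < num_tapes M" "cells_at M w a j (head_at M w a j) \<noteq> rs ! j"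
    | "state_at M w a = q" "reads_at M w a = rs"
    using reads_at[OF wf_M, where w = w and t = a] assms(2) nth_equalityI[of "reads_at M w a" rs] by fastforce
  then show ?thesis
  proof cases
    case 1
    then have "in_range (inst a b c) (State q, [5], []) \<and> \<not> model w (atom_of (inst a b c) (State q, [5], []))"
      using assms(1,4) by (simp add: in_range_def atom_of_def val_simps in_kinds)
    then show ?thesis by (simp add: situation_def)
  next
    case (2 j)
    have "rs ! j < num_syms M"
      using assms(2,3) 2(1) by simp
    then have "in_range (inst a b c) (Reads j (rs ! j), [5], []) \<and>
        \<not> model w (atom_of (inst a b c) (Reads j (rs ! j), [5], []))"
      using assms(4) 2 by (simp add: in_range_def atom_of_def val_simps in_kinds)
    moreover have "(Reads j (rs ! j), [5], []) \<in> set (situation M q rs)"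
      using 2(1) by (simp add: situation_def)
    ultimately show ?thesis by blast
  qed simp
qed

lemma fulfils_read: "j < num_tapes M \<Longrightarrow> a < num_syms M \<Longrightarrow> list_all (fulfils (model w)) (read_schemes j a)"
  using step_at(2)[OF wf_M, of j] Z_less(3)
  by (auto simp: read_schemes_def fulfils_def in_range_def atom_of_def val_simps holds_simps in_kinds e0)

lemma fulfils_step:
  assumes "q < num_states M" "length rs = num_tapes M" "\<forall>a\<in>set rs. a < num_syms M"
  shows "list_all (fulfils (model w)) (step_schemes M q rs)"
proof -
  note mr = move_result_wf[OF wf_M assms]
  define q' acts where "q' = fst (move_result M q rs)" and "acts = snd (move_result M q rs)"
  have result: "move_result M q rs = (q', acts)"
    by (simp add: q'_def acts_def)
  have now: "state_at M w (Suc a) = q'"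
      "\<And>j. j < num_tapes M \<Longrightarrow> cells_at M w (Suc a) j (head_at M w a j) = fst (acts ! j)"
      "\<And>j. j < num_tapes M \<Longrightarrow> head_at M w (Suc a) j = head_at M w a j + offset (snd (acts ! j))"
    if "state_at M w a = q \<and> reads_at M w a = rs" for a
    using step_at[OF wf_M, where w = w and t = a] that by (simp_all add: result)
  have 1: "fulfils (model w) (step_guard, [(State q', [5, 0], [])], situation M q rs)"
  proof (rule fulfilsI, goal_cases)
    case (1 a b c)
    note abc = 1(1-3) and g = 1(4)
    have a: "Suc a < Z" using g by (simp add: step_guard_def holds_simps val_simps e0)
    from situation_cases[OF assms abc(1), of b c] now(1)[of a]
    show ?case
      using a mr(1) Z_less(3)
      by (elim disjE) (auto simp: in_range_def atom_of_def val_simps in_kinds e0 result)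
  qed
  have 2: "fulfils (model w) (step_guard, [(Cell j (fst (acts ! j)), [5, 0], [6])], (Head j, [5], [6]) # situation M q rs)"
    if j: "j < num_tapes M" for j
  proof (rule fulfilsI, goal_cases)
    case (1 a b c)
    note abc = 1(1-3) and g = 1(4)
    have a: "Suc a < Z" using g by (simp add: step_guard_def holds_simps val_simps e0)
    from situation_cases[OF assms abc(1), of b c] now(2)[of a, OF _ j]
    show ?case
      using a abc mr(3)[OF j] j
      by (elim disjE) (auto simp: in_range_def atom_of_def val_simps in_kinds e0 result)
  qed
  have 3: "fulfils (model w) (step_guard, [(Head j, [5, 0], move_to (snd (acts ! j)))],
      (Head j, [5], move_from (snd (acts ! j))) # situation M q rs)" if j: "j < num_tapes M" for j
  proof (rule fulfilsI, goal_cases)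
    case (1 a b c)
    note abc = 1(1-3) and g = 1(4)
    let ?m = "snd (acts ! j)"
    have a: "Suc a < Z" "Suc b < 2 * Z" using g by (simp_all add: step_guard_def holds_simps val_simps e0)
    have range: "val (inst a b c) (move_to ?m) < 2 * Z" "val (inst a b c) (move_from ?m) < 2 * Z"
      using a abc by (cases ?m; simp add: val_simps e0)+
    show ?case
      using situation_cases[OF assms abc(1), of b c] a abc range val_moves[of a b c ?m] now(3)[of a, OF _ j] j
      by (elim disjE) (auto simp: in_range_def atom_of_def val_simps in_kinds e0)
  qed
  show ?thesis
    using 1 2 3 by (simp add: step_schemes_def result list_all_iff)
qed

end

lemma fulfils_start: "list_all (fulfils (model w)) (start_schemes M)"
  using states_ge syms_ge tapes_pos initial_at[of _ M w] Z_less
  by (auto simp: start_schemes_def list_all_iff fulfils_def in_range_def atom_of_def val_simps in_kinds e0 word_tape_def)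

lemma fulfils_output:
  assumes "holds_word (cells_at M w (Z - 1) (num_tapes M - 1)) [True]"
  shows "list_all (fulfils (model w)) (output_schemes M)"
proof -
  have "cells_at M w (Z - 1) (num_tapes M - 1) 0 = 2" "cells_at M w (Z - 1) (num_tapes M - 1) 1 = 0"
    using assms by (simp_all add: holds_word_def sym_of_bit_def)
  moreover have "a = Z - 1" if "Suc a = Z" for a
    using that by simp
  ultimately show ?thesis
    using Z_less tapes_pos
    by (auto simp: output_schemes_def list_all_iff fulfils_def in_range_def atom_of_def val_simps holds_simps in_kinds e0)
qed

lemma fulfils_input:
  assumes "length u \<le> P"
  shows "list_all (fulfils (model (enc_pair x u))) input_schemes"
proof -
  let ?W = "word_tape (enc_pair x u)"
  have cell: "cells_at M (enc_pair x u) 0 0 = ?W"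
    using initial_at(3)[OF tapes_pos, of "enc_pair x u"] by simp
  have odd: "?W (1 + 2 * int i) = sym_of_bit (x ! i)" if "i < length x" for i
    using word_tape_enc_pair(2)[OF that, of u] by (simp add: add.commute)
  have single: "fulfils (model (enc_pair x u)) (g, [(Cell 0 s, [], [6])], [])"
    if "s < 3" "\<And>a b c. holds x (inst a b c) g \<Longrightarrow> ?W (int b - int Z) = s" for g s
    using that syms_ge tapes_pos Z_less(3)
    by (auto simp: fulfils_def in_range_def atom_of_def val_simps in_kinds e0 cell)
  have zone: "?W (int b - int Z) = 0" if "\<not> (Z \<le> b \<and> b < Z + 2 * length x + 1 + P)" for b
  proof (cases "b < Z")
    case True
    then show ?thesis by (intro word_tape_enc_pair(6)) simp
  next
    case False
    define i where "i = b - (Z + 2 * length x + 1)"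
    have "int b - int Z = 2 * int (length x) + 1 + int i" "length u \<le> i"
      using False that assms by (auto simp: i_def)
    then show ?thesis using word_tape_enc_pair(5)[of u i x] by simp
  qed
  have "fulfils (model (enc_pair x u)) (CNot (CAnd (Le [3] [6]) (lt_cond [6] [3, 1, 1, 0, 2])), [(Cell 0 0, [], [6])], [])"
    by (rule single) (auto simp: holds_simps val_simps e0 val_def intro!: zone)
  moreover have "fulfils (model (enc_pair x u)) (CAnd (lt_cond [5] [1]) (eq_cond [6] [3, 5, 5]), [(Cell 0 2, [], [6])], [])"
    by (rule single) (auto simp: holds_simps val_simps e0 word_tape_enc_pair(1) simp flip: mult_2)
  moreover have "fulfils (model (enc_pair x u)) (CAnd (Bit 5) (eq_cond [6] [3, 5, 5, 0]), [(Cell 0 2, [], [6])], [])"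
    by (rule single) (auto simp: holds_simps val_simps e0 odd sym_of_bit_def add_ac simp flip: mult_2)
  moreover have "fulfils (model (enc_pair x u)) (CAnd (lt_cond [5] [1]) (CAnd (CNot (Bit 5)) (eq_cond [6] [3, 5, 5, 0])),
      [(Cell 0 1, [], [6])], [])"
    by (rule single) (auto simp: holds_simps val_simps e0 odd sym_of_bit_def add_ac simp flip: mult_2)
  moreover have "fulfils (model (enc_pair x u)) (eq_cond [6] [3, 1, 1], [(Cell 0 1, [], [6])], [])"
    by (rule single) (auto simp: holds_simps val_simps e0 word_tape_enc_pair(3) simp flip: mult_2)
  moreover have "fulfils (model (enc_pair x u)) (CAnd (Le [3, 1, 1, 0] [6]) (lt_cond [6] [3, 1, 1, 0, 2]),
       [(Cell 0 0, [], [6]), (Cell 0 1, [], [6]), (Cell 0 2, [], [6])], [])"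
  proof -
    have "?W (int b - int Z) = 0 \<or> ?W (int b - int Z) = 1 \<or> ?W (int b - int Z) = 2" for b
      by (auto simp: word_tape_def sym_of_bit_def)
    then show ?thesis
      using syms_ge tapes_pos Z_less(3)
      by (auto simp: fulfils_def in_range_def atom_of_def val_simps in_kinds e0 cell)
  qed
  moreover have "fulfils (model (enc_pair x u)) (CAnd (Le [3, 1, 1, 0] [6]) (lt_cond [6, 0] [3, 1, 1, 0, 2]),
       [(Cell 0 0, [], [6, 0])], [(Cell 0 0, [], [6])])"
  proof -
    \<comment> \<open>Witness symbols are 1 or 2, so a blank in this zone means that the witness has
      ended, and blanks follow.\<close>
    have "?W (int (Suc b) - int Z) = 0"
      if "Z + 2 * length x + 1 \<le> b" "?W (int b - int Z) = 0" for b
    proof -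
      define i where "i = b - (Z + 2 * length x + 1)"
      have i: "int b - int Z = 2 * int (length x) + 1 + int i"
        using that(1) by (auto simp: i_def)
      have "length u \<le> i"
        using that(2) word_tape_enc_pair(4)[of i u x] unfolding i
        by (cases "i < length u") (auto simp: sym_of_bit_def split: if_splits)
      have next_i: "int (Suc b) - int Z = 2 * int (length x) + 1 + int (Suc i)"
        using i by simp
      show ?thesis
        unfolding next_i by (rule word_tape_enc_pair(5)) (use \<open>length u \<le> i\<close> in simp)
    qed
    note next_blank = this
    show ?thesis
    proof (rule fulfilsI, goal_cases)
      case (1 a b c)
      then have b: "b < 2 * Z" "Z + 2 * length x + 1 \<le> b" "Suc b < Z + 2 * length x + 1 + P"
        by (simp_all add: lt_cond_def e0)
      then have "in_range (inst a b c) (Cell 0 0, [], [6, 0])" "in_range (inst a b c) (Cell 0 0, [], [6])"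
        using syms_ge tapes_pos Z_less(3) Z by (simp_all add: in_range_def val_simps in_kinds e0)
      moreover have "model (enc_pair x u) (atom_of (inst a b c) (Cell 0 0, [], [6, 0])) \<longleftrightarrow> ?W (int (Suc b) - int Z) = 0"
        "model (enc_pair x u) (atom_of (inst a b c) (Cell 0 0, [], [6])) \<longleftrightarrow> ?W (int b - int Z) = 0"
        by (simp_all add: atom_of_def val_simps e0 cell)
      ultimately show ?case
        using next_blank[OF b(2)] by auto
    qed
  qed
  ultimately show ?thesis
    by (simp add: input_schemes_def)
qed

lemma sat_if_accepting:
  assumes "length u \<le> P" "holds_word (cells_at M (enc_pair x u) (Z - 1) (num_tapes M - 1)) [True]"
  shows "sat_schemes x e0 (kinds M) (schemes M)"
proof -
  have "list_all (fulfils (model (enc_pair x u))) (schemes M)"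
    using fulfils_read fulfils_step fulfils_start fulfils_input[OF assms(1)] fulfils_output[OF assms(2)]
    by (auto simp: schemes_def list_all_iff set_n_lists subset_iff)
  then show ?thesis
    unfolding sat_iff by blast
qed

end

subsection \<open>An assignment contains the tableau of an accepting run\<close>

context tableau
begin

lemma in_schemes:
  "j < num_tapes M \<Longrightarrow> a < num_syms M \<Longrightarrow> set (read_schemes j a) \<subseteq> set (schemes M)"
  "q < num_states M \<Longrightarrow> length rs = num_tapes M \<Longrightarrow> \<forall>a\<in>set rs. a < num_syms M \<Longrightarrow>
    set (step_schemes M q rs) \<subseteq> set (schemes M)"
  "set (start_schemes M) \<subseteq> set (schemes M)" "set input_schemes \<subseteq> set (schemes M)"
  "set (output_schemes M) \<subseteq> set (schemes M)"
  by (fastforce simp: schemes_def set_n_lists)+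

lemma step_schemesI:
  "(step_guard, [(State (fst (move_result M q rs)), [5, 0], [])], situation M q rs) \<in> set (step_schemes M q rs)"
  "j < num_tapes M \<Longrightarrow> (step_guard, [(Cell j (fst (snd (move_result M q rs) ! j)), [5, 0], [6])],
     (Head j, [5], [6]) # situation M q rs) \<in> set (step_schemes M q rs)"
  "j < num_tapes M \<Longrightarrow> (step_guard, [(Head j, [5, 0], move_to (snd (snd (move_result M q rs) ! j)))],
     (Head j, [5], move_from (snd (snd (move_result M q rs) ! j))) # situation M q rs) \<in> set (step_schemes M q rs)"
  by (auto simp: step_schemes_def case_prod_unfold)

lemma output_schemesI:
  "a < num_syms M \<Longrightarrow> a \<noteq> 2 \<Longrightarrow>
    (eq_cond [5, 0] [3], [], [(Cell (num_tapes M - 1) a, [5], [3])]) \<in> set (output_schemes M)"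
  "a < num_syms M \<Longrightarrow> a \<noteq> 0 \<Longrightarrow>
    (eq_cond [5, 0] [3], [], [(Cell (num_tapes M - 1) a, [5], [3, 0])]) \<in> set (output_schemes M)"
  by (simp_all add: output_schemes_def)

lemma move_vals:
  assumes "int h' = int h + offset m" "Suc h < 2 * Z" "h' < 2 * Z"
  shows "\<exists>b. Suc b < 2 * Z \<and> val (inst t b 0) (move_from m) = h \<and> val (inst t b 0) (move_to m) = h'"
  using assms by (intro exI[of _ "min h h'"], cases m) (auto simp: val_simps e0 min_def)

context
  fixes \<alpha> :: "kind \<times> nat \<times> nat \<Rightarrow> bool"
  assumes fulfilled: "list_all (fulfils \<alpha>) (schemes M)"
begin

text \<open>The clauses are used as rules from their negative to their positive literals; this is
  the only way in which the assignment is exploited below.\<close>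

lemma fire:
  assumes "(g, ps, ns) \<in> set (schemes M)" "a < 2 * Z" "b < 2 * Z" "c < 2 * Z" "holds x (inst a b c) g"
    "list_all (\<lambda>l. \<alpha> (atom_of (inst a b c) l)) ns"
  shows "\<exists>l\<in>set ps. \<alpha> (atom_of (inst a b c) l)"
proof -
  have "fulfils \<alpha> (g, ps, ns)"
    using fulfilled assms(1) by (simp add: list_all_iff)
  then have "(\<exists>l\<in>set ps. in_range (inst a b c) l \<and> \<alpha> (atom_of (inst a b c) l)) \<or>
      (\<exists>l\<in>set ns. in_range (inst a b c) l \<and> \<not> \<alpha> (atom_of (inst a b c) l))"
    using assms(2-5) unfolding fulfils_def by blast
  then show ?thesis
    using assms(6) by (auto simp: list_all_iff)
qed

lemma fire1:
  assumes "(g, [(k, us, vs)], ns) \<in> set (schemes M)" "a < 2 * Z" "b < 2 * Z" "c < 2 * Z"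
    "holds x (inst a b c) g" "list_all (\<lambda>l. \<alpha> (atom_of (inst a b c) l)) ns"
  shows "\<alpha> (k, val (inst a b c) us, val (inst a b c) vs)"
  using fire[OF assms] by (simp add: atom_of_def)

lemma start_cells:
  "\<alpha> (State 0, 0, 0)" "j < num_tapes M \<Longrightarrow> \<alpha> (Head j, 0, Z)"
  "0 < j \<Longrightarrow> j < num_tapes M \<Longrightarrow> b < 2 * Z \<Longrightarrow> \<alpha> (Cell j 0, 0, b)"
proof -
  have start: "\<alpha> (k, val (inst 0 b 0) us, val (inst 0 b 0) vs)"
    if "(always, [(k, us, vs)], []) \<in> set (start_schemes M)" "b < 2 * Z" for k us vs b
    using fire1[OF subsetD[OF in_schemes(3) that(1)], of 0 b 0] that(2) Z_less(3) by (simp add: holds_simps)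
  show "\<alpha> (State 0, 0, 0)"
    using start[of "State 0" "[]" "[]" 0] Z_less(3) by (simp add: start_schemes_def val_simps)
  show "\<alpha> (Head j, 0, Z)" if "j < num_tapes M"
    using start[of "Head j" "[]" "[3]" 0] Z_less(3) that by (simp add: start_schemes_def val_simps e0)
  show "\<alpha> (Cell j 0, 0, b)" if "0 < j" "j < num_tapes M" "b < 2 * Z"
    using start[of "Cell j 0" "[]" "[6]" b] that by (simp add: start_schemes_def val_simps e0 image_iff)
qed

text \<open>The witness ends where the assignment puts the first blank behind the input.\<close>

lemma input_cells:
  "\<exists>u. length u \<le> P \<and> (\<forall>b<2 * Z. \<alpha> (Cell 0 (word_tape (enc_pair x u) (int b - int Z)), 0, b))"
proof -
  have input: "\<alpha> (Cell 0 s, 0, b)"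
    if "(g, [(Cell 0 s, [], [6])], []) \<in> set input_schemes" "a < 2 * Z" "b < 2 * Z" "holds x (inst a b 0) g" for g s a b
    using fire1[OF subsetD[OF in_schemes(4) that(1)] that(2,3) Z_less(3) that(4)] by (simp add: val_simps)
  define base where "base = Z + 2 * length x + 1"
  have base: "base + P < 2 * Z" using Z by (simp add: base_def)
  \<comment> \<open>The disjunct \<open>j = P\<close> guarantees a least element when no blank is
    assigned in the witness zone.\<close>
  define L where "L = (LEAST j. j = P \<or> \<alpha> (Cell 0 0, 0, base + j))"
  \<comment> \<open>A cell may have several symbols assigned. Before the first blank at least one of
    them is 1 or 2, and 2 is preferred if both are.\<close>
  define u where "u = map (\<lambda>j. \<alpha> (Cell 0 2, 0, base + j)) [0..<L]"
  have L: "L = P \<or> \<alpha> (Cell 0 0, 0, base + L)" "L \<le> P"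
    unfolding L_def by (rule LeastI[of _ P], simp) (rule Least_le, simp)
  have before: "j < P" "\<not> \<alpha> (Cell 0 0, 0, base + j)" if "j < L" for j
    using not_less_Least[of j "\<lambda>j. j = P \<or> \<alpha> (Cell 0 0, 0, base + j)"] that L(2) by (auto simp: L_def)
  have len_u: "length u = L" by (simp add: u_def)
  define w where "w = enc_pair x u"
  note input_fire = fire[OF subsetD[OF in_schemes(4)], of _ _ _ 0 _ 0] fire1[OF subsetD[OF in_schemes(4)], of _ _ _ _ _ 0 _ 0]
  have witness: "\<alpha> (Cell 0 0, 0, base + j) \<or> \<alpha> (Cell 0 1, 0, base + j) \<or> \<alpha> (Cell 0 2, 0, base + j)" if "j < P" for j
    using input_fire(1)[of "CAnd (Le [3, 1, 1, 0] [6]) (lt_cond [6] [3, 1, 1, 0, 2])"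
        "[(Cell 0 0, [], [6]), (Cell 0 1, [], [6]), (Cell 0 2, [], [6])]" "[]" "base + j"] Z_less(3) base that
    by (auto simp: input_schemes_def lt_cond_def atom_of_def val_simps e0 base_def)
  have witness_blank: "\<alpha> (Cell 0 0, 0, base + Suc j)" if "Suc j < P" "\<alpha> (Cell 0 0, 0, base + j)" for j
    using input_fire(2)[of "CAnd (Le [3, 1, 1, 0] [6]) (lt_cond [6, 0] [3, 1, 1, 0, 2])" "Cell 0 0" "[]" "[6, 0]"
        "[(Cell 0 0, [], [6])]" "base + j"] Z_less(3) base that
    by (auto simp: input_schemes_def lt_cond_def atom_of_def val_simps e0 base_def)
  have after: "\<alpha> (Cell 0 0, 0, base + j)" if "L \<le> j" "j < P" for j
    using that
  proof (induction j rule: dec_induct)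
    case base
    then show ?case using L(1) by auto
  next
    case (step j)
    then show ?case by (intro witness_blank) auto
  qed
  have input_cell: "\<alpha> (Cell 0 (word_tape w (int b - int Z)), 0, b)" if b: "b < 2 * Z" for b
  proof -
    consider "b < Z" | "b \<ge> base + P" | i where "i < length x" "b = Z + 2 * i"
      | i where "i < length x" "b = Z + 2 * i + 1" | "b = Z + 2 * length x" | i where "i < P" "b = base + i"
    proof -
      have "b < Z \<or> b \<ge> base + P \<or> (\<exists>i. i < length x \<and> b = Z + 2 * i) \<or> (\<exists>i. i < length x \<and> b = Z + 2 * i + 1) \<or>
          b = Z + 2 * length x \<or> (\<exists>i<P. b = base + i)"
        unfolding base_def by presburger
      then show ?thesis using that by blast
    qed
    then show ?thesis
    proof cases
      case 1
      then have "word_tape w (int b - int Z) = 0"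
        unfolding w_def by (intro word_tape_enc_pair(6)) simp
      then show ?thesis
        using input[of "CNot (CAnd (Le [3] [6]) (lt_cond [6] [3, 1, 1, 0, 2]))" 0 0 b] 1 b
        by (simp add: input_schemes_def e0)
    next
      case 2
      define i where "i = b - base"
      have i: "int b - int Z = 2 * int (length x) + 1 + int i" "length u \<le> i"
        using 2 L(2) by (auto simp: i_def base_def len_u)
      have "word_tape w (int b - int Z) = 0"
        unfolding w_def i(1) by (rule word_tape_enc_pair(5)[OF i(2)])
      then show ?thesis
        using input[of "CNot (CAnd (Le [3] [6]) (lt_cond [6] [3, 1, 1, 0, 2]))" 0 0 b] 2 b
        by (simp add: input_schemes_def e0 lt_cond_def base_def)
    next
      case (3 i)
      then have "word_tape w (int b - int Z) = 2"
        unfolding w_def using word_tape_enc_pair(1)[of i x u] by simp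
      then show ?thesis
        using input[of "CAnd (lt_cond [5] [1]) (eq_cond [6] [3, 5, 5])" 2 i b] 3 b
        by (simp add: input_schemes_def e0 holds_simps val_simps)
    next
      case (4 i)
      then have *: "word_tape w (int b - int Z) = sym_of_bit (x ! i)"
        unfolding w_def using word_tape_enc_pair(2)[of i x u] by (simp add: add.commute)
      show ?thesis
        unfolding *
        using input[of "CAnd (Bit 5) (eq_cond [6] [3, 5, 5, 0])" 2 i b]
          input[of "CAnd (lt_cond [5] [1]) (CAnd (CNot (Bit 5)) (eq_cond [6] [3, 5, 5, 0]))" 1 i b] 4 b
        by (cases "x ! i") (simp_all add: sym_of_bit_def input_schemes_def e0 holds_simps val_simps)
    next
      case 5
      then have "word_tape w (int b - int Z) = 1"
        unfolding w_def using word_tape_enc_pair(3)[of x u] by simp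
      then show ?thesis
        using input[of "eq_cond [6] [3, 1, 1]" 1 0 b] 5 b
        by (simp add: input_schemes_def e0 holds_simps val_simps)
    next
      case (6 i)
      have i: "int b - int Z = 2 * int (length x) + 1 + int i"
        using 6 by (simp add: base_def)
      show ?thesis
      proof (cases "i < L")
        case True
        then have "word_tape w (int b - int Z) = sym_of_bit (\<alpha> (Cell 0 2, 0, base + i))"
          unfolding w_def i using word_tape_enc_pair(4)[of i u x] by (simp add: len_u) (simp add: u_def)
        then show ?thesis
          using witness[of i] before[OF True] 6 by (auto simp: sym_of_bit_def)
      next
        case False
        then have "word_tape w (int b - int Z) = 0"
          unfolding w_def i by (intro word_tape_enc_pair(5)) (simp add: len_u)
        then show ?thesis
          using after[of i] False 6 by simp
      qed
    qed
  qed
  then show ?thesis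
    using L(2) len_u unfolding w_def by blast
qed

text \<open>By induction on time, the assignment contains state, heads and all cells of the run on
  \<open>w\<close>. Inclusion is all that one-sided implications can give, and the prohibitions at
  the end need no more.\<close>

lemma tableau_cells:
  assumes input_cell: "\<And>b. b < 2 * Z \<Longrightarrow> \<alpha> (Cell 0 (word_tape w (int b - int Z)), 0, b)"
    and "t < Z" "j < num_tapes M" "b < 2 * Z"
  shows "\<alpha> (Cell j (cells_at M w t j (int b - int Z)), t, b)"
proof -
  define pos where "pos t j = nat (head_at M w t j + int Z)" for t j
  \<comment> \<open>At a time \<open>t < Z\<close> a head is at distance at most \<open>t\<close>
    from cell 0, so its shifted position lies strictly between 0 and \<open>2 * Z\<close>.\<close>
  have pos: "int (pos t j) = head_at M w t j + int Z" "0 < pos t j" "Suc (pos t j) < 2 * Z + 1"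
    if "j < num_tapes M" "t < Z" for t j
    using head_at_bound[OF wf_M that(1), of w t] that(2) by (auto simp: pos_def)
  have run: "\<alpha> (State (state_at M w t), t, 0) \<and> (\<forall>j<num_tapes M. \<alpha> (Head j, t, pos t j)) \<and>
      (\<forall>j<num_tapes M. \<forall>b<2 * Z. \<alpha> (Cell j (cells_at M w t j (int b - int Z)), t, b))" if "t < Z" for t
    using that
  proof (induction t)
    case 0
    have empty: "word_tape [] i = 0" for i
      by (auto simp: word_tape_def)
    have "\<alpha> (Cell j (cells_at M w 0 j (int b - int Z)), 0, b)" if "j < num_tapes M" "b < 2 * Z" for j b
      using initial_at(3)[OF that(1), of w] start_cells(3)[of j b] input_cell[of b] that
      by (cases "j = 0") (simp_all add: empty)
    moreover have "pos 0 j = Z" if "j < num_tapes M" for j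
      using initial_at(2)[OF that, of w] by (simp add: pos_def)
    ultimately show ?case
      using start_cells initial_at(1)[OF tapes_pos, of w] by simp
  next
    case (Suc t)
    define q where "q = state_at M w t"
    define rs where "rs = reads_at M w t"
    define q' acts where "q' = fst (move_result M q rs)" and "acts = snd (move_result M q rs)"
    have t: "t < 2 * Z" "Suc t < Z" using Suc.prems by auto
    have IH: "\<alpha> (State q, t, 0)" "\<And>j. j < num_tapes M \<Longrightarrow> \<alpha> (Head j, t, pos t j)"
      "\<And>j b. j < num_tapes M \<Longrightarrow> b < 2 * Z \<Longrightarrow> \<alpha> (Cell j (cells_at M w t j (int b - int Z)), t, b)"
      using Suc by (auto simp: q_def)
    have q: "q < num_states M"
      using run_invariant[OF wf_M, of t w] by (simp add: q_def)
    have rs: "length rs = num_tapes M" "\<forall>a\<in>set rs. a < num_syms M"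
      using reads_at[OF wf_M, where w = w and t = t] by (simp_all add: rs_def)
    have syms: "cells_at M w t j i < num_syms M" if "j < num_tapes M" for j i
      using run_invariant[OF wf_M, of t w] that by simp
    have pos_less: "pos t j < 2 * Z" "0 < pos t j" "head_at M w t j = int (pos t j) - int Z" if "j < num_tapes M" for j
      using pos[OF that, of t] t by auto
    have pos_Suc: "pos (Suc t) j < 2 * Z" "0 < pos (Suc t) j" "head_at M w (Suc t) j = int (pos (Suc t) j) - int Z"
      if "j < num_tapes M" for j
      using pos[OF that, of "Suc t"] t by auto
    have reads: "\<alpha> (Reads j (rs ! j), t, 0)" if j: "j < num_tapes M" for j
    proof -
      have rs_j: "rs ! j = cells_at M w t j (int (pos t j) - int Z)"
        using reads_at(3)[OF wf_M j, where w = w and t = t] pos_less(3)[OF j] by (simp add: rs_def)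
      show ?thesis
        using fire1[OF subsetD[OF in_schemes(1)[OF j, of "rs ! j"]], of always "Reads j (rs ! j)" "[5]" "[]"
            "[(Head j, [5], [6]), (Cell j (rs ! j), [5], [6])]" t "pos t j" 0]
          syms[OF j] IH(2)[OF j] IH(3)[OF j pos_less(1)[OF j]] t(1) pos_less(1)[OF j] Z_less(3)
        by (auto simp: read_schemes_def holds_simps val_simps atom_of_def rs_j)
    qed
    have situation: "list_all (\<lambda>l. \<alpha> (atom_of (inst t b c) l)) (situation M q rs)" for b c
      using IH(1) reads by (simp add: situation_def atom_of_def val_simps list_all_iff)
    have step: "S \<in> set (schemes M)" if "S \<in> set (step_schemes M q rs)" for S
      using in_schemes(2)[OF q rs] that by blast
    have guard: "holds x (inst t b c) step_guard" if "Suc b < 2 * Z" for b c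
      using that t by (simp add: step_guard_def holds_simps val_simps e0)
    have "\<alpha> (State q', Suc t, 0)"
      using fire1[OF step[OF step_schemesI(1)], of t 0 0] guard[of 0 0] situation t Z_less
      by (simp add: q'_def val_simps e0)
    then have state: "\<alpha> (State (state_at M w (Suc t)), Suc t, 0)"
      using step_at(1)[OF wf_M, of w t] by (simp add: q'_def q_def rs_def)
    have head: "\<alpha> (Head j, Suc t, pos (Suc t) j)" if j: "j < num_tapes M" for j
    proof -
      let ?m = "snd (acts ! j)"
      have moved: "int (pos (Suc t) j) = int (pos t j) + offset ?m"
        using step_at(3)[OF wf_M j, of w t] pos_less(3)[OF j] pos_Suc(3)[OF j] by (simp add: acts_def q_def rs_def)
      have "Suc (pos t j) < 2 * Z"
        using head_at_bound[OF wf_M j, of w t] t(2) pos_less(3)[OF j] by linarith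
      from move_vals[OF moved this pos_Suc(1)[OF j]] obtain b
        where b: "Suc b < 2 * Z" "val (inst t b 0) (move_from ?m) = pos t j" "val (inst t b 0) (move_to ?m) = pos (Suc t) j"
        by blast
      have "(step_guard, [(Head j, [5, 0], move_to ?m)], (Head j, [5], move_from ?m) # situation M q rs) \<in> set (schemes M)"
        unfolding acts_def by (intro step step_schemesI(3) j)
      then have "\<alpha> (Head j, val (inst t b 0) [5, 0], val (inst t b 0) (move_to ?m))"
      proof (rule fire1[OF _ t(1) _ Z_less(3) guard[OF b(1)]])
        show "b < 2 * Z" using b(1) by simp
        show "list_all (\<lambda>l. \<alpha> (atom_of (inst t b 0) l)) ((Head j, [5], move_from ?m) # situation M q rs)"
          using situation[of b 0] IH(2)[OF j] by (simp add: atom_of_def b(2)) (simp add: val_simps)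
      qed
      then show ?thesis
        unfolding b(3) by (simp add: val_simps e0)
    qed
    have "\<alpha> (Cell j (cells_at M w (Suc t) j (int b - int Z)), Suc t, b)" if j: "j < num_tapes M" and b: "b < 2 * Z" for j b
    proof (cases "b = pos t j")
      case True
      have "Suc b < 2 * Z"
        using head_at_bound[OF wf_M j, of w t] t pos_less(3)[OF j] True by auto
      moreover have "(step_guard, [(Cell j (fst (acts ! j)), [5, 0], [6])], (Head j, [5], [6]) # situation M q rs) \<in> set (schemes M)"
        unfolding acts_def by (intro step step_schemesI(2) j)
      ultimately have "\<alpha> (Cell j (fst (acts ! j)), Suc t, b)"
        using fire1[of step_guard "Cell j (fst (acts ! j))" "[5, 0]" "[6]" "(Head j, [5], [6]) # situation M q rs" t b 0]
          guard[of b 0] situation IH(2)[OF j] t(1) b Z_less(3) True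
        by (auto simp: val_simps e0 atom_of_def)
      then show ?thesis
        using step_at(2)[OF wf_M j, of w t] pos_less(3)[OF j] True by (simp add: acts_def q_def rs_def)
    next
      case False
      have "cells_at M w (Suc t) j (int b - int Z) = cells_at M w t j (int b - int Z)"
        using step_at(2)[OF wf_M j, of w t] pos_less(3)[OF j] False by simp
      moreover have "\<alpha> (Cell j a, Suc t, b)" if "a = cells_at M w t j (int b - int Z)" for a
        using fire1[OF subsetD[OF in_schemes(1)[OF j, of a]],
            of "CAnd (lt_cond [5, 0] [3]) (CNot (eq_cond [6] [7]))" "Cell j a" "[5, 0]" "[7]"
            "[(Head j, [5], [6]), (Cell j a, [5], [7])]" t "pos t j" b]
          syms[OF j] IH(2)[OF j] IH(3)[OF j b] t pos_less(1)[OF j] b that False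
        by (auto simp: read_schemes_def holds_simps val_simps atom_of_def e0)
      ultimately show ?thesis by simp
    qed
    with state head show ?case by simp
  qed
  then show ?thesis
    using assms(2-) by blast
qed

lemma accepting_if_fulfilled:
  "\<exists>u. length u \<le> P \<and> holds_word (cells_at M (enc_pair x u) (Z - 1) (num_tapes M - 1)) [True]"
proof -
  obtain u where u: "length u \<le> P" "\<And>b. b < 2 * Z \<Longrightarrow> \<alpha> (Cell 0 (word_tape (enc_pair x u) (int b - int Z)), 0, b)"
    using input_cells by blast
  define w where "w = enc_pair x u"
  define last where "last = num_tapes M - 1"
  have last: "last < num_tapes M" using tapes_pos by (simp add: last_def)
  have Z1: "Z - 1 < Z" "Z - Suc 0 < 2 * Z" "Suc (Z - 1) = Z" using Z by auto
  \<comment> \<open>One rule for both output cells: either the symbol is the required one, or some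
    output scheme forbids it and contradicts its being assigned.\<close>
  have final: "a = s"
    if "(eq_cond [5, 0] [3], [], [(Cell last a, [5], vs)]) \<in> set (output_schemes M) \<or> a = s"
      "\<alpha> (Cell last a, Z - 1, val (inst (Z - 1) 0 0) vs)" for a s vs
  proof (rule ccontr)
    assume "a \<noteq> s"
    with that(1) in_schemes(5) have "(eq_cond [5, 0] [3], [], [(Cell last a, [5], vs)]) \<in> set (schemes M)"
      by blast
    from fire[OF this, of "Z - 1" 0 0] show False
      using that(2) Z_less Z1 by (auto simp: holds_simps val_simps e0 atom_of_def)
  qed
  have cell: "\<alpha> (Cell last (cells_at M w (Z - 1) last (int b - int Z)), Z - 1, b)" if "b < 2 * Z" for b
    using tableau_cells[OF _ Z1(1) last that, of w] u(2) by (simp add: w_def)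
  have syms: "cells_at M w (Z - 1) last i < num_syms M" for i
    using run_invariant[OF wf_M, of "Z - 1" w] last by simp
  have "cells_at M w (Z - 1) last 0 = 2"
  proof (rule final)
    show "(eq_cond [5, 0] [3], [], [(Cell last (cells_at M w (Z - 1) last 0), [5], [3])]) \<in> set (output_schemes M) \<or>
        cells_at M w (Z - 1) last 0 = 2"
      using output_schemesI(1)[OF syms[of 0], folded last_def] by blast
    show "\<alpha> (Cell last (cells_at M w (Z - 1) last 0), Z - 1, val (inst (Z - 1) 0 0) [3])"
      using cell[OF Z_less(1)] by (simp add: val_simps e0)
  qed
  moreover have "cells_at M w (Z - 1) last 1 = 0"
  proof (rule final)
    show "(eq_cond [5, 0] [3], [], [(Cell last (cells_at M w (Z - 1) last 1), [5], [3, 0])]) \<in> set (output_schemes M) \<or>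
        cells_at M w (Z - 1) last 1 = 0"
      using output_schemesI(2)[OF syms[of 1], folded last_def] by blast
    show "\<alpha> (Cell last (cells_at M w (Z - 1) last 1), Z - 1, val (inst (Z - 1) 0 0) [3, 0])"
      using cell[OF Z_less(2)] by (simp add: val_simps e0)
  qed
  ultimately have "holds_word (cells_at M w (Z - 1) last) [True]"
    by (simp add: holds_word_def sym_of_bit_def)
  then show ?thesis
    using u(1) unfolding w_def last_def by blast
qed

end

end

context tableau
begin

lemma sat_schemes_iff: "sat_schemes x e0 (kinds M) (schemes M) \<longleftrightarrow>
    (\<exists>u. length u \<le> P \<and> holds_word (cells_at M (enc_pair x u) (Z - 1) (num_tapes M - 1)) [True])"
  using sat_if_accepting accepting_if_fulfilled unfolding sat_iff by blast

end

text \<open>Monotonicity carries the verifier's time bound from the longest admissible witness to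
  all shorter ones.\<close>

lemma poly_nat_mono: "a \<le> b \<Longrightarrow> poly q a \<le> poly q b" for q :: "nat poly" and a b :: nat
  by (induction q) (auto intro: add_mono mult_le_mono)

lemma length_enc_pair: "length (enc_pair x u) = 2 * length x + 1 + length u"
  by (simp add: enc_pair_def length_enc_word)

theorem theorem2: "NP_hard_on path_inputs MCES_yes"
  unfolding NP_hard_on_def
proof
  fix L
  assume "L \<in> NP"
  then obtain V and p :: "nat poly" where V: "poly_time V"
    and L: "\<And>x. x \<in> L \<longleftrightarrow> (\<exists>u. length u \<le> poly p (length x) \<and> V (enc_pair x u) = [True])"
    unfolding NP_def by blast
  from V obtain M and q :: "nat poly" where M: "wf_tm M"
    and q: "\<And>w. \<exists>t\<le>poly q (length w). halts_with ((step M ^^ t) (initial M w)) (V w)"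
    unfolding poly_time_def by blast
  \<comment> \<open>The verifier's input has at most \<open>2 * n + 1 + poly p n\<close> symbols, so
    the composed polynomial bounds its running time for every witness. The remaining summands make
    the pair fit into the tableau and leave the run finished by time \<open>Z - 1\<close>.\<close>
  define z where "z = pcompose q ([:1, 2:] + p) + p + [:3, 2:]"
  have z: "poly z n = poly q (2 * n + 1 + poly p n) + poly p n + 2 * n + 3" for n
  proof -
    have linear: "poly [:1, 2:] n + poly p n = 2 * n + 1 + poly p n" "poly [:3, 2:] n = 2 * n + 3"
      by simp_all
    show ?thesis
      unfolding z_def poly_add poly_pcompose linear by simp
  qed
  obtain f where f: "poly_time f" "\<And>x. f x \<in> path_inputs"
    "\<And>x. f x \<in> MCES_yes \<longleftrightarrow> sat_schemes x (base_env p z (smult 2 z) (length x)) (kinds M) (schemes M)"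
    using scheme_reduction[of "schemes M" "kinds M" p z "smult 2 z", OF wf_schemes[of _ M] distinct_kinds] by blast
  have "x \<in> L \<longleftrightarrow> f x \<in> MCES_yes" for x
  proof -
    define n where "n = length x"
    interpret tableau M x "base_env p z (smult 2 z) n" "poly p n" "poly z n"
      by unfold_locales (simp_all add: M base_env_def n_def z)
    have "V (enc_pair x u) = [True] \<longleftrightarrow>
        holds_word (cells_at M (enc_pair x u) (poly z n - 1) (num_tapes M - 1)) [True]" if "length u \<le> poly p n" for u
    proof -
      obtain t where t: "t \<le> poly q (length (enc_pair x u))"
        "halts_with ((step M ^^ t) (initial M (enc_pair x u))) (V (enc_pair x u))"
        using q by blast
      have "poly q (length (enc_pair x u)) \<le> poly q (2 * n + 1 + poly p n)"
        using that by (intro poly_nat_mono) (simp add: length_enc_pair n_def)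
      then have "t \<le> poly z n - 1"
        using t(1) by (simp add: z)
      from output_at[OF M this t(2)] show ?thesis by simp
    qed
    then show ?thesis
      unfolding L f(3) sat_schemes_iff[unfolded n_def] n_def by blast
  qed
  then show "\<exists>f. poly_time f \<and> (\<forall>x. f x \<in> path_inputs \<and> (x \<in> L \<longleftrightarrow> f x \<in> MCES_yes))"
    using f(1,2) by blast
qed

end
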